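(* Let $V_{H,1},V_{H,2}\subset H_0^1(\Omega)$ be the multiscale spaces built from the NLMC basis as described in the context, $V_H=V_{H,1}+V_{H,2}$, and let $u_{H,1}^n\in V_{H,1}$, $u_{H,2}^n\in V_{H,2}$ be computed by the partially explicit splitting scheme with time step $\Delta T$ and parameter $\omega\in[0,1]$ given there. Define the following error indicators. Type 1: $$\eta_1^n=\sqrt{\tfrac{\Delta T}{3}}\big(\|u_{H,1}^{n+1}-u_{H,1}^n\|_a+\gamma\|u_{H,2}^{n+1}-u_{H,2}^n\|_a\big)+\Delta T^{3/2}\|\partial_t^2u_{H,2}^{n+1}\|,$$ $$\eta_2^n=\gamma\sqrt{C_\omega\Delta T}\,\|u_{H,1}^{n+1}-u_{H,1}^n\|_a+\tfrac{\sqrt{\Delta T}}{3}\|u_{H,2}^{n+1}-u_{H,2}^n\|_a+\Delta T^{3/2}\|\partial_t^2u_{H,1}^{n+1}\|.$$ Type 2: $$\eta_1^n=\sqrt{\tfrac{\Delta T}{3}}\big(\|u_{H,1}^{n+1}-u_{H,1}^n\|_a+\gamma\|u_{H,2}^{n+1}-u_{H,2}^n\|_a\big)+\Delta T^{3/2}\|\partial_t^2u_{H,2}^{n+1}\|_{a^*},$$ $$\eta_2^n=\gamma\sqrt{C_\omega\Delta T}\,\|u_{H,1}^{n+1}-u_{H,1}^n\|_a+\tfrac{\sqrt{\Delta T}}{3}\|u_{H,2}^{n+1}-u_{H,2}^n\|_a+\Delta T^{3/2}\|\partial_t^2u_{H,1}^{n+1}\|_{a^*}.$$ Here $C_\omega=\frac13+\omega^2-\omega$,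 and $\gamma$ is the constant defined in the context. Then (for either type of indicator) there exist constants $D_1,D_2$ such that $$\mathcal R_v\le D_1(1-\gamma_x)^{-1/2}\big((\eta_1^n)^2+(\eta_2^n)^2\big)^{1/2}+D_2\|f(t)-F(t)\|_{L^2((T_n,T_{n+1}],L^2(\Omega))},$$ where $\mathcal R_v$ is the dual norm of the residual over $(T_n,T_{n+1}]$ and $\gamma_x$, $F$ are as defined in the context.
   Context: Setting: $\Omega$ is the computational domain, $V=H_0^1(\Omega)$, $(\cdot,\cdot)$ and $\|\cdot\|$ are the $L^2(\Omega)$ inner product and norm, $\kappa\in L^\infty(\Omega)$ is a permeability coefficient, $a(u,v)=\int_\Omega\kappa\nabla u\cdot\nabla v$, $\|v\|_a=a(v,v)^{1/2}$, and $\|\cdot\|_{a^*}$ is the dual norm (dual to $\|\cdot\|_a$). The medium is fractured: $\Omega$ consists of a background region (matrix) and finitely many explicitly known fracture networks, and $\kappa$ takes (positive) constant values of high contrast in the matrix and in the fractures. Multiscale spaces: $\{K_i\}_{i=1}^{N_c}$ are the blocks of a coarse partition of $\Omega$ of mesh size $H$; $K_i^+$ is $K_i$ enlarged by a few layers of neighbouring coarse blocks; $V_0(K_i^+)$ is the space of restrictions to $K_i^+$ of functions of $V$ having zero trace on $\partial K_i^+$. Write $K_i=K_{i,f}\cup K_{i,m}$, where $K_{i,f}$ is the fracture part, consisting of the non-connected fractures $f_1^{(i)},\dots,f_{m_i}^{(i)}$, and $K_{i,m}$ is its complement (matrix). For $1\le i\le N_c$, $0\le l\le m_i$, the NLMC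 basis function $\psi_l^{(i)}\in V_0(K_i^+)$, together with multipliers $\mu_0^{(j)},\mu_p^{(j)}\in\mathbb R$, solves $$a(\psi_l^{(i)},v)+\sum_{K_j\subset K_i^+}\Big(\mu_0^{(j)}\int_{K_{j,m}}v+\sum_{1\le p\le m_j}\mu_p^{(j)}\int_{f_p^{(j)}}v\Big)=0\quad\forall v\in V_0(K_i^+),$$ $$\int_{K_{j,m}}\psi_l^{(i)}=\delta_{ij}\delta_{l0},\qquad \int_{f_p^{(j)}}\psi_l^{(i)}=\delta_{ij}\delta_{lp}\qquad\forall K_j\subset K_i^+,\ 1\le p\le m_j .$$ Let $L=\sum_{i=1}^{N_c}m_i$, $\bar\psi=\frac1L\sum_{i=1}^{N_c}\sum_{l=0}^{m_i}\psi_l^{(i)}$, $s(u,v)=\int_\Omega\tilde\kappa uv$ with $\tilde\kappa=\sum_j\kappa|\nabla\chi_j|^2$ and $\{\chi_j\}$ the multiscale partition of unity functions, and $\tilde\psi_l^{(i)}=\psi_l^{(i)}-\frac{s(\psi_l^{(i)},\bar\psi)}{s(\bar\psi,\bar\psi)}\bar\psi$. Enumerate the $\tilde\psi_l^{(i)}$, $1\le l\le m_i$, $1\le i\le N_c$, as $\tilde\psi_1,\dots,\tilde\psi_L$. Then $$V_{H,1}=\mathrm{span}\{\tilde\psi_k:1\le k\le L-1\},\qquad V_{H,2}=\mathrm{span}\{\bar\psi,\ \psi_0^{(i)}:1\le i\le N_c\}.$$ The constant $\gamma$ is $$\gamma=\sup_{v_1\in V_{H,1},\,v_2\in V_{H,2}}\frac{(v_1,v_2)}{\|v_1\|\,\|v_2\|}<1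 .$$ Scheme: $T_n$ are the time points with step $\Delta T$, $f$ is the source term and $f^{n+1}$ its value at $T_{n+1}$. For all $v_1\in V_{H,1}$, $v_2\in V_{H,2}$, $$\Big(\tfrac{u_{H,1}^{n+1}-u_{H,1}^n}{\Delta T},v_1\Big)+\Big(\tfrac{u_{H,2}^{n}-u_{H,2}^{n-1}}{\Delta T},v_1\Big)+a(u_{H,1}^{n+1}+u_{H,2}^{n},v_1)=(f^{n+1},v_1),$$ $$\Big(\tfrac{u_{H,2}^{n+1}-u_{H,2}^n}{\Delta T},v_2\Big)+\Big(\tfrac{u_{H,1}^{n}-u_{H,1}^{n-1}}{\Delta T},v_2\Big)+a((1-\omega)u_{H,1}^{n}+\omega u_{H,1}^{n+1}+u_{H,2}^{n},v_2)=(f^{n+1},v_2).$$ Notation: $u_H^n=u_{H,1}^n+u_{H,2}^n$ and $\partial_t^2u_{H,i}^{n+1}=\frac{u_{H,i}^{n+1}-2u_{H,i}^n+u_{H,i}^{n-1}}{\Delta T^2}$. On $(T_n,T_{n+1}]$, $U(t)=u_H^n+\frac{t-T_n}{\Delta T}(u_H^{n+1}-u_H^n)$, and $F(t)$ is constant in time and equal to the $L^2$-projection of $f^{n+1}$ onto $V_H$, i.e. $(F(t),v)=(f^{n+1},v)$ for all $v\in V_H$. On $X_n=L^2((T_n,T_{n+1}];H^1(\Omega))$ put $$(u,v)_{X_n}=\int_{T_n}^{T_{n+1}}\Big(\int_\Omega uv+\int_\Omega\kappa\nabla u\cdot\nabla v\Big)dt,\qquad \|v\|_{X_n}=\Big(\int_{T_n}^{T_{n+1}}(\|v\|^2+\|v\|_a^2)\,dt\Big)^{1/2},$$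 and let $$\gamma_x=\sup_{\substack{v_1\in L^2((T_n,T_{n+1}];V_{H,1})\\ v_2\in L^2((T_n,T_{n+1}];V_{H,2})}}\frac{(v_1,v_2)_{X_n}}{\|v_1\|_{X_n}\|v_2\|_{X_n}}<1 .$$ The residual $R(U(t))$ is defined by $$\int_{T_n}^{T_{n+1}}(R(U(t)),v)\,dt=\int_{T_n}^{T_{n+1}}(f(t),v)\,dt-\int_{T_n}^{T_{n+1}}(U'(t),v)\,dt-\int_{T_n}^{T_{n+1}}a(U(t),v)\,dt,$$ and $$\mathcal R_v=\sup_{\substack{v\in L^2((T_n,T_{n+1}];V_H)\\ \|v\|_{X_n}=1}}\int_{T_n}^{T_{n+1}}(R(U(t)),v)\,dt .$$ *)

theory Defs
  imports "HOL-Analysis.Analysis"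
begin

section \<open>Function spaces\<close>

text \<open>
  Functions on an open set \<open>S\<close> are total functions on the ambient Euclidean space, integrated
  over \<open>S\<close> with Lebesgue measure; elements of function spaces are representatives, not classes.
\<close>

definition L2 :: "'a::euclidean_space set \<Rightarrow> ('a \<Rightarrow> 'b::euclidean_space) set" where
  "L2 S = {u. u \<in> borel_measurable (lebesgue_on S) \<and> integrable (lebesgue_on S) (\<lambda>x. (norm (u x))\<^sup>2)}"

definition l2_inner :: "'a::euclidean_space set \<Rightarrow> ('a \<Rightarrow> real) \<Rightarrow> ('a \<Rightarrow> real) \<Rightarrow> real" where
  "l2_inner S u v = (\<integral>x. u x * v x \<partial>lebesgue_on S)"

definition l2_norm :: "'a::euclidean_space set \<Rightarrow> ('a \<Rightarrow> real) \<Rightarrow> real" where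
  "l2_norm S u = sqrt (l2_inner S u u)"

primrec C_class :: "nat \<Rightarrow> ('a::euclidean_space \<Rightarrow> real) \<Rightarrow> bool" where
  "C_class 0 \<phi> \<longleftrightarrow> continuous_on UNIV \<phi>"
| "C_class (Suc k) \<phi> \<longleftrightarrow> (\<forall>x. \<phi> differentiable (at x)) \<and>
     (\<forall>b\<in>Basis. C_class k (\<lambda>x. frechet_derivative \<phi> (at x) b))"

definition test_function :: "'a::euclidean_space set \<Rightarrow> ('a \<Rightarrow> real) \<Rightarrow> bool" where
  "test_function S \<phi> \<longleftrightarrow> (\<forall>k. C_class k \<phi>) \<and>
     compact (closure {x. \<phi> x \<noteq> 0}) \<and> closure {x. \<phi> x \<noteq> 0} \<subseteq> S"

definition has_weak_gradient ::
  "'a::euclidean_space set \<Rightarrow> ('a \<Rightarrow> real) \<Rightarrow> ('a \<Rightarrow> 'a) \<Rightarrow> bool" where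
  "has_weak_gradient S u g \<longleftrightarrow> (\<forall>\<phi>. test_function S \<phi> \<longrightarrow> (\<forall>b\<in>Basis.
     (\<integral>x. u x * frechet_derivative \<phi> (at x) b \<partial>lebesgue_on S)
       = - (\<integral>x. (g x \<bullet> b) * \<phi> x \<partial>lebesgue_on S)))"

definition sobolev_H1 :: "'a::euclidean_space set \<Rightarrow> ('a \<Rightarrow> real) set" where
  "sobolev_H1 S = {u \<in> L2 S. \<exists>g\<in>L2 S. has_weak_gradient S u g}"

text \<open>The weak gradient, determined up to null sets for members of \<^const>\<open>sobolev_H1\<close>.\<close>

definition wgrad :: "'a::euclidean_space set \<Rightarrow> ('a \<Rightarrow> real) \<Rightarrow> 'a \<Rightarrow> 'a" where
  "wgrad S u = (SOME g. g \<in> L2 S \<and> has_weak_gradient S u g)"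

definition H1_norm :: "'a::euclidean_space set \<Rightarrow> ('a \<Rightarrow> real) \<Rightarrow> real" where
  "H1_norm S u = sqrt (\<integral>x. (u x)\<^sup>2 + (norm (wgrad S u x))\<^sup>2 \<partial>lebesgue_on S)"

text \<open>
  The closure of the test functions in \<open>H\<^sup>1\<close>. Members vanish outside \<open>S\<close>, so a member is already
  its own extension by zero to a larger set.
\<close>

definition sobolev_H10 :: "'a::euclidean_space set \<Rightarrow> ('a \<Rightarrow> real) set" where
  "sobolev_H10 S = {u \<in> sobolev_H1 S. (\<forall>x. x \<notin> S \<longrightarrow> u x = 0) \<and>
     (\<exists>\<phi>. (\<forall>k::nat. test_function S (\<phi> k)) \<and>
          (\<lambda>k. H1_norm S (\<lambda>x. u x - \<phi> k x)) \<longlonglongrightarrow> 0)}"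

definition a_form ::
  "'a::euclidean_space set \<Rightarrow> ('a \<Rightarrow> real) \<Rightarrow> ('a \<Rightarrow> real) \<Rightarrow> ('a \<Rightarrow> real) \<Rightarrow> real" where
  "a_form \<Omega> \<kappa> u v = (\<integral>x. \<kappa> x * (wgrad \<Omega> u x \<bullet> wgrad \<Omega> v x) \<partial>lebesgue_on \<Omega>)"

definition a_norm :: "'a::euclidean_space set \<Rightarrow> ('a \<Rightarrow> real) \<Rightarrow> ('a \<Rightarrow> real) \<Rightarrow> real" where
  "a_norm \<Omega> \<kappa> u = sqrt (a_form \<Omega> \<kappa> u u)"

text \<open>
  In suprema of quotients, here and below, the vectors of norm zero are not excluded: they
  contribute the value 0 by \<open>x / 0 = 0\<close>. Since the quotients change sign under \<open>v \<mapsto> -v\<close>, this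
  does not change the supremum, and it gives 0 when there are no other vectors.
\<close>

definition a_dual_norm :: "'a::euclidean_space set \<Rightarrow> ('a \<Rightarrow> real) \<Rightarrow> ('a \<Rightarrow> real) \<Rightarrow> real" where
  "a_dual_norm \<Omega> \<kappa> w = (SUP v\<in>sobolev_H10 \<Omega>. l2_inner \<Omega> w v / a_norm \<Omega> \<kappa> v)"

text \<open>
  The Bochner space \<open>L\<^sup>2(I; W)\<close> with respect to the norm \<open>nrm\<close> on \<open>W\<close>: strongly measurable
  functions (limits of \<open>W\<close>-valued simple functions) with square integrable norm.
\<close>

definition bochner_L2 ::
  "real set \<Rightarrow> (('a \<Rightarrow> real) \<Rightarrow> real) \<Rightarrow> ('a \<Rightarrow> real) set \<Rightarrow> (real \<Rightarrow> 'a \<Rightarrow> real) set" where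
  "bochner_L2 I nrm W = {v. (\<forall>t\<in>I. v t \<in> W) \<and>
     (\<exists>s. (\<forall>k::nat. finite (s k ` I) \<and> s k ` I \<subseteq> W \<and>
                (\<forall>w. {t\<in>I. s k t = w} \<in> sets lebesgue)) \<and>
          (AE t in lebesgue_on I. (\<lambda>k. nrm (\<lambda>x. v t x - s k t x)) \<longlonglongrightarrow> 0)) \<and>
     integrable (lebesgue_on I) (\<lambda>t. (nrm (v t))\<^sup>2)}"

definition lin_span :: "nat set \<Rightarrow> (nat \<Rightarrow> 'a \<Rightarrow> real) \<Rightarrow> ('a \<Rightarrow> real) set" where
  "lin_span J \<phi> = {\<lambda>x. \<Sum>k\<in>J. c k * \<phi> k x | c. True}"

definition space_sum :: "('a \<Rightarrow> real) set \<Rightarrow> ('a \<Rightarrow> real) set \<Rightarrow> ('a \<Rightarrow> real) set" where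
  "space_sum V1 V2 = {\<lambda>x. v1 x + v2 x | v1 v2. v1 \<in> V1 \<and> v2 \<in> V2}"


section \<open>The fractured medium and the coarse partition\<close>

text \<open>
  \<open>G 1, \<dots>, G Nf\<close> are the fracture networks, thick sets on each of which \<open>\<kappa>\<close> is a positive
  constant; the rest of \<open>\<Omega>\<close> is the matrix.
\<close>

definition fractured_medium ::
  "'a::euclidean_space set \<Rightarrow> ('a \<Rightarrow> real) \<Rightarrow> nat \<Rightarrow> (nat \<Rightarrow> 'a set) \<Rightarrow> bool" where
  "fractured_medium \<Omega> \<kappa> Nf G \<longleftrightarrow>
     open \<Omega> \<and> connected \<Omega> \<and> bounded \<Omega> \<and> \<Omega> \<noteq> {} \<and>
     (\<forall>s\<in>{1..Nf}. compact (G s) \<and> G s \<subseteq> closure \<Omega>) \<and> disjoint_family_on G {1..Nf} \<and>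
     (\<exists>km>0. \<forall>x \<in> \<Omega> - (\<Union>s\<in>{1..Nf}. G s). \<kappa> x = km) \<and>
     (\<forall>s\<in>{1..Nf}. \<exists>kf>0. \<forall>x \<in> \<Omega> \<inter> G s. \<kappa> x = kf)"

definition coarse_partition ::
  "'a::euclidean_space set \<Rightarrow> nat \<Rightarrow> (nat \<Rightarrow> 'a set) \<Rightarrow> real \<Rightarrow> bool" where
  "coarse_partition \<Omega> Nc K h \<longleftrightarrow>
     (\<forall>i\<in>{1..Nc}. compact (K i) \<and> interior (K i) \<noteq> {} \<and> closure (interior (K i)) = K i \<and>
        negligible (frontier (K i))) \<and>
     disjoint_family_on (\<lambda>i. interior (K i)) {1..Nc} \<and>
     (\<Union>i\<in>{1..Nc}. K i) = closure \<Omega> \<and>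
     h = Max ((\<lambda>i. diameter (K i)) ` {1..Nc})"

primrec block_layers :: "nat \<Rightarrow> (nat \<Rightarrow> 'a set) \<Rightarrow> nat \<Rightarrow> nat \<Rightarrow> nat set" where
  "block_layers Nc K i 0 = {i}"
| "block_layers Nc K i (Suc k) = {j\<in>{1..Nc}. \<exists>j'\<in>block_layers Nc K i k. K j \<inter> K j' \<noteq> {}}"

text \<open>The block \<open>K\<^sub>i\<^sup>+\<close>, with \<open>lay\<close> layers of neighbouring blocks added to \<open>K\<^sub>i\<close>.\<close>

definition oversampled :: "nat \<Rightarrow> (nat \<Rightarrow> 'a set) \<Rightarrow> nat \<Rightarrow> nat \<Rightarrow> 'a set" where
  "oversampled Nc K lay i = (\<Union>j\<in>block_layers Nc K i lay. K j)"

text \<open>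
  Vanishing trace on the boundary of the block is membership in \<open>H\<^sup>1\<^sub>0\<close> of its interior; the
  functions are extended by zero to \<open>\<Omega>\<close>.
\<close>

definition V0 :: "'a::euclidean_space set \<Rightarrow> 'a set \<Rightarrow> ('a \<Rightarrow> real) set" where
  "V0 \<Omega> B = sobolev_H10 (\<Omega> \<inter> interior B)"

text \<open>
  The fractures \<open>fr i 1, \<dots>, fr i (m i)\<close> of \<open>K\<^sub>i\<close> are the connected components of its fracture
  part; components of measure zero (a network merely touching the block) are disregarded.
\<close>

definition block_fractures ::
  "nat \<Rightarrow> (nat \<Rightarrow> 'a::euclidean_space set) \<Rightarrow> nat \<Rightarrow> (nat \<Rightarrow> 'a set) \<Rightarrow>
     (nat \<Rightarrow> nat) \<Rightarrow> (nat \<Rightarrow> nat \<Rightarrow> 'a set) \<Rightarrow> bool" where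
  "block_fractures Nf G Nc K m fr \<longleftrightarrow> (\<forall>i\<in>{1..Nc}.
     bij_betw (fr i) {1..m i}
       {C \<in> components (K i \<inter> (\<Union>s\<in>{1..Nf}. G s)). \<not> negligible C})"

definition block_matrix ::
  "(nat \<Rightarrow> 'a set) \<Rightarrow> (nat \<Rightarrow> nat) \<Rightarrow> (nat \<Rightarrow> nat \<Rightarrow> 'a set) \<Rightarrow> nat \<Rightarrow> 'a set" where
  "block_matrix K m fr i = K i - (\<Union>p\<in>{1..m i}. fr i p)"


section \<open>The NLMC basis and the multiscale spaces\<close>

definition nlmc_basis ::
  "'a::euclidean_space set \<Rightarrow> ('a \<Rightarrow> real) \<Rightarrow> nat \<Rightarrow> (nat \<Rightarrow> 'a set) \<Rightarrow> nat \<Rightarrow>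
     (nat \<Rightarrow> nat) \<Rightarrow> (nat \<Rightarrow> nat \<Rightarrow> 'a set) \<Rightarrow> (nat \<Rightarrow> nat \<Rightarrow> 'a \<Rightarrow> real) \<Rightarrow> bool" where
  "nlmc_basis \<Omega> \<kappa> Nc K lay m fr \<psi> \<longleftrightarrow> (\<forall>i\<in>{1..Nc}. \<forall>l\<in>{0..m i}.
     let B = oversampled Nc K lay i; J = {j\<in>{1..Nc}. K j \<subseteq> B} in
       \<psi> i l \<in> V0 \<Omega> B \<and>
       (\<exists>\<mu> :: nat \<Rightarrow> nat \<Rightarrow> real. \<forall>v\<in>V0 \<Omega> B.
          a_form \<Omega> \<kappa> (\<psi> i l) v +
          (\<Sum>j\<in>J. \<mu> j 0 * (LINT x:block_matrix K m fr j|lebesgue. v x) +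
                 (\<Sum>p=1..m j. \<mu> j p * (LINT x:fr j p|lebesgue. v x))) = 0) \<and>
       (\<forall>j\<in>J.
          (LINT x:block_matrix K m fr j|lebesgue. \<psi> i l x) = (if j = i \<and> l = 0 then 1 else 0) \<and>
          (\<forall>p\<in>{1..m j}.
             (LINT x:fr j p|lebesgue. \<psi> i l x) = (if j = i \<and> l = p then 1 else 0))))"

text \<open>
  Multiscale partition of unity subordinate to the coarse grid, with coarse nodes
  \<open>z 1, \<dots>, z Nv\<close>: nodal functions supported in the blocks containing the node and
  \<open>\<kappa>\<close>-harmonic inside each block. The data on the block edges are not prescribed.
\<close>

definition multiscale_pou ::
  "'a::euclidean_space set \<Rightarrow> ('a \<Rightarrow> real) \<Rightarrow> nat \<Rightarrow> (nat \<Rightarrow> 'a set) \<Rightarrow>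
     nat \<Rightarrow> (nat \<Rightarrow> 'a) \<Rightarrow> (nat \<Rightarrow> 'a \<Rightarrow> real) \<Rightarrow> bool" where
  "multiscale_pou \<Omega> \<kappa> Nc K Nv z \<theta> \<longleftrightarrow>
     (\<forall>x\<in>\<Omega>. (\<Sum>j=1..Nv. \<theta> j x) = 1) \<and>
     (\<forall>j\<in>{1..Nv}. z j \<in> closure \<Omega> \<and> \<theta> j \<in> sobolev_H1 \<Omega> \<and> continuous_on (closure \<Omega>) (\<theta> j) \<and>
        (\<forall>k\<in>{1..Nv}. \<theta> j (z k) = (if j = k then 1 else 0)) \<and>
        (\<forall>i\<in>{1..Nc}. z j \<notin> K i \<longrightarrow> (\<forall>x\<in>K i. \<theta> j x = 0)) \<and>
        (\<forall>i\<in>{1..Nc}. \<forall>v\<in>sobolev_H10 (\<Omega> \<inter> interior (K i)). a_form \<Omega> \<kappa> (\<theta> j) v = 0))"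

definition kappa_tilde ::
  "'a::euclidean_space set \<Rightarrow> ('a \<Rightarrow> real) \<Rightarrow> nat \<Rightarrow> (nat \<Rightarrow> 'a \<Rightarrow> real) \<Rightarrow> 'a \<Rightarrow> real" where
  "kappa_tilde \<Omega> \<kappa> Nv \<theta> x = (\<Sum>j=1..Nv. \<kappa> x * (norm (wgrad \<Omega> (\<theta> j) x))\<^sup>2)"

text \<open>In the next definitions \<open>kt\<close> is the weight \<^const>\<open>kappa_tilde\<close>.\<close>

definition s_form ::
  "'a::euclidean_space set \<Rightarrow> ('a \<Rightarrow> real) \<Rightarrow> ('a \<Rightarrow> real) \<Rightarrow> ('a \<Rightarrow> real) \<Rightarrow> real" where
  "s_form \<Omega> kt u v = (\<integral>x. kt x * u x * v x \<partial>lebesgue_on \<Omega>)"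

definition num_fractures :: "nat \<Rightarrow> (nat \<Rightarrow> nat) \<Rightarrow> nat" where
  "num_fractures Nc m = (\<Sum>i=1..Nc. m i)"

definition psi_bar ::
  "nat \<Rightarrow> (nat \<Rightarrow> nat) \<Rightarrow> (nat \<Rightarrow> nat \<Rightarrow> 'a \<Rightarrow> real) \<Rightarrow> 'a \<Rightarrow> real" where
  "psi_bar Nc m \<psi> x = 1 / real (num_fractures Nc m) * (\<Sum>i=1..Nc. \<Sum>l=0..m i. \<psi> i l x)"

definition psi_tilde ::
  "'a::euclidean_space set \<Rightarrow> ('a \<Rightarrow> real) \<Rightarrow> nat \<Rightarrow> (nat \<Rightarrow> nat) \<Rightarrow>
     (nat \<Rightarrow> nat \<Rightarrow> 'a \<Rightarrow> real) \<Rightarrow> nat \<Rightarrow> nat \<Rightarrow> 'a \<Rightarrow> real" where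
  "psi_tilde \<Omega> kt Nc m \<psi> i l x =
     \<psi> i l x - s_form \<Omega> kt (\<psi> i l) (psi_bar Nc m \<psi>) / s_form \<Omega> kt (psi_bar Nc m \<psi>) (psi_bar Nc m \<psi>)
               * psi_bar Nc m \<psi> x"

definition fracture_enumeration :: "nat \<Rightarrow> (nat \<Rightarrow> nat) \<Rightarrow> (nat \<Rightarrow> nat \<times> nat) \<Rightarrow> bool" where
  "fracture_enumeration Nc m e \<longleftrightarrow>
     bij_betw e {1..num_fractures Nc m} (SIGMA i:{1..Nc}. {1..m i})"

definition V_H1 ::
  "'a::euclidean_space set \<Rightarrow> ('a \<Rightarrow> real) \<Rightarrow> nat \<Rightarrow> (nat \<Rightarrow> nat) \<Rightarrow>
     (nat \<Rightarrow> nat \<Rightarrow> 'a \<Rightarrow> real) \<Rightarrow> (nat \<Rightarrow> nat \<times> nat) \<Rightarrow> ('a \<Rightarrow> real) set" where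
  "V_H1 \<Omega> kt Nc m \<psi> e = lin_span {1..num_fractures Nc m - 1}
     (\<lambda>k. psi_tilde \<Omega> kt Nc m \<psi> (fst (e k)) (snd (e k)))"

definition V_H2 ::
  "nat \<Rightarrow> (nat \<Rightarrow> nat) \<Rightarrow> (nat \<Rightarrow> nat \<Rightarrow> 'a \<Rightarrow> real) \<Rightarrow> ('a \<Rightarrow> real) set" where
  "V_H2 Nc m \<psi> = lin_span {0..Nc} (\<lambda>i. if i = 0 then psi_bar Nc m \<psi> else \<psi> i 0)"

definition gamma_const ::
  "'a::euclidean_space set \<Rightarrow> ('a \<Rightarrow> real) set \<Rightarrow> ('a \<Rightarrow> real) set \<Rightarrow> real" where
  "gamma_const \<Omega> V1 V2 =
     (SUP (v1, v2)\<in>V1 \<times> V2. l2_inner \<Omega> v1 v2 / (l2_norm \<Omega> v1 * l2_norm \<Omega> v2))"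


section \<open>The splitting scheme and the residual\<close>

definition time_slab :: "(nat \<Rightarrow> real) \<Rightarrow> nat \<Rightarrow> real set" where
  "time_slab T n = {T n<..T (Suc n)}"

text \<open>The step \<open>n\<close> uses the level \<open>n - 1\<close>, so the levels 0 and 1 are the starting values.\<close>

definition splitting_scheme ::
  "'a::euclidean_space set \<Rightarrow> ('a \<Rightarrow> real) \<Rightarrow> ('a \<Rightarrow> real) set \<Rightarrow> ('a \<Rightarrow> real) set \<Rightarrow>
     real \<Rightarrow> real \<Rightarrow> nat \<Rightarrow> (nat \<Rightarrow> real) \<Rightarrow> (real \<Rightarrow> 'a \<Rightarrow> real) \<Rightarrow>
     (nat \<Rightarrow> 'a \<Rightarrow> real) \<Rightarrow> (nat \<Rightarrow> 'a \<Rightarrow> real) \<Rightarrow> bool" where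
  "splitting_scheme \<Omega> \<kappa> V1 V2 \<Delta>T \<omega> N T f u1 u2 \<longleftrightarrow>
     (\<forall>n\<le>N. u1 n \<in> V1 \<and> u2 n \<in> V2) \<and>
     (\<forall>n. 1 \<le> n \<and> n < N \<longrightarrow>
        (\<forall>v1\<in>V1.
           l2_inner \<Omega> (\<lambda>x. (u1 (n + 1) x - u1 n x) / \<Delta>T) v1
           + l2_inner \<Omega> (\<lambda>x. (u2 n x - u2 (n - 1) x) / \<Delta>T) v1
           + a_form \<Omega> \<kappa> (\<lambda>x. u1 (n + 1) x + u2 n x) v1
           = l2_inner \<Omega> (f (T (n + 1))) v1) \<and>
        (\<forall>v2\<in>V2.
           l2_inner \<Omega> (\<lambda>x. (u2 (n + 1) x - u2 n x) / \<Delta>T) v2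
           + l2_inner \<Omega> (\<lambda>x. (u1 n x - u1 (n - 1) x) / \<Delta>T) v2
           + a_form \<Omega> \<kappa> (\<lambda>x. (1 - \<omega>) * u1 n x + \<omega> * u1 (n + 1) x + u2 n x) v2
           = l2_inner \<Omega> (f (T (n + 1))) v2))"

definition projected_source ::
  "'a::euclidean_space set \<Rightarrow> ('a \<Rightarrow> real) set \<Rightarrow> nat \<Rightarrow> (nat \<Rightarrow> real) \<Rightarrow>
     (real \<Rightarrow> 'a \<Rightarrow> real) \<Rightarrow> (real \<Rightarrow> 'a \<Rightarrow> real) \<Rightarrow> bool" where
  "projected_source \<Omega> VH N T f F \<longleftrightarrow> (\<forall>n<N. \<exists>g\<in>VH.
     (\<forall>v\<in>VH. l2_inner \<Omega> g v = l2_inner \<Omega> (f (T (n + 1))) v) \<and> (\<forall>t\<in>time_slab T n. F t = g))"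

text \<open>The interpolant of the slab \<open>n\<close>, written as an affine function of all real times.\<close>

definition interpolant ::
  "real \<Rightarrow> (nat \<Rightarrow> real) \<Rightarrow> (nat \<Rightarrow> 'a \<Rightarrow> real) \<Rightarrow> (nat \<Rightarrow> 'a \<Rightarrow> real) \<Rightarrow> nat \<Rightarrow>
     real \<Rightarrow> 'a \<Rightarrow> real" where
  "interpolant \<Delta>T T u1 u2 n t x =
     (u1 n x + u2 n x)
     + (t - T n) / \<Delta>T * ((u1 (n + 1) x + u2 (n + 1) x) - (u1 n x + u2 n x))"

definition X_inner ::
  "'a::euclidean_space set \<Rightarrow> ('a \<Rightarrow> real) \<Rightarrow> real set \<Rightarrow>
     (real \<Rightarrow> 'a \<Rightarrow> real) \<Rightarrow> (real \<Rightarrow> 'a \<Rightarrow> real) \<Rightarrow> real" where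
  "X_inner \<Omega> \<kappa> I u v = (\<integral>t. l2_inner \<Omega> (u t) (v t) + a_form \<Omega> \<kappa> (u t) (v t) \<partial>lebesgue_on I)"

definition X_norm ::
  "'a::euclidean_space set \<Rightarrow> ('a \<Rightarrow> real) \<Rightarrow> real set \<Rightarrow> (real \<Rightarrow> 'a \<Rightarrow> real) \<Rightarrow> real" where
  "X_norm \<Omega> \<kappa> I v = sqrt (\<integral>t. (l2_norm \<Omega> (v t))\<^sup>2 + (a_norm \<Omega> \<kappa> (v t))\<^sup>2 \<partial>lebesgue_on I)"

definition gamma_X ::
  "'a::euclidean_space set \<Rightarrow> ('a \<Rightarrow> real) \<Rightarrow> real set \<Rightarrow>
     ('a \<Rightarrow> real) set \<Rightarrow> ('a \<Rightarrow> real) set \<Rightarrow> real" where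
  "gamma_X \<Omega> \<kappa> I V1 V2 =
     (SUP (v1, v2)\<in>bochner_L2 I (H1_norm \<Omega>) V1 \<times> bochner_L2 I (H1_norm \<Omega>) V2.
        X_inner \<Omega> \<kappa> I v1 v2 / (X_norm \<Omega> \<kappa> I v1 * X_norm \<Omega> \<kappa> I v2))"

text \<open>The number \<open>\<integral>\<^sub>I (R(U(t)), v(t)) dt\<close>, the residual being defined by its action on \<open>v\<close>.\<close>

definition residual ::
  "'a::euclidean_space set \<Rightarrow> ('a \<Rightarrow> real) \<Rightarrow> real set \<Rightarrow>
     (real \<Rightarrow> 'a \<Rightarrow> real) \<Rightarrow> (real \<Rightarrow> 'a \<Rightarrow> real) \<Rightarrow> (real \<Rightarrow> 'a \<Rightarrow> real) \<Rightarrow> real" where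
  "residual \<Omega> \<kappa> I f U v =
     (\<integral>t. l2_inner \<Omega> (f t) (v t) \<partial>lebesgue_on I)
     - (\<integral>t. l2_inner \<Omega> (\<lambda>x. deriv (\<lambda>\<tau>. U \<tau> x) t) (v t) \<partial>lebesgue_on I)
     - (\<integral>t. a_form \<Omega> \<kappa> (U t) (v t) \<partial>lebesgue_on I)"

definition residual_dual_norm ::
  "'a::euclidean_space set \<Rightarrow> ('a \<Rightarrow> real) \<Rightarrow> real set \<Rightarrow> ('a \<Rightarrow> real) set \<Rightarrow>
     (real \<Rightarrow> 'a \<Rightarrow> real) \<Rightarrow> (real \<Rightarrow> 'a \<Rightarrow> real) \<Rightarrow> real" where
  "residual_dual_norm \<Omega> \<kappa> I VH f U =
     (SUP v\<in>{v \<in> bochner_L2 I (H1_norm \<Omega>) VH. X_norm \<Omega> \<kappa> I v = 1}. residual \<Omega> \<kappa> I f U v)"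

definition L2L2_norm :: "'a::euclidean_space set \<Rightarrow> real set \<Rightarrow> (real \<Rightarrow> 'a \<Rightarrow> real) \<Rightarrow> real" where
  "L2L2_norm \<Omega> I g = sqrt (\<integral>t. (l2_norm \<Omega> (g t))\<^sup>2 \<partial>lebesgue_on I)"


section \<open>Error indicators\<close>

definition second_diff :: "real \<Rightarrow> (nat \<Rightarrow> 'a \<Rightarrow> real) \<Rightarrow> nat \<Rightarrow> 'a \<Rightarrow> real" where
  "second_diff \<Delta>T u n x = (u (n + 1) x - 2 * u n x + u (n - 1) x) / \<Delta>T\<^sup>2"

definition C_omega :: "real \<Rightarrow> real" where
  "C_omega \<omega> = 1 / 3 + \<omega>\<^sup>2 - \<omega>"

text \<open>
  The indicators of both types: \<open>nrm\<close> is \<^const>\<open>l2_norm\<close> for the first type and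
  \<^const>\<open>a_dual_norm\<close> for the second. In \<open>eta2\<close> the factor of the second term is
  \<open>sqrt \<Delta>T / 3\<close>, unlike the \<open>sqrt (\<Delta>T / 3)\<close> of \<open>eta1\<close>.
\<close>

definition eta1 ::
  "(('a::euclidean_space \<Rightarrow> real) \<Rightarrow> real) \<Rightarrow> 'a set \<Rightarrow> ('a \<Rightarrow> real) \<Rightarrow> real \<Rightarrow> real \<Rightarrow>
     (nat \<Rightarrow> 'a \<Rightarrow> real) \<Rightarrow> (nat \<Rightarrow> 'a \<Rightarrow> real) \<Rightarrow> nat \<Rightarrow> real" where
  "eta1 nrm \<Omega> \<kappa> \<gamma> \<Delta>T u1 u2 n =
     sqrt (\<Delta>T / 3) * (a_norm \<Omega> \<kappa> (\<lambda>x. u1 (n + 1) x - u1 n x)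
                       + \<gamma> * a_norm \<Omega> \<kappa> (\<lambda>x. u2 (n + 1) x - u2 n x))
     + \<Delta>T powr (3 / 2) * nrm (second_diff \<Delta>T u2 n)"

definition eta2 ::
  "(('a::euclidean_space \<Rightarrow> real) \<Rightarrow> real) \<Rightarrow> 'a set \<Rightarrow> ('a \<Rightarrow> real) \<Rightarrow> real \<Rightarrow> real \<Rightarrow> real \<Rightarrow>
     (nat \<Rightarrow> 'a \<Rightarrow> real) \<Rightarrow> (nat \<Rightarrow> 'a \<Rightarrow> real) \<Rightarrow> nat \<Rightarrow> real" where
  "eta2 nrm \<Omega> \<kappa> \<gamma> \<omega> \<Delta>T u1 u2 n =
     \<gamma> * sqrt (C_omega \<omega> * \<Delta>T) * a_norm \<Omega> \<kappa> (\<lambda>x. u1 (n + 1) x - u1 n x)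
     + sqrt \<Delta>T / 3 * a_norm \<Omega> \<kappa> (\<lambda>x. u2 (n + 1) x - u2 n x)
     + \<Delta>T powr (3 / 2) * nrm (second_diff \<Delta>T u1 n)"

end

(*
  The residual is estimated for each time separately. For a test function v = v1 + v2 with vi in
  V_{H,i}, insert the i-th equation of the scheme into its action on vi: what remains are the second
  time differences of the other component and the a-products of vi with multiples, by factors of
  modulus at most 1, of the increments of both components. Hence the residual acts on v by at most
  ||f - F|| ||v|| + E1 |v1| + E2 |v2|, where |.|^2 = ||.||^2 + ||.||_a^2 and E1, E2 do not depend on
  time. Functions that are constant in time show that gamma_x also bounds the cosine between V_{H,1}
  and V_{H,2} in |.|, so |v1|^2 + |v2|^2 <= |v|^2 / (1 - gamma_x), and integration in time finishes
  the proof with D1 = 8 and D2 = 1. Of the increments, the first one is controlled by eta_1 and the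
  second one by eta_2, where they occur without the factor gamma; of gamma only gamma >= 0 matters.

  The suprema that define gamma, gamma_x and the dual norm are finite by the Cauchy-Schwarz and
  Poincare inequalities (otherwise Sup would be a junk value), and a(.,.) is bilinear because weak
  gradients, which are chosen by SOME, are unique almost everywhere.
*)

theory Submission
  imports Defs
begin

text \<open>The constants 8 and 1 are fixed before the medium, the grid, the basis and the scheme
  are chosen, so no embedding or trace constant may enter the final estimate. This is possible
  because the test function is measured in the full norm |.|, which dominates both the L2 norm and
  the energy norm: the two types of indicators then differ only in how the pairing with a second
  difference is bounded by |v|. Most of the work lies below the estimate. Uniqueness of weak
  gradients rests on the fundamental lemma for exactly the test functions of the definition, hence
  smooth bumps are built from exp (-1/x). The basis functions belong to H^1_0 of enlarged blocks,
  while the scheme takes their gradients on the whole domain; extension by zero connects the two.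
  The residual is a difference of three time integrals, which merge into one only once each
  integrand is known to be integrable, and measurability has to be drawn from simple approximations.
  Finally, the supremum over unit vectors would be a junk value if there were none; a basis function
  with integral 1 over the matrix part of its block excludes this.\<close>

section \<open>Calculus of the classes of continuously differentiable functions\<close>

lemma C_class_SucI:
  assumes "\<And>x. (f has_derivative f' x) (at x)" and "\<And>b. b \<in> Basis \<Longrightarrow> C_class k (\<lambda>x. f' x b)"
  shows "C_class (Suc k) f"
proof -
  have "frechet_derivative f (at x) = f' x" for x
    using assms(1) by (metis frechet_derivative_at)
  then show ?thesis
    using assms by (auto simp: differentiable_def)
qed

lemma C_class_SucD:
  assumes "C_class (Suc k) f"
  shows "(f has_derivative frechet_derivative f (at x)) (at x)"
    and "b \<in> Basis \<Longrightarrow> C_class k (\<lambda>x. frechet_derivative f (at x) b)"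
  using assms by (auto simp: frechet_derivative_works)

lemma C_class_continuous:
  assumes "C_class k f"
  shows "continuous_on UNIV f"
proof (cases k)
  case 0
  with assms show ?thesis by simp
next
  case (Suc j)
  with assms have "f differentiable (at x)" for x by simp
  then show ?thesis
    by (intro continuous_at_imp_continuous_on ballI differentiable_imp_continuous_within)
qed

text \<open>The product and chain rules for class \<open>Suc k\<close> multiply derivatives, which
  are of class \<open>k\<close>, by the functions themselves, so these have to be lowered by one
  order.\<close>

lemma C_class_mono: "C_class (Suc k) f \<Longrightarrow> C_class k f"
proof (induction k arbitrary: f)
  case 0
  then show ?case using C_class_continuous[OF 0] by simp
next
  case (Suc k)
  show ?case
    by (rule C_class_SucI[OF C_class_SucD(1)[OF Suc.prems] Suc.IH[OF C_class_SucD(2)[OF Suc.prems]]])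
qed

lemma C_class_const: "C_class k (\<lambda>x. c)"
proof (induction k arbitrary: c)
  case (Suc k)
  show ?case by (rule C_class_SucI[where f' = "\<lambda>x b. 0"]) (auto intro: Suc)
qed simp

lemma C_class_inner: "C_class k (\<lambda>x. x \<bullet> b)"
proof (cases k)
  case (Suc j)
  show ?thesis unfolding Suc
    by (rule C_class_SucI[where f' = "\<lambda>x h. h \<bullet> b"])
       (auto intro: C_class_const bounded_linear_imp_has_derivative bounded_linear_inner_left)
qed (simp add: continuous_intros)

lemma C_class_add: "C_class k f \<Longrightarrow> C_class k g \<Longrightarrow> C_class k (\<lambda>x. f x + g x)"
proof (induction k arbitrary: f g)
  case 0
  then show ?case by (auto intro: continuous_intros)
next
  case (Suc k)
  show ?case
    by (rule C_class_SucI[OF has_derivative_add[OF C_class_SucD(1)[OF Suc.prems(1)] C_class_SucD(1)[OF Suc.prems(2)]]])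
       (intro Suc.IH C_class_SucD(2)[OF Suc.prems(1)] C_class_SucD(2)[OF Suc.prems(2)])
qed

lemma C_class_mult: "C_class k f \<Longrightarrow> C_class k g \<Longrightarrow> C_class k (\<lambda>x. f x * g x)"
proof (induction k arbitrary: f g)
  case 0
  then show ?case by (auto intro: continuous_intros)
next
  case (Suc k)
  show ?case
    by (rule C_class_SucI[OF has_derivative_mult[OF C_class_SucD(1)[OF Suc.prems(1)] C_class_SucD(1)[OF Suc.prems(2)]]])
       (intro C_class_add Suc.IH C_class_mono[OF Suc.prems(1)] C_class_mono[OF Suc.prems(2)]
          C_class_SucD(2)[OF Suc.prems(1)] C_class_SucD(2)[OF Suc.prems(2)])
qed

lemma C_class_cmult: "C_class k f \<Longrightarrow> C_class k (\<lambda>x. c * f x)"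
  by (rule C_class_mult[OF C_class_const])

lemma C_class_prod: "finite B \<Longrightarrow> (\<And>b. b \<in> B \<Longrightarrow> C_class k (f b)) \<Longrightarrow> C_class k (\<lambda>x. \<Prod>b\<in>B. f b x)"
  by (induction B rule: finite_induct) (auto intro: C_class_const C_class_mult)

text \<open>The outer function comes as a sequence \<open>H\<close> of successive derivatives, and
  the induction is generalized over the index \<open>j\<close>: differentiating \<open>H j\<close>
  after \<open>f\<close> yields \<open>H (Suc j)\<close> after \<open>f\<close> times a derivative
  of \<open>f\<close>, which the induction hypothesis covers.\<close>

lemma C_class_compose:
  fixes H :: "nat \<Rightarrow> real \<Rightarrow> real"
  assumes H: "\<And>j x. (H j has_real_derivative H (Suc j) x) (at x)" and f: "C_class k f"
  shows "C_class k (\<lambda>x. H j (f x))"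
  using f
proof (induction k arbitrary: j)
  case 0
  have "continuous_on UNIV (H j)"
    using H by (meson DERIV_continuous_on has_field_derivative_at_within)
  with 0 show ?case using continuous_on_compose2[of UNIV "H j" UNIV f] by simp
next
  case (Suc k)
  have d: "((\<lambda>x. H j (f x)) has_derivative (\<lambda>h. H (Suc j) (f x) * frechet_derivative f (at x) h)) (at x)" for x
    by (rule has_derivative_compose[OF C_class_SucD(1)[OF Suc.prems] H[unfolded has_field_derivative_def]])
  show ?case
    by (rule C_class_SucI[OF d])
       (intro C_class_mult Suc.IH C_class_mono[OF Suc.prems] C_class_SucD(2)[OF Suc.prems])
qed

subsection \<open>Bump functions\<close>

text \<open>The polynomial factor makes the family closed under differentiation;
  \<open>p = 1\<close> is the usual smooth function that is flat at the origin.\<close>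

definition flat_fun :: "real poly \<Rightarrow> real \<Rightarrow> real" where
  "flat_fun p x = (if x > 0 then poly p (1 / x) * exp (- 1 / x) else 0)"

lemma tendsto_poly_div_exp_0:
  fixes p :: "real poly"
  shows "((\<lambda>x. poly p x / exp x) \<longlongrightarrow> 0) at_top"
proof -
  have "((\<lambda>x. \<Sum>i\<le>degree p. coeff p i * (x ^ i / exp x)) \<longlongrightarrow> (\<Sum>i\<le>degree p. coeff p i * 0)) at_top"
    by (intro tendsto_sum tendsto_mult tendsto_const tendsto_power_div_exp_0)
  then show ?thesis
    by (simp add: poly_altdef sum_divide_distrib)
qed

lemma flat_fun_tendsto_0: "((\<lambda>x. poly p (1 / x) * exp (- 1 / x)) \<longlongrightarrow> 0) (at_right (0::real))"
proof -
  have "filterlim (\<lambda>x::real. 1 / x) at_top (at_right 0)"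
    using filterlim_inverse_at_top_right by (simp add: inverse_eq_divide)
  from filterlim_compose[OF tendsto_poly_div_exp_0 this, of p] show ?thesis
    by (simp add: exp_minus divide_inverse)
qed

text \<open>In the variable y = 1/x one has d/dx = - y^2 d/dy, so the derivative of p(y) exp(-y) is
  y^2 (p - p')(y) exp(-y).\<close>

definition flat_step :: "real poly \<Rightarrow> real poly" where
  "flat_step p = [:0, 0, 1:] * (p - pderiv p)"

lemma flat_fun_deriv: "(flat_fun p has_real_derivative flat_fun (flat_step p) x) (at x)"
proof -
  consider "x > 0" | "x < 0" | "x = 0" by linarith
  then show ?thesis
  proof cases
    case 1
    have "((\<lambda>x. poly p (1 / x) * exp (- 1 / x)) has_real_derivative flat_fun (flat_step p) x) (at x)"
      using 1 by (auto intro!: derivative_eq_intros DERIV_chain2[OF poly_DERIV]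
          simp: flat_fun_def flat_step_def field_simps power2_eq_square)
    moreover have "open {0::real<..}" "x \<in> {0<..}" using 1 by auto
    ultimately show ?thesis
      by (rule has_field_derivative_transform_within_open) (auto simp: flat_fun_def)
  next
    case 2
    have "((\<lambda>x. 0) has_real_derivative flat_fun (flat_step p) x) (at x)"
      using 2 by (simp add: flat_fun_def)
    moreover have "open {..<0::real}" "x \<in> {..<0}" using 2 by auto
    ultimately show ?thesis
      by (rule has_field_derivative_transform_within_open) (auto simp: flat_fun_def)
  next
    case 3
    \<comment> \<open>The factor 1/h of the difference quotient at the origin is absorbed into the
      polynomial, which is multiplied by its variable.\<close>
    have "((\<lambda>h. flat_fun p h / h) \<longlongrightarrow> 0) (at_right 0)"
    proof (rule Lim_transform_eventually[OF flat_fun_tendsto_0[of "[:0, 1:] * p"]])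
      show "\<forall>\<^sub>F h in at_right 0. poly ([:0, 1:] * p) (1 / h) * exp (- 1 / h) = flat_fun p h / h"
        by (auto simp: flat_fun_def eventually_at_right_less eventually_at_filter)
    qed
    moreover have "((\<lambda>h. flat_fun p h / h) \<longlongrightarrow> 0) (at_left 0)"
      by (rule Lim_transform_eventually[OF tendsto_const])
         (auto simp: flat_fun_def eventually_at_filter)
    ultimately have "((\<lambda>h. flat_fun p h / h) \<longlongrightarrow> 0) (at 0)"
      by (simp add: filterlim_split_at)
    then show ?thesis
      using 3 by (simp add: has_field_derivative_iff flat_fun_def)
  qed
qed

definition smooth_step :: "real \<Rightarrow> real" where
  "smooth_step = flat_fun 1"

lemma smooth_step_simps:
  "smooth_step x = (if x > 0 then exp (- 1 / x) else 0)"
  by (simp add: smooth_step_def flat_fun_def)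

lemma smooth_step_bounds: "0 \<le> smooth_step x" "smooth_step x \<le> 1"
  by (auto simp: smooth_step_simps)

lemma smooth_step_eq_0: "smooth_step x = 0 \<longleftrightarrow> x \<le> 0"
  by (auto simp: smooth_step_simps)

lemma C_class_smooth_step: "C_class k f \<Longrightarrow> C_class k (\<lambda>x. smooth_step (f x))"
  using C_class_compose[where H = "\<lambda>j. flat_fun ((flat_step ^^ j) 1)" and j = 0, of k f] flat_fun_deriv
  by (auto simp: smooth_step_def)

lemma smooth_step_tendsto:
  "(\<lambda>k. smooth_step (real k * y)) \<longlonglongrightarrow> (if y > 0 then 1 else 0)"
proof (cases "y > 0")
  case True
  have "(\<lambda>k. exp (- (1 / y) * (1 / real k))) \<longlonglongrightarrow> exp (- (1 / y) * 0)"
    by (intro tendsto_intros lim_1_over_n)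
  then have l: "(\<lambda>k. exp (- 1 / (real k * y))) \<longlonglongrightarrow> 1" by (simp add: field_simps)
  have "(\<lambda>k. smooth_step (real k * y)) \<longlonglongrightarrow> 1"
    by (rule Lim_transform_eventually[OF l])
       (use True in \<open>auto intro!: eventually_sequentiallyI[of 1] simp: smooth_step_simps\<close>)
  with True show ?thesis by simp
next
  case False
  then have "smooth_step (real k * y) = 0" for k
    by (simp add: smooth_step_eq_0 mult_nonneg_nonpos)
  then show ?thesis using False by simp
qed

text \<open>A smooth substitute for the indicator of an open box: each coordinate contributes one
  step that switches on past the lower face and one that switches off before the upper face. Growing
  \<open>k\<close> sharpens the steps while all values stay in [0, 1], which allows dominated
  convergence.\<close>

definition bump :: "'a \<Rightarrow> 'a \<Rightarrow> nat \<Rightarrow> 'a::euclidean_space \<Rightarrow> real" where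
  "bump a c k x = (\<Prod>b\<in>Basis. smooth_step (real k * (x \<bullet> b - a \<bullet> b)) * smooth_step (real k * (c \<bullet> b - x \<bullet> b)))"

lemma C_class_bump: "C_class j (bump a c k)"
proof -
  have l: "C_class j (\<lambda>x. r * (x \<bullet> b - s))" for r s :: real and b :: 'a
    using C_class_cmult[OF C_class_add[OF C_class_inner C_class_const[where c = "-s"]], of j r b] by simp
  have m: "C_class j (\<lambda>x. r * (s - x \<bullet> b))" for r s :: real and b :: 'a
    using l[of "-r" b s] by (simp add: algebra_simps)
  show ?thesis
    unfolding bump_def by (intro C_class_prod C_class_mult C_class_smooth_step l m) simp
qed

lemma bump_bounds: "0 \<le> bump a c k x" "bump a c k x \<le> 1"
  unfolding bump_def
  by (auto intro!: prod_nonneg prod_le_1 mult_nonneg_nonneg mult_le_one smooth_step_bounds)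

lemma bump_support: "bump a c k x \<noteq> 0 \<Longrightarrow> x \<in> box a c"
  by (auto simp: bump_def mem_box smooth_step_eq_0 not_le zero_less_mult_iff)

lemma bump_tendsto: "(\<lambda>k. bump a c k x) \<longlonglongrightarrow> indicator (box a c) x"
proof -
  have "(\<lambda>k. bump a c k x) \<longlonglongrightarrow>
      (\<Prod>b\<in>Basis. (if x \<bullet> b - a \<bullet> b > 0 then 1 else 0) * (if c \<bullet> b - x \<bullet> b > 0 then 1 else (0::real)))"
    unfolding bump_def by (intro tendsto_prod tendsto_mult smooth_step_tendsto)
  also have "(\<Prod>b\<in>Basis. (if x \<bullet> b - a \<bullet> b > 0 then 1 else 0) * (if c \<bullet> b - x \<bullet> b > 0 then 1 else (0::real))) = indicator (box a c) x"
    by (auto simp: mem_box indicator_def intro!: prod.neutral)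
  finally show ?thesis .
qed

lemma bump_closure: "closure {x. bump a c k x \<noteq> 0} \<subseteq> cbox a c"
  by (rule closure_minimal) (use bump_support box_subset_cbox in blast)+

lemma test_function_bump: "cbox a c \<subseteq> S \<Longrightarrow> test_function S (bump a c k)"
  unfolding test_function_def
  using C_class_bump bump_closure[of a c k]
  using compact_Int_closed[OF compact_cbox closed_closure, of a c "{x. bump a c k x \<noteq> 0}"]
  by (auto simp: Int_absorb1)

subsection \<open>Integration by parts and the fundamental lemma\<close>

text \<open>Open boxes form an intersection-stable generator of the Borel sets, so the vanishing of
  the integral spreads from boxes to all Borel sets. The whole space is not a box; its integral is
  the separate assumption \<open>g0\<close>, used for complements.\<close>

lemma AE_eq_0_if_box_integrals_0:
  fixes g :: "'a::euclidean_space \<Rightarrow> real"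
  assumes g: "integrable lborel g" and g0: "integral\<^sup>L lborel g = 0"
    and box: "\<And>a c. (LINT x:box a c|lborel. g x) = 0"
  shows "AE x in lborel. g x = 0"
proof (rule sigma_finite_measure.density_zero[OF sigma_finite_lborel g])
  fix A :: "'a set" assume "A \<in> sets lborel"
  then have A: "A \<in> sigma_sets UNIV (range (\<lambda>(a, b). box a b))"
    by (simp add: borel_eq_box)
  have "Int_stable (range (\<lambda>(a::'a, b). box a b))"
    by (auto simp: Int_stable_def box_Int_box)
  moreover have "range (\<lambda>(a::'a, b). box a b) \<subseteq> Pow UNIV" by simp
  moreover note A
  ultimately show "(LINT x:A|lborel. g x) = 0"
  proof (induction rule: sigma_sets_induct_disjoint)
    case (compl A)
    then have A: "A \<in> sets lborel" by (simp add: borel_eq_box)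
    have "(LINT x:UNIV - A|lborel. g x) = integral\<^sup>L lborel (\<lambda>x. g x - indicator A x *\<^sub>R g x)"
      unfolding set_lebesgue_integral_def
      by (rule Bochner_Integration.integral_cong) (auto simp: indicator_def)
    also have "\<dots> = integral\<^sup>L lborel g - (LINT x:A|lborel. g x)"
      unfolding set_lebesgue_integral_def
      by (rule Bochner_Integration.integral_diff[OF g integrable_mult_indicator[OF A g]])
    finally show ?case using g0 compl by simp
  next
    case (union A)
    then have A: "A i \<in> sets lborel" for i by (auto simp: borel_eq_box)
    have "(LINT x:(\<Union>i. A i)|lborel. g x) = (\<Sum>i. LINT x:A i|lborel. g x)"
    proof (rule lebesgue_integral_countable_add[OF A])
      show "A i \<inter> A j = {}" if "i \<noteq> j" for i j
        using union(1) that by (auto simp: disjoint_family_on_def)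
      show "set_integrable lborel (\<Union>i. A i) g"
        unfolding set_integrable_def by (rule integrable_mult_indicator[OF _ g]) (use A in auto)
    qed
    then show ?case using union by simp
  qed (use box in \<open>auto simp: set_lebesgue_integral_def\<close>)
qed

lemma test_function_support:
  assumes "test_function S \<phi>"
  obtains K where "compact K" "K \<subseteq> S" "\<And>x. \<phi> x \<noteq> 0 \<Longrightarrow> x \<in> K"
  using assms closure_subset unfolding test_function_def by (metis (mono_tags, lifting) mem_Collect_eq subsetD)

text \<open>Testing with bumps and letting them sharpen shows that \<open>f\<close> has integral 0
  over every open box whose closed box lies in \<open>S\<close>. On each such box the function
  vanishes almost everywhere, and countably many of them cover \<open>S\<close>.\<close>

lemma fundamental_lemma:
  fixes f :: "'a::euclidean_space \<Rightarrow> real"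
  assumes S: "open S" and f: "integrable (lebesgue_on S) f"
    and test: "\<And>\<phi>. test_function S \<phi> \<Longrightarrow> (\<integral>x. f x * \<phi> x \<partial>lebesgue_on S) = 0"
  shows "AE x in lebesgue_on S. f x = 0"
proof -
  have SS: "S \<inter> space lebesgue \<in> sets lebesgue" using S by auto
  define h where "h x = indicator S x * f x" for x
  have h: "integrable lebesgue h"
    using f unfolding h_def integrable_restrict_space[OF SS] by simp
  \<comment> \<open>The box argument works with Borel functions, so the Lebesgue measurable
    \<open>h\<close> is replaced by a Borel function equal to it almost everywhere.\<close>
  obtain h' where h'm: "h' \<in> borel_measurable lborel" and hh': "AE x in lborel. h x = h' x"
    using completion_ex_borel_measurable_real[of h lborel] h by auto
  have hh'': "AE x in lebesgue. h x = h' x"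
    using hh' by (rule AE_completion)
  have h'l: "integrable lebesgue h'"
    using h by (subst integrable_cong_AE[OF _ _ hh'', symmetric])
      (use h measurable_completion[OF h'm] in auto)
  then have h': "integrable lborel h'"
    using integrable_completion[OF h'm] by simp
  have box0: "(LINT x:box a c|lborel. h' x) = 0" if ac: "cbox a c \<subseteq> S" for a c
  proof -
    have m: "bump a c k \<in> borel_measurable lebesgue" for k
      using borel_measurable_continuous_onI[OF C_class_continuous[OF C_class_bump[of 0 a c k]]]
      by (intro measurable_completion) simp
    have "(\<lambda>k. \<integral>x. h x * bump a c k x \<partial>lebesgue) \<longlonglongrightarrow> (\<integral>x. h x * indicator (box a c) x \<partial>lebesgue)"
    proof (rule integral_dominated_convergence[where w = "\<lambda>x. norm (h x)"])
      show "AE x in lebesgue. (\<lambda>i. h x * bump a c i x) \<longlonglongrightarrow> h x * indicat_real (box a c) x"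
        by (intro AE_I2 tendsto_intros bump_tendsto)
      show "AE x in lebesgue. norm (h x * bump a c i x) \<le> norm (h x)" for i
        using bump_bounds[of a c i] by (intro AE_I2) (simp add: abs_mult mult_left_le)
      show "(\<lambda>x. h x * indicat_real (box a c) x) \<in> borel_measurable lebesgue"
        using h by (intro borel_measurable_times borel_measurable_indicator fmeasurableD[OF lmeasurable_box]) auto
    qed (use m h in auto)
    moreover have "(\<integral>x. h x * bump a c k x \<partial>lebesgue) = 0" for k
      using test[OF test_function_bump[OF ac, of k]]
      unfolding integral_restrict_space[OF SS] h_def by (simp add: mult.assoc)
    ultimately have "(\<integral>x. h x * indicator (box a c) x \<partial>lebesgue) = 0"
      by (simp add: LIMSEQ_const_iff)
    moreover have "(\<integral>x. h x * indicator (box a c) x \<partial>lebesgue) = (\<integral>x. h' x * indicator (box a c) x \<partial>lebesgue)"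
      by (intro integral_cong_AE borel_measurable_times borel_measurable_indicator
          fmeasurableD[OF lmeasurable_box]) (use hh'' h h'l in auto)
    moreover have "\<dots> = (\<integral>x. h' x * indicator (box a c) x \<partial>lborel)"
      by (rule integral_completion) (use h'm in auto)
    ultimately show ?thesis
      unfolding set_lebesgue_integral_def by (simp add: mult.commute)
  qed
  define F where "F = {box a c | a c. cbox a c \<subseteq> S}"
  have "\<And>B. B \<in> F \<Longrightarrow> open B" by (auto simp: F_def)
  then obtain F' where F': "F' \<subseteq> F" "countable F'" "\<Union>F' = \<Union>F"
    by (rule Lindelof)
  have "\<Union>F' = S"
    unfolding F'(3)
  proof (intro equalityI subsetI)
    fix x assume "x \<in> S"
    from open_contains_cbox[OF S this] obtain a c where "cbox a c \<subseteq> S" "x \<in> box a c" by metis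
    then show "x \<in> \<Union>F" unfolding F_def by blast
  next
    fix x assume "x \<in> \<Union>F"
    then obtain a c where "cbox a c \<subseteq> S" "x \<in> box a c" unfolding F_def by blast
    then show "x \<in> S" using box_subset_cbox[of a c] by blast
  qed
  have "AE x in lborel. x \<in> B \<longrightarrow> h' x = 0" if BF: "B \<in> F'" for B
  proof -
    obtain a c where B: "B = box a c" "cbox a c \<subseteq> S" using BF F'(1) unfolding F_def by blast
    have "AE x in lborel. indicator B x *\<^sub>R h' x = 0"
    proof (rule AE_eq_0_if_box_integrals_0)
      show "integrable lborel (\<lambda>x. indicator B x *\<^sub>R h' x)"
        by (rule integrable_mult_indicator[OF _ h']) (simp add: B)
      show "integral\<^sup>L lborel (\<lambda>x. indicator B x *\<^sub>R h' x) = 0"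
        using box0[OF B(2)] unfolding B set_lebesgue_integral_def .
      fix a' c'
      obtain a'' c'' where i: "box a c \<inter> box a' c' = box a'' c''"
        using box_Int_box by blast
      show "(LINT x:box a' c'|lborel. indicator B x *\<^sub>R h' x) = 0"
      proof (cases "box a'' c'' = {}")
        case True
        then show ?thesis using i
          unfolding set_lebesgue_integral_def B
          by (intro integral_eq_zero_AE AE_I2) (auto simp: indicator_def)
      next
        \<comment> \<open>An empty open box may come from a degenerate closed box that need not lie
          in \<open>cbox a c\<close>; only for a nonempty one is the closed box its closure.\<close>
        case False
        have "cbox a'' c'' \<subseteq> cbox a c"
          using closure_mono[of "box a'' c''" "cbox a c"] i closure_box[OF False] box_subset_cbox[of a c] by auto
        then have "(LINT x:box a'' c''|lborel. h' x) = 0" using B(2) by (intro box0) auto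
        then show ?thesis
          unfolding i[symmetric] set_lebesgue_integral_def B by (simp add: indicator_inter_arith mult_ac)
      qed
    qed
    then show ?thesis by eventually_elim (auto simp: indicator_def)
  qed
  then have "AE x in lborel. \<forall>B\<in>F'. x \<in> B \<longrightarrow> h' x = 0"
    unfolding AE_ball_countable[OF F'(2)] by blast
  then have "AE x in lborel. x \<in> S \<longrightarrow> f x = 0"
    using hh'
  proof eventually_elim
    case (elim x)
    then show ?case
      unfolding \<open>\<Union>F' = S\<close>[symmetric] h_def by (metis UnionE UnionI indicator_simps(1) mult_1)
  qed
  then have "AE x in lebesgue. x \<in> S \<longrightarrow> f x = 0"
    by (rule AE_completion)
  then show ?thesis
    using AE_restrict_space_iff[OF SS] by simp
qed

text \<open>By translation invariance every difference quotient along \<open>b\<close> has integral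
  0. The quotients converge to the derivative and are dominated by means of the mean value
  theorem.\<close>

lemma integral_directional_derivative_0:
  fixes \<psi> :: "'a::euclidean_space \<Rightarrow> real"
  assumes \<psi>: "C_class 1 \<psi>" and K: "compact K" and supp: "\<And>x. \<psi> x \<noteq> 0 \<Longrightarrow> x \<in> K" and b: "b \<in> Basis"
  shows "(\<integral>x. frechet_derivative \<psi> (at x) b \<partial>lebesgue) = 0"
proof -
  define D where "D x = frechet_derivative \<psi> (at x) b" for x
  have der: "(\<psi> has_derivative frechet_derivative \<psi> (at x)) (at x)" for x
    using C_class_SucD(1)[of 0 \<psi>] \<psi> by simp
  have cD: "continuous_on UNIV D"
    using C_class_SucD(2)[of 0 \<psi> b] \<psi> b by (simp add: D_def)
  have c\<psi>: "continuous_on UNIV \<psi>" using C_class_continuous[OF \<psi>] .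
  have m\<psi> [measurable]: "\<psi> \<in> borel_measurable borel"
    by (rule borel_measurable_continuous_onI[OF c\<psi>])
  have mD [measurable]: "D \<in> borel_measurable borel"
    by (rule borel_measurable_continuous_onI[OF cD])
  obtain R where R: "R > 0" "K \<subseteq> cball 0 R"
    using bounded_subset_ballD[OF compact_imp_bounded[OF K], of 0]
    by (metis ball_subset_cball subset_trans)
  have supp': "\<psi> x = 0" if "norm x > R" for x
    using supp[of x] R(2) that by (auto simp: subset_iff not_le[symmetric])
  have directional: "((\<lambda>s. \<psi> (x + s *\<^sub>R b)) has_real_derivative D (x + s *\<^sub>R b)) (at s)" for x s
  proof -
    have "((\<lambda>s. \<psi> (x + s *\<^sub>R b)) has_derivative (\<lambda>h. frechet_derivative \<psi> (at (x + s *\<^sub>R b)) (h *\<^sub>R b))) (at s)"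
      by (rule has_derivative_compose[OF _ der]) (auto intro!: derivative_eq_intros)
    moreover have "frechet_derivative \<psi> (at (x + s *\<^sub>R b)) (h *\<^sub>R b) = D (x + s *\<^sub>R b) * h" for h
      using linear_scale[OF linear_frechet_derivative[of \<psi> "at (x + s *\<^sub>R b)"], of h b] der
      by (force simp: D_def differentiable_def)
    ultimately show ?thesis by (simp add: has_field_derivative_def)
  qed
  \<comment> \<open>A shift has length at most 1, so the quotients vanish outside radius R + 1, and
    the intermediate points for the remaining arguments have norm at most R + 2.\<close>
  obtain M where M: "\<And>x. x \<in> cball 0 (R + 2) \<Longrightarrow> \<bar>D x\<bar> \<le> M"
  proof -
    have "compact (D ` cball 0 (R + 2))"
      by (rule compact_continuous_image[OF continuous_on_subset[OF cD]]) auto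
    then show ?thesis using that compact_imp_bounded[of "D ` cball 0 (R + 2)"]
      unfolding bounded_iff by fastforce
  qed
  define q where "q k x = real (Suc k) * (\<psi> (x + (1 / real (Suc k)) *\<^sub>R b) - \<psi> x)" for k x
  have nb: "norm b = 1" using b by simp
  have qb: "norm (q k x) \<le> indicator (cball 0 (R + 1)) x * M" for k x
  proof (cases "norm x \<le> R + 1")
    case True
    let ?h = "1 / real (Suc k)"
    have h: "0 < ?h" "?h \<le> 1" by auto
    obtain \<xi> where \<xi>: "0 < \<xi>" "\<xi> < ?h" "\<psi> (x + ?h *\<^sub>R b) - \<psi> (x + 0 *\<^sub>R b) = (?h - 0) * D (x + \<xi> *\<^sub>R b)"
      using MVT2[OF h(1), of "\<lambda>s. \<psi> (x + s *\<^sub>R b)" "\<lambda>s. D (x + s *\<^sub>R b)"] directional by blast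
    have "q k x = D (x + \<xi> *\<^sub>R b)" using \<xi>(3) by (simp add: q_def field_simps)
    moreover have "norm (x + \<xi> *\<^sub>R b) \<le> R + 2"
    proof -
      have "norm (\<xi> *\<^sub>R b) = \<xi>" using \<xi>(1) nb by simp
      then show ?thesis
        using norm_triangle_ineq[of x "\<xi> *\<^sub>R b"] True less_le_trans[OF \<xi>(2) h(2)] by linarith
    qed
    ultimately show ?thesis using M True by simp
  next
    case False
    have "norm ((1 / real (Suc k)) *\<^sub>R b) \<le> 1" using nb by simp
    then have "norm (x + (1 / real (Suc k)) *\<^sub>R b) > R"
      using False norm_diff_ineq[of x "(1 / real (Suc k)) *\<^sub>R b"] by linarith
    then have "q k x = 0" unfolding q_def using False supp'[of x] supp'[of "x + (1 / real (Suc k)) *\<^sub>R b"] by simp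
    then show ?thesis using False by simp
  qed
  have i\<psi>: "integrable lborel \<psi>"
  proof -
    have "integrable lborel (\<lambda>x. indicator (cball 0 R) x *\<^sub>R \<psi> x)"
      by (rule borel_integrable_compact) (auto intro: continuous_on_subset[OF c\<psi>])
    moreover have "(\<lambda>x. indicator (cball 0 R) x *\<^sub>R \<psi> x) = \<psi>"
      using supp' by (auto simp: indicator_def fun_eq_iff not_le)
    ultimately show ?thesis by simp
  qed
  have tr: "integrable lborel (\<lambda>x. \<psi> (x + c))" "(\<integral>x. \<psi> (x + c) \<partial>lborel) = (\<integral>x. \<psi> x \<partial>lborel)" for c
  proof -
    have *: "(+) c \<in> lborel \<rightarrow>\<^sub>M borel" by simp
    show "(\<integral>x. \<psi> (x + c) \<partial>lborel) = (\<integral>x. \<psi> x \<partial>lborel)"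
      using integral_distr[OF * m\<psi>] by (simp add: lborel_distr_plus add.commute)
    show "integrable lborel (\<lambda>x. \<psi> (x + c))"
      using integrable_distr_eq[OF * m\<psi>] i\<psi> by (simp add: lborel_distr_plus add.commute)
  qed
  have q0: "(\<integral>x. q k x \<partial>lborel) = 0" for k
    unfolding q_def using tr i\<psi> by simp
  have "(\<lambda>k. \<integral>x. q k x \<partial>lborel) \<longlonglongrightarrow> (\<integral>x. D x \<partial>lborel)"
  proof (rule integral_dominated_convergence[where w = "\<lambda>x. indicator (cball 0 (R + 1)) x * M"])
    show "AE x in lborel. (\<lambda>k. q k x) \<longlonglongrightarrow> D x"
    proof (rule AE_I2)
      fix x
      have "((\<lambda>h. (\<psi> (x + h *\<^sub>R b) - \<psi> x) / h) \<longlongrightarrow> D x) (at 0)"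
        using directional[of x 0] by (simp add: has_field_derivative_iff)
      moreover have "filterlim (\<lambda>k. 1 / real (Suc k)) (at 0) sequentially"
        unfolding filterlim_at using LIMSEQ_Suc[OF lim_1_over_n] by auto
      ultimately have "(\<lambda>k. (\<psi> (x + (1 / real (Suc k)) *\<^sub>R b) - \<psi> x) / (1 / real (Suc k))) \<longlonglongrightarrow> D x"
        by (rule filterlim_compose)
      then show "(\<lambda>k. q k x) \<longlonglongrightarrow> D x" by (simp add: q_def mult.commute)
    qed
    show "integrable lborel (\<lambda>x. indicat_real (cball 0 (R + 1)) x * M)"
      using borel_integrable_compact[of "cball 0 (R + 1)" "\<lambda>x. M"] by simp
    show "AE x in lborel. norm (q k x) \<le> indicator (cball 0 (R + 1)) x * M" for k
      by (rule AE_I2) (rule qb)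
    show "q k \<in> borel_measurable lborel" for k
      unfolding q_def by measurable
  qed simp
  then have "(\<integral>x. D x \<partial>lborel) = 0"
    unfolding q0 by (rule LIMSEQ_unique) (rule tendsto_const)
  then show ?thesis
    using integral_completion[of D lborel] mD unfolding D_def by simp
qed

lemma frechet_derivative_eq_0_outside:
  assumes "closed K" "\<And>x. \<phi> x \<noteq> 0 \<Longrightarrow> x \<in> K" "x \<notin> K"
  shows "frechet_derivative \<phi> (at x) = (\<lambda>h. 0)"
proof -
  have "((\<lambda>x. 0) has_derivative (\<lambda>h. 0)) (at x)" by simp
  then have "(\<phi> has_derivative (\<lambda>h. 0)) (at x)"
    by (rule has_derivative_transform_within_open[of _ _ _ _ "- K"]) (use assms in auto)
  then show ?thesis by (metis frechet_derivative_at)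
qed

lemma frechet_derivative_mult:
  fixes f g :: "'a::euclidean_space \<Rightarrow> real"
  assumes "C_class 1 f" "C_class 1 g"
  shows "frechet_derivative (\<lambda>x. f x * g x) (at x) b =
    f x * frechet_derivative g (at x) b + frechet_derivative f (at x) b * g x"
proof -
  have "C_class (Suc 0) f" "C_class (Suc 0) g" using assms by auto
  from frechet_derivative_at[OF has_derivative_mult[OF C_class_SucD(1)[OF this(1)] C_class_SucD(1)[OF this(2)]]]
  show ?thesis by metis
qed

lemma integral_compact_support:
  fixes f :: "'a::euclidean_space \<Rightarrow> real"
  assumes "continuous_on UNIV f" "compact K" "\<And>x. x \<notin> K \<Longrightarrow> f x = 0"
  shows "integrable lebesgue f"
proof -
  have "integrable lborel (\<lambda>x. indicator K x *\<^sub>R f x)"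
    by (rule borel_integrable_compact[OF assms(2) continuous_on_subset[OF assms(1)]]) auto
  moreover have "(\<lambda>x. indicator K x *\<^sub>R f x) = f"
    using assms(3) by (auto simp: indicator_def fun_eq_iff)
  ultimately show ?thesis
    using integrable_completion[OF borel_measurable_integrable[of lborel f]] by simp
qed

text \<open>The product has compact support, so its directional derivative integrates to 0. The
  support condition is put on \<open>f\<close> alone, so that \<open>g\<close> may later be a
  coordinate function.\<close>

lemma integration_by_parts:
  fixes f g :: "'a::euclidean_space \<Rightarrow> real"
  assumes f: "C_class 1 f" and g: "C_class 1 g" and K: "compact K"
    and supp: "\<And>x. f x \<noteq> 0 \<Longrightarrow> x \<in> K" and b: "b \<in> Basis"
  shows "(\<integral>x. f x * frechet_derivative g (at x) b \<partial>lebesgue) = - (\<integral>x. frechet_derivative f (at x) b * g x \<partial>lebesgue)"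
proof -
  have c: "continuous_on UNIV f" "continuous_on UNIV g"
    "continuous_on UNIV (\<lambda>x. frechet_derivative f (at x) b)" "continuous_on UNIV (\<lambda>x. frechet_derivative g (at x) b)"
    using f g b C_class_continuous[OF f] C_class_continuous[OF g] by auto
  have i1: "integrable lebesgue (\<lambda>x. f x * frechet_derivative g (at x) b)"
  proof (rule integral_compact_support[OF _ K])
    show "continuous_on UNIV (\<lambda>x. f x * frechet_derivative g (at x) b)"
      by (rule continuous_on_mult[OF c(1) c(4)])
  qed (use supp in auto)
  have i2: "integrable lebesgue (\<lambda>x. frechet_derivative f (at x) b * g x)"
  proof (rule integral_compact_support[OF _ K])
    show "continuous_on UNIV (\<lambda>x. frechet_derivative f (at x) b * g x)"
      by (rule continuous_on_mult[OF c(3) c(2)])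
    show "frechet_derivative f (at x) b * g x = 0" if "x \<notin> K" for x
      using frechet_derivative_eq_0_outside[OF compact_imp_closed[OF K], of f x, OF supp that] by simp
  qed
  have "(\<integral>x. frechet_derivative (\<lambda>x. f x * g x) (at x) b \<partial>lebesgue) = 0"
    by (rule integral_directional_derivative_0[OF C_class_mult[OF f g] K _ b]) (use supp in auto)
  then show ?thesis
    using i1 i2 by (simp add: frechet_derivative_mult[OF f g])
qed

subsection \<open>Square integrable functions and semi-inner products\<close>

lemma L2_inner_integrable:
  assumes "u \<in> L2 S" "v \<in> L2 S"
  shows "integrable (lebesgue_on S) (\<lambda>x. u x \<bullet> v x)"
proof (rule Bochner_Integration.integrable_bound)
  show "integrable (lebesgue_on S) (\<lambda>x. (norm (u x))\<^sup>2 + (norm (v x))\<^sup>2)"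
    using assms by (auto simp: L2_def)
  show "(\<lambda>x. u x \<bullet> v x) \<in> borel_measurable (lebesgue_on S)"
    using assms by (auto simp: L2_def)
  show "AE x in lebesgue_on S. norm (u x \<bullet> v x) \<le> norm ((norm (u x))\<^sup>2 + (norm (v x))\<^sup>2)"
  proof (rule AE_I2)
    fix x
    have "norm (u x \<bullet> v x) \<le> norm (u x) * norm (v x)"
      using Cauchy_Schwarz_ineq2 by simp
    also have "\<dots> \<le> (norm (u x))\<^sup>2 + (norm (v x))\<^sup>2"
      using sum_squares_bound[of "norm (u x)" "norm (v x)"] mult_nonneg_nonneg[OF norm_ge_zero[of "u x"] norm_ge_zero[of "v x"]]
      by linarith
    finally show "norm (u x \<bullet> v x) \<le> norm ((norm (u x))\<^sup>2 + (norm (v x))\<^sup>2)" by simp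
  qed
qed

lemma L2_mult_integrable:
  fixes u v :: "'a::euclidean_space \<Rightarrow> real"
  shows "u \<in> L2 S \<Longrightarrow> v \<in> L2 S \<Longrightarrow> integrable (lebesgue_on S) (\<lambda>x. u x * v x)"
  using L2_inner_integrable[of u S v] by simp

lemma L2_comb:
  assumes "u \<in> L2 S" "v \<in> L2 S"
  shows "(\<lambda>x. u x + c *\<^sub>R v x) \<in> L2 S"
proof -
  have "integrable (lebesgue_on S) (\<lambda>x. u x \<bullet> u x + 2 * c * (u x \<bullet> v x) + c\<^sup>2 * (v x \<bullet> v x))"
    by (intro Bochner_Integration.integrable_add integrable_mult_right L2_inner_integrable assms)
  moreover have "(\<lambda>x. u x \<bullet> u x + 2 * c * (u x \<bullet> v x) + c\<^sup>2 * (v x \<bullet> v x)) = (\<lambda>x. (norm (u x + c *\<^sub>R v x))\<^sup>2)"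
    unfolding power2_norm_eq_inner
    by (simp add: fun_eq_iff inner_add_left inner_add_right inner_commute power2_eq_square algebra_simps)
  ultimately show ?thesis
    using assms by (auto simp: L2_def)
qed

lemma L2_comb_real:
  fixes u v :: "'a::euclidean_space \<Rightarrow> real"
  shows "u \<in> L2 S \<Longrightarrow> v \<in> L2 S \<Longrightarrow> (\<lambda>x. u x + c * v x) \<in> L2 S"
  using L2_comb[of u S v c] by simp

lemma L2_zero: "(\<lambda>x. 0) \<in> L2 S"
  by (simp add: L2_def)

lemma L2_bound:
  assumes "u \<in> L2 S" "v \<in> borel_measurable (lebesgue_on S)"
    and "\<And>x. x \<in> S \<Longrightarrow> norm (v x) \<le> R * norm (u x)"
  shows "v \<in> L2 S"
proof -
  have "integrable (lebesgue_on S) (\<lambda>x. (norm (v x))\<^sup>2)"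
  proof (rule Bochner_Integration.integrable_bound)
    show "integrable (lebesgue_on S) (\<lambda>x. R\<^sup>2 * (norm (u x))\<^sup>2)"
      using assms by (auto simp: L2_def)
    show "AE x in lebesgue_on S. norm ((norm (v x))\<^sup>2) \<le> norm (R\<^sup>2 * (norm (u x))\<^sup>2)"
    proof (rule AE_I2)
      fix x assume "x \<in> space (lebesgue_on S)"
      then have "norm (v x) \<le> R * norm (u x)" using assms(3) by simp
      then have "(norm (v x))\<^sup>2 \<le> (R * norm (u x))\<^sup>2" by (rule power_mono) simp
      then show "norm ((norm (v x))\<^sup>2) \<le> norm (R\<^sup>2 * (norm (u x))\<^sup>2)" by (simp add: power_mult_distrib)
    qed
  qed (use assms in auto)
  with assms show ?thesis by (simp add: L2_def)
qed

lemma L2_component: "g \<in> L2 S \<Longrightarrow> b \<in> Basis \<Longrightarrow> (\<lambda>x. g x \<bullet> b) \<in> L2 S"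
  by (rule L2_bound[where R = 1]) (auto simp: L2_def Basis_le_norm)

lemma lebesgue_on_open: "open S \<Longrightarrow> S \<inter> space lebesgue \<in> sets lebesgue"
  by auto

lemma lebesgue_on_integrable:
  fixes f :: "'a::euclidean_space \<Rightarrow> 'b::euclidean_space"
  assumes "open S" "integrable lebesgue f"
  shows "integrable (lebesgue_on S) f"
  unfolding integrable_restrict_space[OF lebesgue_on_open[OF assms(1)]]
  by (rule integrable_mult_indicator) (use assms in auto)

lemma integrable_if_L2:
  fixes u :: "'a::euclidean_space \<Rightarrow> real"
  assumes "open S" "bounded S" "u \<in> L2 S"
  shows "integrable (lebesgue_on S) u"
proof -
  have "finite_measure (lebesgue_on S)"
    using assms by (intro finite_measure_lebesgue_on lmeasurable_open)
  then have "(\<lambda>x. 1::real) \<in> L2 S"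
    using finite_measure.integrable_const by (auto simp: L2_def)
  from L2_mult_integrable[OF assms(3) this] show ?thesis by simp
qed

text \<open>Elements are representatives and not classes, so the forms are only semidefinite. The
  locale is shared by the L2 product in space, the L2 product in time, the energy form and their
  combinations; closure under \<open>u + c v\<close> is the single subspace axiom.\<close>

locale semi_inner =
  fixes W :: "('a \<Rightarrow> real) set" and B :: "('a \<Rightarrow> real) \<Rightarrow> ('a \<Rightarrow> real) \<Rightarrow> real"
  assumes comb: "u \<in> W \<Longrightarrow> v \<in> W \<Longrightarrow> (\<lambda>x. u x + c * v x) \<in> W"
    and sym: "u \<in> W \<Longrightarrow> v \<in> W \<Longrightarrow> B u v = B v u"
    and lin: "u \<in> W \<Longrightarrow> v \<in> W \<Longrightarrow> w \<in> W \<Longrightarrow> B (\<lambda>x. u x + c * v x) w = B u w + c * B v w"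
    and pos: "u \<in> W \<Longrightarrow> 0 \<le> B u u"
begin

definition nrm :: "('a \<Rightarrow> real) \<Rightarrow> real" where
  "nrm u = sqrt (B u u)"

lemma nrm_nonneg: "u \<in> W \<Longrightarrow> 0 \<le> nrm u"
  by (simp add: nrm_def pos)

lemma nrm_sq: "u \<in> W \<Longrightarrow> (nrm u)\<^sup>2 = B u u"
  by (simp add: nrm_def pos)

lemma lin_right: "u \<in> W \<Longrightarrow> v \<in> W \<Longrightarrow> w \<in> W \<Longrightarrow> B w (\<lambda>x. u x + c * v x) = B w u + c * B w v"
  using lin[of u v w c] sym comb by metis

lemma expand:
  assumes "u \<in> W" "v \<in> W"
  shows "B (\<lambda>x. u x + c * v x) (\<lambda>x. u x + c * v x) = B u u + 2 * c * B u v + c\<^sup>2 * B v v"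
  using assms by (simp add: lin lin_right comb sym[of v u] power2_eq_square algebra_simps)

lemma Cauchy_Schwarz:
  assumes u: "u \<in> W" and v: "v \<in> W"
  shows "\<bar>B u v\<bar> \<le> nrm u * nrm v"
proof -
  have quad: "0 \<le> B u u + 2 * c * B u v + c\<^sup>2 * B v v" for c
    using expand[OF u v, of c] pos[OF comb[OF u v]] by metis
  have "(B u v)\<^sup>2 \<le> B u u * B v v"
  proof (cases "B v v = 0")
    case True
    have "B u v = 0"
    proof (rule ccontr)
      assume "B u v \<noteq> 0"
      \<comment> \<open>With B v v = 0 the quadratic in \<open>c\<close> is affine, and this
        \<open>c\<close> gives it the value -1.\<close>
      with quad[of "- (B u u + 1) / (2 * B u v)"] True show False by (simp add: field_simps)
    qed
    then show ?thesis using True by simp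
  next
    case False
    then have "B v v > 0" using pos[OF v] by simp
    have "0 \<le> B u u - (B u v)\<^sup>2 / B v v"
      \<comment> \<open>This \<open>c\<close> is the minimizer of the quadratic.\<close>
      using quad[of "- B u v / B v v"] False by (simp add: power2_eq_square field_simps)
    then show ?thesis using \<open>B v v > 0\<close> by (simp add: field_simps)
  qed
  then have "sqrt ((B u v)\<^sup>2) \<le> sqrt (B u u * B v v)" by (rule real_sqrt_le_mono)
  then show ?thesis by (simp add: nrm_def real_sqrt_mult)
qed

lemma triangle:
  assumes u: "u \<in> W" and v: "v \<in> W"
  shows "nrm (\<lambda>x. u x + c * v x) \<le> nrm u + \<bar>c\<bar> * nrm v"
proof (rule power2_le_imp_le)
  have "(nrm (\<lambda>x. u x + c * v x))\<^sup>2 = (nrm u)\<^sup>2 + 2 * (c * B u v) + c\<^sup>2 * (nrm v)\<^sup>2"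
    using expand[OF u v, of c] nrm_sq[OF comb[OF u v]] nrm_sq[OF u] nrm_sq[OF v] by simp
  also have "c * B u v \<le> \<bar>c\<bar> * (nrm u * nrm v)"
    using Cauchy_Schwarz[OF u v] by (metis abs_ge_self abs_mult abs_ge_zero mult_left_mono order_trans)
  finally show "(nrm (\<lambda>x. u x + c * v x))\<^sup>2 \<le> (nrm u + \<bar>c\<bar> * nrm v)\<^sup>2"
    by (simp add: power2_eq_square algebra_simps)
  show "0 \<le> nrm u + \<bar>c\<bar> * nrm v" using nrm_nonneg u v by simp
qed

lemma diff: "u \<in> W \<Longrightarrow> v \<in> W \<Longrightarrow> (\<lambda>x. u x - v x) \<in> W"
  using comb[of u v "-1"] by simp

lemma add: "u \<in> W \<Longrightarrow> v \<in> W \<Longrightarrow> (\<lambda>x. u x + v x) \<in> W"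
  using comb[of u v 1] by simp

lemma triangle_diff: "u \<in> W \<Longrightarrow> v \<in> W \<Longrightarrow> nrm u \<le> nrm v + nrm (\<lambda>x. u x - v x)"
  using triangle[of v "\<lambda>x. u x - v x" 1] diff[of u v] by simp

lemma nrm_minus:
  assumes "u \<in> W" "v \<in> W"
  shows "nrm (\<lambda>x. u x - v x) = nrm (\<lambda>x. v x - u x)"
proof -
  have "B (\<lambda>x. u x - v x) (\<lambda>x. u x - v x) = B (\<lambda>x. v x - u x) (\<lambda>x. v x - u x)"
    using expand[OF assms, of "-1"] expand[OF assms(2,1), of "-1"] sym[OF assms] by simp
  then show ?thesis by (simp add: nrm_def)
qed

lemma triangle_abs: "u \<in> W \<Longrightarrow> v \<in> W \<Longrightarrow> \<bar>nrm u - nrm v\<bar> \<le> nrm (\<lambda>x. u x - v x)"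
  using triangle_diff[of u v] triangle_diff[of v u] nrm_minus[of u v] by linarith

end

lemma semi_inner_l2: "semi_inner (L2 S) (l2_inner S)"
proof
  fix u v w :: "'a \<Rightarrow> real" and c :: real assume *: "u \<in> L2 S" "v \<in> L2 S" "w \<in> L2 S"
  have "(\<lambda>x. (u x + c * v x) * w x) = (\<lambda>x. u x * w x + c * (v x * w x))"
    by (auto simp: fun_eq_iff algebra_simps)
  then show "l2_inner S (\<lambda>x. u x + c * v x) w = l2_inner S u w + c * l2_inner S v w"
    unfolding l2_inner_def using * by (simp add: L2_mult_integrable)
qed (auto simp: L2_comb_real l2_inner_def mult.commute)

lemma l2_norm_nrm: "l2_norm S = semi_inner.nrm (l2_inner S)"
  by (simp add: fun_eq_iff l2_norm_def semi_inner.nrm_def[OF semi_inner_l2])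

subsection \<open>Weak gradients\<close>

definition classical_grad :: "('a::euclidean_space \<Rightarrow> real) \<Rightarrow> 'a \<Rightarrow> 'a" where
  "classical_grad \<phi> x = (\<Sum>b\<in>Basis. frechet_derivative \<phi> (at x) b *\<^sub>R b)"

lemma classical_grad_inner: "b \<in> Basis \<Longrightarrow> classical_grad \<phi> x \<bullet> b = frechet_derivative \<phi> (at x) b"
  by (simp add: classical_grad_def)

lemma test_function_C_class: "test_function S \<phi> \<Longrightarrow> C_class k \<phi>"
  by (simp add: test_function_def)

lemma continuous_support_L2:
  fixes f :: "'a::euclidean_space \<Rightarrow> 'b::euclidean_space"
  assumes "open S" "continuous_on UNIV f" "compact K" "\<And>x. x \<notin> K \<Longrightarrow> f x = 0"
  shows "f \<in> L2 S"
proof -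
  have "f \<in> borel_measurable lborel"
    using borel_measurable_continuous_onI[OF assms(2)] by simp
  then have "f \<in> borel_measurable (lebesgue_on S)"
    by (intro measurable_restrict_space1 measurable_completion)
  moreover have "integrable lebesgue (\<lambda>x. (norm (f x))\<^sup>2)"
    by (rule integral_compact_support[OF _ assms(3)]) (auto intro!: continuous_intros assms)
  ultimately show ?thesis
    using lebesgue_on_integrable[OF assms(1)] by (auto simp: L2_def)
qed

lemma test_function_derivative_continuous:
  assumes "test_function S \<phi>" "b \<in> Basis"
  shows "continuous_on UNIV (\<lambda>x. frechet_derivative \<phi> (at x) b)"
  using test_function_C_class[OF assms(1), of 1] assms(2) by simp

lemma test_function_L2:
  assumes \<phi>: "test_function S \<phi>" and S': "open S'"
  shows "\<phi> \<in> L2 S'" and "b \<in> Basis \<Longrightarrow> (\<lambda>x. frechet_derivative \<phi> (at x) b) \<in> L2 S'"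
    and "classical_grad \<phi> \<in> L2 S'"
proof -
  obtain K where K: "compact K" "K \<subseteq> S" "\<And>x. \<phi> x \<noteq> 0 \<Longrightarrow> x \<in> K"
    using test_function_support[OF \<phi>] by blast
  have 0: "frechet_derivative \<phi> (at x) = (\<lambda>h. 0)" if "x \<notin> K" for x
    by (rule frechet_derivative_eq_0_outside[OF compact_imp_closed[OF K(1)] K(3) that])
  show "\<phi> \<in> L2 S'"
    by (rule continuous_support_L2[OF S' C_class_continuous[OF test_function_C_class[OF \<phi>]] K(1)]) (use K in auto)
  show "(\<lambda>x. frechet_derivative \<phi> (at x) b) \<in> L2 S'" if "b \<in> Basis"
    by (rule continuous_support_L2[OF S' test_function_derivative_continuous[OF \<phi> that] K(1)]) (simp add: 0)
  show "classical_grad \<phi> \<in> L2 S'"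
  proof (rule continuous_support_L2[OF S' _ K(1)])
    show "continuous_on UNIV (classical_grad \<phi>)"
      unfolding classical_grad_def
      by (intro continuous_intros test_function_derivative_continuous[OF \<phi>])
  qed (simp add: classical_grad_def 0)
qed

lemma integral_lebesgue_on_eq:
  fixes f :: "'a::euclidean_space \<Rightarrow> real"
  assumes "open S" "\<And>x. x \<notin> S \<Longrightarrow> f x = 0"
  shows "(\<integral>x. f x \<partial>lebesgue_on S) = (\<integral>x. f x \<partial>lebesgue)"
  unfolding integral_restrict_space[OF lebesgue_on_open[OF assms(1)]]
  by (rule Bochner_Integration.integral_cong) (use assms(2) in \<open>auto simp: indicator_def\<close>)

text \<open>Here \<open>\<theta>\<close> may be nonzero up to the boundary of \<open>S\<close> and
  beyond. This generality is what extension by zero and Poincare's inequality use, besides the weak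
  differentiability of test functions.\<close>

lemma test_function_by_parts:
  assumes S: "open S" and \<phi>: "test_function S \<phi>" and \<theta>: "C_class 1 \<theta>" and b: "b \<in> Basis"
  shows "(\<integral>x. \<phi> x * frechet_derivative \<theta> (at x) b \<partial>lebesgue_on S)
    = - (\<integral>x. frechet_derivative \<phi> (at x) b * \<theta> x \<partial>lebesgue_on S)"
proof -
  obtain K where K: "compact K" "K \<subseteq> S" "\<And>x. \<phi> x \<noteq> 0 \<Longrightarrow> x \<in> K"
    using test_function_support[OF \<phi>] by blast
  have "frechet_derivative \<phi> (at x) = (\<lambda>h. 0)" if "x \<notin> S" for x
    by (rule frechet_derivative_eq_0_outside[OF compact_imp_closed[OF K(1)] K(3)]) (use that K(2) in auto)
  moreover have "\<phi> x = 0" if "x \<notin> S" for x using K that by blast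
  ultimately show ?thesis
    using integration_by_parts[OF test_function_C_class[OF \<phi>] \<theta> K(1) K(3) b]
    by (simp add: integral_lebesgue_on_eq[OF S])
qed

lemma test_function_weak_gradient:
  assumes "open S" "test_function S \<phi>"
  shows "has_weak_gradient S \<phi> (classical_grad \<phi>)"
  unfolding has_weak_gradient_def
  by (auto simp: classical_grad_inner test_function_by_parts[OF assms test_function_C_class])

lemma weak_gradient_comb:
  assumes S: "open S" and u: "u \<in> L2 S" "g \<in> L2 S" "has_weak_gradient S u g"
    and v: "v \<in> L2 S" "h \<in> L2 S" "has_weak_gradient S v h"
  shows "has_weak_gradient S (\<lambda>x. u x + c * v x) (\<lambda>x. g x + c *\<^sub>R h x)"
  unfolding has_weak_gradient_def
proof (intro allI impI ballI)
  fix \<phi> :: "'a \<Rightarrow> real" and b :: 'a assume \<phi>: "test_function S \<phi>" and b: "b \<in> Basis"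
  note i = L2_mult_integrable[OF _ test_function_L2(2)[OF \<phi> S b]] L2_mult_integrable[OF _ test_function_L2(1)[OF \<phi> S]]
  have "(\<integral>x. (u x + c * v x) * frechet_derivative \<phi> (at x) b \<partial>lebesgue_on S)
      = (\<integral>x. u x * frechet_derivative \<phi> (at x) b + c * (v x * frechet_derivative \<phi> (at x) b) \<partial>lebesgue_on S)"
    by (simp add: algebra_simps)
  also have "\<dots> = - (\<integral>x. (g x \<bullet> b) * \<phi> x \<partial>lebesgue_on S) + c * - (\<integral>x. (h x \<bullet> b) * \<phi> x \<partial>lebesgue_on S)"
    using i u v \<phi> b by (simp add: has_weak_gradient_def)
  also have "\<dots> = - (\<integral>x. (g x \<bullet> b) * \<phi> x + c * ((h x \<bullet> b) * \<phi> x) \<partial>lebesgue_on S)"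
    using i(2)[OF L2_component[OF u(2) b]] i(2)[OF L2_component[OF v(2) b]] by simp
  also have "\<dots> = - (\<integral>x. ((g x + c *\<^sub>R h x) \<bullet> b) * \<phi> x \<partial>lebesgue_on S)"
    by (simp add: algebra_simps)
  finally show "(\<integral>x. (u x + c * v x) * frechet_derivative \<phi> (at x) b \<partial>lebesgue_on S)
    = - (\<integral>x. ((g x + c *\<^sub>R h x) \<bullet> b) * \<phi> x \<partial>lebesgue_on S)" .
qed

text \<open>The fundamental lemma is applied to each component of the difference; boundedness of
  \<open>S\<close> turns square integrable components into integrable ones.\<close>

lemma weak_gradient_unique:
  assumes S: "open S" "bounded S" and g: "g \<in> L2 S" "has_weak_gradient S u g"
    and h: "h \<in> L2 S" "has_weak_gradient S u h"
  shows "AE x in lebesgue_on S. g x = h x"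
proof -
  have "AE x in lebesgue_on S. g x \<bullet> b - h x \<bullet> b = 0" if b: "b \<in> Basis" for b
  proof (rule fundamental_lemma[OF S(1)])
    note gb = L2_component[OF g(1) b] and hb = L2_component[OF h(1) b]
    show "integrable (lebesgue_on S) (\<lambda>x. g x \<bullet> b - h x \<bullet> b)"
      using integrable_if_L2[OF S gb] integrable_if_L2[OF S hb] by simp
    fix \<phi> :: "'a \<Rightarrow> real" assume \<phi>: "test_function S \<phi>"
    note \<phi>2 = test_function_L2(1)[OF \<phi> S(1)]
    have "(\<integral>x. (g x \<bullet> b) * \<phi> x \<partial>lebesgue_on S) = (\<integral>x. (h x \<bullet> b) * \<phi> x \<partial>lebesgue_on S)"
      using g(2)[unfolded has_weak_gradient_def, rule_format, OF \<phi> b]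
        h(2)[unfolded has_weak_gradient_def, rule_format, OF \<phi> b] by simp
    then show "(\<integral>x. (g x \<bullet> b - h x \<bullet> b) * \<phi> x \<partial>lebesgue_on S) = 0"
      using L2_mult_integrable[OF gb \<phi>2] L2_mult_integrable[OF hb \<phi>2] by (simp add: left_diff_distrib)
  qed
  then have "AE x in lebesgue_on S. \<forall>b\<in>Basis. g x \<bullet> b - h x \<bullet> b = 0"
    by (simp add: AE_finite_all)
  then show ?thesis
    by eventually_elim (auto intro: euclidean_eqI)
qed

lemma sobolev_H1_wgrad:
  assumes "u \<in> sobolev_H1 S"
  shows "u \<in> L2 S" "wgrad S u \<in> L2 S" "has_weak_gradient S u (wgrad S u)"
proof -
  obtain g where "g \<in> L2 S \<and> has_weak_gradient S u g" using assms by (auto simp: sobolev_H1_def)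
  then have "wgrad S u \<in> L2 S \<and> has_weak_gradient S u (wgrad S u)"
    using someI[of "\<lambda>g. g \<in> L2 S \<and> has_weak_gradient S u g" g] by (simp add: wgrad_def)
  then show "u \<in> L2 S" "wgrad S u \<in> L2 S" "has_weak_gradient S u (wgrad S u)"
    using assms by (auto simp: sobolev_H1_def)
qed

text \<open>This is the way to compute with the chosen gradient: exhibit some weak gradient, and
  \<open>wgrad\<close> agrees with it almost everywhere.\<close>

lemma wgrad_eq:
  assumes "open S" "bounded S" "u \<in> L2 S" "g \<in> L2 S" "has_weak_gradient S u g"
  shows "u \<in> sobolev_H1 S" "AE x in lebesgue_on S. wgrad S u x = g x"
proof -
  show "u \<in> sobolev_H1 S" using assms by (auto simp: sobolev_H1_def)
  then show "AE x in lebesgue_on S. wgrad S u x = g x"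
    using weak_gradient_unique[OF assms(1,2)] sobolev_H1_wgrad[of u S] assms by blast
qed

lemma wgrad_comb:
  assumes S: "open S" "bounded S" and u: "u \<in> sobolev_H1 S" and v: "v \<in> sobolev_H1 S"
  shows "(\<lambda>x. u x + c * v x) \<in> sobolev_H1 S"
    and "AE x in lebesgue_on S. wgrad S (\<lambda>x. u x + c * v x) x = wgrad S u x + c *\<^sub>R wgrad S v x"
  using wgrad_eq[OF S L2_comb_real L2_comb weak_gradient_comb[OF S(1)]]
    sobolev_H1_wgrad[OF u] sobolev_H1_wgrad[OF v] by blast+

lemma test_function_H1:
  assumes "open S" "bounded S" "test_function S \<phi>"
  shows "\<phi> \<in> sobolev_H1 S" "AE x in lebesgue_on S. wgrad S \<phi> x = classical_grad \<phi> x"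
  using wgrad_eq[OF assms(1,2) test_function_L2(1,3)[OF assms(3,1)] test_function_weak_gradient[OF assms(1,3)]] by auto

section \<open>The energy form and the combined norm on one time level\<close>

text \<open>Measurability and two-sided bounds are what is extracted from the piecewise constant
  permeability. The constant coefficient 1 is included, so that the \<open>H1_norm\<close> is
  treated by the same lemmas.\<close>

definition coeff_on :: "'a::euclidean_space set \<Rightarrow> ('a \<Rightarrow> real) \<Rightarrow> bool" where
  "coeff_on S \<kappa> \<longleftrightarrow> \<kappa> \<in> borel_measurable (lebesgue_on S) \<and> (\<exists>k0>0. \<exists>k1. \<forall>x\<in>S. k0 \<le> \<kappa> x \<and> \<kappa> x \<le> k1)"

lemma coeff_on_1: "coeff_on S (\<lambda>x. 1)"
  unfolding coeff_on_def by (auto intro: exI[of _ 1])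

lemma coeff_integrable:
  assumes "coeff_on S \<kappa>" "g \<in> L2 S" "h \<in> L2 S"
  shows "integrable (lebesgue_on S) (\<lambda>x. \<kappa> x * (g x \<bullet> h x))"
proof -
  obtain k1 where k1: "\<And>x. x \<in> S \<Longrightarrow> \<bar>\<kappa> x\<bar> \<le> k1" 
    using assms(1) unfolding coeff_on_def by (metis abs_of_nonneg less_imp_le order_trans)
  show ?thesis
  proof (rule Bochner_Integration.integrable_bound)
    show "integrable (lebesgue_on S) (\<lambda>x. k1 * (g x \<bullet> h x))"
      using L2_inner_integrable[OF assms(2,3)] by simp
    show "AE x in lebesgue_on S. norm (\<kappa> x * (g x \<bullet> h x)) \<le> norm (k1 * (g x \<bullet> h x))"
      by (rule AE_I2) (auto simp: abs_mult intro!: mult_right_mono order_trans[OF k1])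
    show "(\<lambda>x. \<kappa> x * (g x \<bullet> h x)) \<in> borel_measurable (lebesgue_on S)"
      using assms by (auto simp: coeff_on_def L2_def)
  qed
qed

lemma semi_inner_a_form:
  assumes S: "open S" "bounded S" and \<kappa>: "coeff_on S \<kappa>"
  shows "semi_inner (sobolev_H1 S) (a_form S \<kappa>)"
proof
  fix u v w :: "'a \<Rightarrow> real" and c :: real assume *: "u \<in> sobolev_H1 S" "v \<in> sobolev_H1 S" "w \<in> sobolev_H1 S"
  note g = sobolev_H1_wgrad(2)[OF *(1)] sobolev_H1_wgrad(2)[OF *(2)] sobolev_H1_wgrad(2)[OF *(3)]
  have m: "\<kappa> \<in> borel_measurable (lebesgue_on S)" using \<kappa> by (simp add: coeff_on_def)
  have "a_form S \<kappa> (\<lambda>x. u x + c * v x) w =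
      (\<integral>x. \<kappa> x * (wgrad S u x \<bullet> wgrad S w x) + c * (\<kappa> x * (wgrad S v x \<bullet> wgrad S w x)) \<partial>lebesgue_on S)"
    unfolding a_form_def
  proof (rule integral_cong_AE)
    have "wgrad S (\<lambda>x. u x + c * v x) \<in> L2 S"
      by (rule sobolev_H1_wgrad(2)[OF wgrad_comb(1)[OF S *(1,2)]])
    then show "(\<lambda>x. \<kappa> x * (wgrad S (\<lambda>x. u x + c * v x) x \<bullet> wgrad S w x)) \<in> borel_measurable (lebesgue_on S)"
      using m g by (auto simp: L2_def)
    show "AE x in lebesgue_on S. \<kappa> x * (wgrad S (\<lambda>x. u x + c * v x) x \<bullet> wgrad S w x) =
      \<kappa> x * (wgrad S u x \<bullet> wgrad S w x) + c * (\<kappa> x * (wgrad S v x \<bullet> wgrad S w x))"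
      using wgrad_comb(2)[OF S *(1,2), of c] by eventually_elim (simp add: algebra_simps)
  qed (use m g in \<open>auto simp: L2_def\<close>)
  then show "a_form S \<kappa> (\<lambda>x. u x + c * v x) w = a_form S \<kappa> u w + c * a_form S \<kappa> v w"
    unfolding a_form_def using coeff_integrable[OF \<kappa> g(1,3)] coeff_integrable[OF \<kappa> g(2,3)] by simp
next
  fix u :: "'a \<Rightarrow> real"
  show "0 \<le> a_form S \<kappa> u u"
    unfolding a_form_def
  proof (rule integral_nonneg_AE, rule AE_I2)
    fix x assume "x \<in> space (lebesgue_on S)"
    then have "0 \<le> \<kappa> x" using \<kappa> unfolding coeff_on_def by fastforce
    then show "0 \<le> \<kappa> x * (wgrad S u x \<bullet> wgrad S u x)" by simp
  qed
next
  fix u v :: "'a \<Rightarrow> real" and c :: real assume "u \<in> sobolev_H1 S" "v \<in> sobolev_H1 S"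
  then show "(\<lambda>x. u x + c * v x) \<in> sobolev_H1 S" by (rule wgrad_comb(1)[OF S])
next
  fix u v :: "'a \<Rightarrow> real"
  show "a_form S \<kappa> u v = a_form S \<kappa> v u" by (simp add: a_form_def inner_commute)
qed

lemma a_norm_nrm: "open S \<Longrightarrow> bounded S \<Longrightarrow> coeff_on S \<kappa> \<Longrightarrow> a_norm S \<kappa> = semi_inner.nrm (a_form S \<kappa>)"
  by (simp add: fun_eq_iff a_norm_def semi_inner.nrm_def[OF semi_inner_a_form])

text \<open>The integrand of \<open>X_inner\<close> at a single time. For the coefficient 1 it is
  the inner product of H^1.\<close>

definition x_form :: "'a::euclidean_space set \<Rightarrow> ('a \<Rightarrow> real) \<Rightarrow> ('a \<Rightarrow> real) \<Rightarrow> ('a \<Rightarrow> real) \<Rightarrow> real" where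
  "x_form S \<kappa> u v = l2_inner S u v + a_form S \<kappa> u v"

definition x_norm :: "'a::euclidean_space set \<Rightarrow> ('a \<Rightarrow> real) \<Rightarrow> ('a \<Rightarrow> real) \<Rightarrow> real" where
  "x_norm S \<kappa> u = sqrt (x_form S \<kappa> u u)"

lemma semi_inner_x_form:
  assumes S: "open S" "bounded S" and \<kappa>: "coeff_on S \<kappa>"
  shows "semi_inner (sobolev_H1 S) (x_form S \<kappa>)"
proof -
  interpret l: semi_inner "L2 S" "l2_inner S" by (rule semi_inner_l2)
  interpret a: semi_inner "sobolev_H1 S" "a_form S \<kappa>" by (rule semi_inner_a_form[OF assms])
  show ?thesis
    by standard (auto simp: x_form_def l.lin a.lin l.pos a.pos l.sym a.sym sobolev_H1_wgrad(1) algebra_simps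
        intro: a.comb)
qed

lemma x_norm_nrm: "open S \<Longrightarrow> bounded S \<Longrightarrow> coeff_on S \<kappa> \<Longrightarrow> x_norm S \<kappa> = semi_inner.nrm (x_form S \<kappa>)"
  by (simp add: fun_eq_iff x_norm_def semi_inner.nrm_def[OF semi_inner_x_form])

text \<open>Identifies the \<open>H1_norm\<close> as the norm of a semi-inner product, which gives
  it the triangle inequality; the single integral splits because both summands are
  integrable.\<close>

lemma H1_norm_x_norm:
  assumes "u \<in> sobolev_H1 S"
  shows "H1_norm S u = x_norm S (\<lambda>x. 1) u"
proof -
  have "integrable (lebesgue_on S) (\<lambda>x. u x * u x)" "integrable (lebesgue_on S) (\<lambda>x. wgrad S u x \<bullet> wgrad S u x)"
    using sobolev_H1_wgrad[OF assms] by (auto intro: L2_mult_integrable L2_inner_integrable)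
  moreover have "(\<lambda>x. (u x)\<^sup>2 + (norm (wgrad S u x))\<^sup>2) = (\<lambda>x. u x * u x + wgrad S u x \<bullet> wgrad S u x)"
    by (simp only: power2_eq_square[of "u _"] power2_norm_eq_inner)
  ultimately show ?thesis
    by (simp add: H1_norm_def x_norm_def x_form_def l2_inner_def a_form_def)
qed

lemma l2_inner_self: "u \<in> L2 S \<Longrightarrow> (l2_norm S u)\<^sup>2 = l2_inner S u u"
  using semi_inner.nrm_sq[OF semi_inner_l2] by (simp add: l2_norm_nrm)

lemma x_norm_sq:
  assumes "open S" "bounded S" "coeff_on S \<kappa>" "u \<in> sobolev_H1 S"
  shows "(x_norm S \<kappa> u)\<^sup>2 = (l2_norm S u)\<^sup>2 + (a_norm S \<kappa> u)\<^sup>2"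
    "l2_norm S u \<le> x_norm S \<kappa> u" "a_norm S \<kappa> u \<le> x_norm S \<kappa> u"
    "0 \<le> l2_norm S u" "0 \<le> a_norm S \<kappa> u" "0 \<le> x_norm S \<kappa> u"
proof -
  interpret l: semi_inner "L2 S" "l2_inner S" by (rule semi_inner_l2)
  interpret a: semi_inner "sobolev_H1 S" "a_form S \<kappa>" by (rule semi_inner_a_form[OF assms(1-3)])
  interpret x: semi_inner "sobolev_H1 S" "x_form S \<kappa>" by (rule semi_inner_x_form[OF assms(1-3)])
  note n = l2_norm_nrm a_norm_nrm[OF assms(1-3)] x_norm_nrm[OF assms(1-3)]
  show 0: "0 \<le> l2_norm S u" "0 \<le> a_norm S \<kappa> u" "0 \<le> x_norm S \<kappa> u"
    unfolding n using assms(4) sobolev_H1_wgrad(1) l.nrm_nonneg a.nrm_nonneg x.nrm_nonneg by auto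
  show *: "(x_norm S \<kappa> u)\<^sup>2 = (l2_norm S u)\<^sup>2 + (a_norm S \<kappa> u)\<^sup>2"
    unfolding n using assms(4) sobolev_H1_wgrad(1)[OF assms(4)] by (simp add: l.nrm_sq a.nrm_sq x.nrm_sq x_form_def)
  show "l2_norm S u \<le> x_norm S \<kappa> u" "a_norm S \<kappa> u \<le> x_norm S \<kappa> u"
    by (rule power2_le_imp_le; use * 0 in simp)+
qed

section \<open>Scaling and additivity in semi-inner product spaces\<close>

context semi_inner
begin

lemma zero: "u \<in> W \<Longrightarrow> (\<lambda>x. 0) \<in> W" "u \<in> W \<Longrightarrow> B (\<lambda>x. 0) (\<lambda>x. 0) = 0" "u \<in> W \<Longrightarrow> nrm (\<lambda>x. 0) = 0"
  using diff[of u u] expand[of u u "-1"] by (simp_all add: nrm_def)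

text \<open>The multiple c u is written as u + (c - 1) u, which the subspace axiom covers.\<close>

lemma scale: "u \<in> W \<Longrightarrow> (\<lambda>x. c * u x) \<in> W" "u \<in> W \<Longrightarrow> B (\<lambda>x. c * u x) (\<lambda>x. c * u x) = c\<^sup>2 * B u u"
  using comb[of u u "c - 1"] expand[of u u "c - 1"] by (simp_all add: algebra_simps power2_eq_square)

lemma nrm_scale: "u \<in> W \<Longrightarrow> nrm (\<lambda>x. c * u x) = \<bar>c\<bar> * nrm u"
  by (simp add: nrm_def scale real_sqrt_mult)

lemma scale_left: "u \<in> W \<Longrightarrow> w \<in> W \<Longrightarrow> B (\<lambda>x. c * u x) w = c * B u w"
  using lin[of u u w "c - 1"] by (simp add: algebra_simps)

lemma diff_left: "u \<in> W \<Longrightarrow> v \<in> W \<Longrightarrow> w \<in> W \<Longrightarrow> B (\<lambda>x. u x - v x) w = B u w - B v w"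
  using lin[of u v w "-1"] by simp

lemma add_left: "u \<in> W \<Longrightarrow> v \<in> W \<Longrightarrow> w \<in> W \<Longrightarrow> B (\<lambda>x. u x + v x) w = B u w + B v w"
  using lin[of u v w 1] by simp

lemma add_right: "u \<in> W \<Longrightarrow> v \<in> W \<Longrightarrow> w \<in> W \<Longrightarrow> B w (\<lambda>x. u x + v x) = B w u + B w v"
  using lin_right[of u v w 1] by simp

end

subsection \<open>The space \<open>H\<^sup>1\<^sub>0\<close>\<close>

lemma test_functionI:
  assumes "\<And>k. C_class k \<phi>" "compact K" "K \<subseteq> S" "\<And>x. \<phi> x \<noteq> 0 \<Longrightarrow> x \<in> K"
  shows "test_function S \<phi>"
proof -
  have "closure {x. \<phi> x \<noteq> 0} \<subseteq> K"
    by (rule closure_minimal) (use assms compact_imp_closed in auto)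
  then show ?thesis
    unfolding test_function_def using assms compact_Int_closed[OF assms(2) closed_closure, of "{x. \<phi> x \<noteq> 0}"]
    by (auto simp: Int_absorb1)
qed

lemma test_function_comb:
  assumes "test_function S \<phi>" "test_function S \<theta>"
  shows "test_function S (\<lambda>x. \<phi> x + c * \<theta> x)"
proof -
  obtain K L where K: "compact K" "K \<subseteq> S" "\<And>x. \<phi> x \<noteq> 0 \<Longrightarrow> x \<in> K" and L: "compact L" "L \<subseteq> S" "\<And>x. \<theta> x \<noteq> 0 \<Longrightarrow> x \<in> L"
    using test_function_support assms by metis
  show ?thesis
  proof (rule test_functionI[where K = "K \<union> L"])
    show "C_class k (\<lambda>x. \<phi> x + c * \<theta> x)" for k
      by (intro C_class_add C_class_cmult test_function_C_class[OF assms(1)] test_function_C_class[OF assms(2)])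
    show "x \<in> K \<union> L" if "\<phi> x + c * \<theta> x \<noteq> 0" for x
    proof -
      have "\<phi> x \<noteq> 0 \<or> \<theta> x \<noteq> 0" using that by auto
      then show ?thesis using K(3) L(3) by blast
    qed
  qed (use K L in auto)
qed

lemma test_function_mono: "test_function S \<phi> \<Longrightarrow> S \<subseteq> S' \<Longrightarrow> test_function S' \<phi>"
  by (auto simp: test_function_def)

lemma sobolev_H10_H1: "u \<in> sobolev_H10 S \<Longrightarrow> u \<in> sobolev_H1 S"
  by (simp add: sobolev_H10_def)

lemma H1_norm_nrm:
  assumes "open S" "bounded S" "u \<in> sobolev_H1 S"
  shows "H1_norm S u = semi_inner.nrm (x_form S (\<lambda>x. 1)) u"
  using H1_norm_x_norm[OF assms(3)] x_norm_nrm[OF assms(1,2) coeff_on_1] by simp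

lemma sobolev_H10_approx:
  assumes "u \<in> sobolev_H10 S"
  obtains \<phi> where "\<And>k::nat. test_function S (\<phi> k)" "(\<lambda>k. H1_norm S (\<lambda>x. u x - \<phi> k x)) \<longlonglongrightarrow> 0"
  using assms by (auto simp: sobolev_H10_def)

lemma sobolev_H10_comb:
  assumes S: "open S" "bounded S" and u: "u \<in> sobolev_H10 S" and v: "v \<in> sobolev_H10 S"
  shows "(\<lambda>x. u x + c * v x) \<in> sobolev_H10 S"
proof -
  interpret h: semi_inner "sobolev_H1 S" "x_form S (\<lambda>x. 1)"
    by (rule semi_inner_x_form[OF S coeff_on_1])
  obtain \<phi> where \<phi>: "\<And>k::nat. test_function S (\<phi> k)" "(\<lambda>k. H1_norm S (\<lambda>x. u x - \<phi> k x)) \<longlonglongrightarrow> 0"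
    using sobolev_H10_approx[OF u] by blast
  obtain \<theta> where \<theta>: "\<And>k::nat. test_function S (\<theta> k)" "(\<lambda>k. H1_norm S (\<lambda>x. v x - \<theta> k x)) \<longlonglongrightarrow> 0"
    using sobolev_H10_approx[OF v] by blast
  note u1 = sobolev_H10_H1[OF u] and v1 = sobolev_H10_H1[OF v]
  note d1 = h.diff[OF u1 test_function_H1(1)[OF S \<phi>(1)]] and d2 = h.diff[OF v1 test_function_H1(1)[OF S \<theta>(1)]]
  have 1: "(\<lambda>x. u x + c * v x - (\<phi> k x + c * \<theta> k x)) = (\<lambda>x. (u x - \<phi> k x) + c * (v x - \<theta> k x))" for k
    by (auto simp: fun_eq_iff algebra_simps)
  have "(\<lambda>k. H1_norm S (\<lambda>x. u x + c * v x - (\<phi> k x + c * \<theta> k x))) \<longlonglongrightarrow> 0"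
  proof (rule tendsto_sandwich[where f = "\<lambda>k. 0"])
    have "H1_norm S (\<lambda>x. u x + c * v x - (\<phi> k x + c * \<theta> k x))
        \<le> H1_norm S (\<lambda>x. u x - \<phi> k x) + \<bar>c\<bar> * H1_norm S (\<lambda>x. v x - \<theta> k x)" for k
      unfolding 1 using h.triangle[OF d1 d2] h.comb[OF d1 d2] d1 d2 by (simp add: H1_norm_nrm[OF S])
    then show "\<forall>\<^sub>F k in sequentially. H1_norm S (\<lambda>x. u x + c * v x - (\<phi> k x + c * \<theta> k x))
        \<le> H1_norm S (\<lambda>x. u x - \<phi> k x) + \<bar>c\<bar> * H1_norm S (\<lambda>x. v x - \<theta> k x)" by simp
    have "(\<lambda>k. H1_norm S (\<lambda>x. u x - \<phi> k x) + \<bar>c\<bar> * H1_norm S (\<lambda>x. v x - \<theta> k x)) \<longlonglongrightarrow> 0 + \<bar>c\<bar> * 0"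
      by (intro tendsto_intros \<phi> \<theta>)
    then show "(\<lambda>k. H1_norm S (\<lambda>x. u x - \<phi> k x) + \<bar>c\<bar> * H1_norm S (\<lambda>x. v x - \<theta> k x)) \<longlonglongrightarrow> 0" by simp
  qed (auto simp: H1_norm_def intro!: integral_nonneg_AE)
  moreover have "test_function S (\<lambda>x. \<phi> k x + c * \<theta> k x)" for k
    by (rule test_function_comb[OF \<phi>(1) \<theta>(1)])
  ultimately show ?thesis
    using h.comb[OF u1 v1] u v unfolding sobolev_H10_def
    by (auto intro!: exI[of _ "\<lambda>k x. \<phi> k x + c * \<theta> k x"])
qed

lemma test_function_H10:
  assumes S: "open S" "bounded S" and \<phi>: "test_function S \<phi>"
  shows "\<phi> \<in> sobolev_H10 S"
proof -
  interpret h: semi_inner "sobolev_H1 S" "x_form S (\<lambda>x. 1)"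
    by (rule semi_inner_x_form[OF S coeff_on_1])
  note \<phi>1 = test_function_H1(1)[OF assms]
  have "H1_norm S (\<lambda>x. \<phi> x - \<phi> x) = 0"
    using h.zero[OF \<phi>1] by (simp add: H1_norm_nrm[OF S])
  moreover have "\<phi> x = 0" if "x \<notin> S" for x
    using test_function_support[OF \<phi>] that by (metis subsetD)
  ultimately show ?thesis
    using \<phi>1 \<phi> unfolding sobolev_H10_def by (auto intro!: exI[of _ "\<lambda>k. \<phi>"])
qed

lemma zero_H10: "open S \<Longrightarrow> bounded S \<Longrightarrow> (\<lambda>x. 0) \<in> sobolev_H10 S"
  by (rule test_function_H10) (auto simp: test_function_def C_class_const)

lemma integral_subset:
  fixes f :: "'a::euclidean_space \<Rightarrow> real"
  assumes "open S" "open S'" "S' \<subseteq> S" "\<And>x. x \<notin> S' \<Longrightarrow> f x = 0"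
  shows "(\<integral>x. f x \<partial>lebesgue_on S) = (\<integral>x. f x \<partial>lebesgue_on S')"
  using integral_lebesgue_on_eq[OF assms(1), of f] integral_lebesgue_on_eq[OF assms(2), of f] assms by auto

lemma L2_extend:
  fixes g :: "'a::euclidean_space \<Rightarrow> 'b::euclidean_space"
  assumes S: "open S" "open S'" "S' \<subseteq> S" and g: "g \<in> L2 S'"
  shows "(\<lambda>x. if x \<in> S' then g x else 0) \<in> L2 S"
proof -
  let ?G = "\<lambda>x. if x \<in> S' then g x else 0"
  have G: "?G = (\<lambda>x. indicator S' x *\<^sub>R g x)" by (auto simp: indicator_def)
  have "?G \<in> borel_measurable lebesgue"
    unfolding G using g borel_measurable_restrict_space_iff[OF lebesgue_on_open[OF S(2)], of g] by (simp add: L2_def)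
  moreover have "integrable lebesgue (\<lambda>x. (norm (?G x))\<^sup>2)"
  proof -
    have "integrable lebesgue (\<lambda>x. indicator S' x *\<^sub>R (norm (g x))\<^sup>2)"
      using g integrable_restrict_space[OF lebesgue_on_open[OF S(2)], of "\<lambda>x. (norm (g x))\<^sup>2"] by (simp add: L2_def)
    moreover have "(\<lambda>x. indicator S' x *\<^sub>R (norm (g x))\<^sup>2) = (\<lambda>x. (norm (?G x))\<^sup>2)" by (auto simp: indicator_def)
    ultimately show ?thesis by simp
  qed
  ultimately show ?thesis
    unfolding L2_def using lebesgue_on_integrable[OF S(1)] measurable_restrict_space1 by auto
qed

text \<open>The test function \<open>\<theta>\<close> lives on the larger set and need not have
  support in \<open>S'\<close>, so the weak gradient on \<open>S'\<close> cannot be tested with it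
  directly. Approximation of \<open>u\<close> by test functions of \<open>S'\<close> helps: for
  these, integration by parts holds against every smooth \<open>\<theta>\<close>.\<close>

lemma weak_gradient_extend:
  assumes S: "open S" "bounded S" and S': "open S'" "S' \<subseteq> S" and u: "u \<in> sobolev_H10 S'"
  shows "has_weak_gradient S u (\<lambda>x. if x \<in> S' then wgrad S' u x else 0)"
  unfolding has_weak_gradient_def
proof (intro allI impI ballI)
  fix \<theta> :: "'a \<Rightarrow> real" and b :: 'a assume \<theta>: "test_function S \<theta>" and b: "b \<in> Basis"
  have bd: "bounded S'" using S S' bounded_subset by blast
  interpret h: semi_inner "sobolev_H1 S'" "x_form S' (\<lambda>x. 1)"
    by (rule semi_inner_x_form[OF S'(1) bd coeff_on_1])
  interpret l: semi_inner "L2 S'" "l2_inner S'" by (rule semi_inner_l2)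
  obtain \<phi> where \<phi>: "\<And>k::nat. test_function S' (\<phi> k)" "(\<lambda>k. H1_norm S' (\<lambda>x. u x - \<phi> k x)) \<longlonglongrightarrow> 0"
    using sobolev_H10_approx[OF u] by blast
  note u1 = sobolev_H10_H1[OF u] and \<phi>1 = test_function_H1(1)[OF S'(1) bd \<phi>(1)]
  note dk = h.diff[OF u1 \<phi>1]
  let ?d = "\<lambda>x. frechet_derivative \<theta> (at x) b"
  have \<theta>2: "\<theta> \<in> L2 S'" "?d \<in> L2 S'"
    using test_function_L2(1,2)[OF \<theta> S'(1)] b by auto
  have wd: "AE x in lebesgue_on S'. wgrad S' (\<lambda>x. u x - \<phi> k x) x = wgrad S' u x - classical_grad (\<phi> k) x" for k
    using wgrad_comb(2)[OF S'(1) bd u1 \<phi>1[of k], of "-1"] test_function_H1(2)[OF S'(1) bd \<phi>(1)[of k]]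
    by eventually_elim simp
  \<comment> \<open>The defect in the formula of integration by parts. It is 0 for each
    \<open>\<phi> k\<close>, hence unchanged when \<open>u\<close> is replaced by the difference to
    \<open>\<phi> k\<close>, and it is bounded by the H^1 norm of that difference.\<close>
  define E where "E = l2_inner S' u ?d + l2_inner S' (\<lambda>x. wgrad S' u x \<bullet> b) \<theta>"
  have E_eq: "E = l2_inner S' (\<lambda>x. u x - \<phi> k x) ?d + l2_inner S' (\<lambda>x. wgrad S' (\<lambda>x. u x - \<phi> k x) x \<bullet> b) \<theta>" for k
  proof -
    note m = L2_component[OF sobolev_H1_wgrad(2)[OF dk[of k]] b] L2_component[OF sobolev_H1_wgrad(2)[OF u1] b]
      test_function_L2(1)[OF \<phi>(1)[of k] S'(1)] test_function_L2(2)[OF \<phi>(1)[of k] S'(1) b] sobolev_H1_wgrad(1)[OF u1]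
    have "l2_inner S' (\<lambda>x. wgrad S' (\<lambda>x. u x - \<phi> k x) x \<bullet> b) \<theta>
        = l2_inner S' (\<lambda>x. wgrad S' u x \<bullet> b - frechet_derivative (\<phi> k) (at x) b) \<theta>"
      unfolding l2_inner_def
    proof (rule integral_cong_AE)
      show "AE x in lebesgue_on S'. wgrad S' (\<lambda>x. u x - \<phi> k x) x \<bullet> b * \<theta> x =
          (wgrad S' u x \<bullet> b - frechet_derivative (\<phi> k) (at x) b) * \<theta> x"
        using wd[of k] by eventually_elim (simp add: inner_diff_left classical_grad_inner b)
    qed (use m \<theta>2 in \<open>auto simp: L2_def\<close>)
    also have "\<dots> = l2_inner S' (\<lambda>x. wgrad S' u x \<bullet> b) \<theta> - l2_inner S' (\<lambda>x. frechet_derivative (\<phi> k) (at x) b) \<theta>"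
      by (rule l.diff_left[OF m(2) m(4) \<theta>2(1)])
    finally have 1: "l2_inner S' (\<lambda>x. wgrad S' (\<lambda>x. u x - \<phi> k x) x \<bullet> b) \<theta>
        = l2_inner S' (\<lambda>x. wgrad S' u x \<bullet> b) \<theta> - l2_inner S' (\<lambda>x. frechet_derivative (\<phi> k) (at x) b) \<theta>" .
    have 2: "l2_inner S' (\<lambda>x. u x - \<phi> k x) ?d = l2_inner S' u ?d - l2_inner S' (\<phi> k) ?d"
      by (rule l.diff_left[OF m(5) m(3) \<theta>2(2)])
    have 3: "l2_inner S' (\<phi> k) ?d = - l2_inner S' (\<lambda>x. frechet_derivative (\<phi> k) (at x) b) \<theta>"
      unfolding l2_inner_def by (rule test_function_by_parts[OF S'(1) \<phi>(1) test_function_C_class[OF \<theta>] b])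
    show ?thesis unfolding E_def 1 2 3 by simp
  qed
  have bound: "\<bar>E\<bar> \<le> H1_norm S' (\<lambda>x. u x - \<phi> k x) * (l.nrm ?d + l.nrm \<theta>)" for k
  proof -
    note m = L2_component[OF sobolev_H1_wgrad(2)[OF dk[of k]] b] sobolev_H1_wgrad[OF dk[of k]]
    note x = x_norm_sq[OF S'(1) bd coeff_on_1 dk[of k]]
    have H: "H1_norm S' (\<lambda>x. u x - \<phi> k x) = x_norm S' (\<lambda>x. 1) (\<lambda>x. u x - \<phi> k x)"
      by (rule H1_norm_x_norm[OF dk])
    have "l2_inner S' (\<lambda>x. wgrad S' (\<lambda>x. u x - \<phi> k x) x \<bullet> b) (\<lambda>x. wgrad S' (\<lambda>x. u x - \<phi> k x) x \<bullet> b)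
        \<le> a_form S' (\<lambda>x. 1) (\<lambda>x. u x - \<phi> k x) (\<lambda>x. u x - \<phi> k x)"
      unfolding l2_inner_def a_form_def
    proof (rule integral_mono)
      show "wgrad S' (\<lambda>x. u x - \<phi> k x) x \<bullet> b * (wgrad S' (\<lambda>x. u x - \<phi> k x) x \<bullet> b)
          \<le> 1 * (wgrad S' (\<lambda>x. u x - \<phi> k x) x \<bullet> wgrad S' (\<lambda>x. u x - \<phi> k x) x)" for x
        using power_mono[OF Basis_le_norm[OF b, of "wgrad S' (\<lambda>x. u x - \<phi> k x) x"] abs_ge_zero, of 2]
        by (simp only: power2_abs power2_norm_eq_inner) (simp add: power2_eq_square)
    qed (use L2_mult_integrable[OF m(1,1)] L2_inner_integrable[OF m(3,3)] in auto)
    then have 1: "l.nrm (\<lambda>x. wgrad S' (\<lambda>x. u x - \<phi> k x) x \<bullet> b) \<le> H1_norm S' (\<lambda>x. u x - \<phi> k x)"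
      unfolding H using x(3) by (simp add: l.nrm_def a_norm_def) (meson order_trans real_sqrt_le_mono)
    have 2: "l.nrm (\<lambda>x. u x - \<phi> k x) \<le> H1_norm S' (\<lambda>x. u x - \<phi> k x)"
      unfolding H using x(2) by (simp add: l2_norm_nrm)
    have "\<bar>E\<bar> \<le> l.nrm (\<lambda>x. u x - \<phi> k x) * l.nrm ?d + l.nrm (\<lambda>x. wgrad S' (\<lambda>x. u x - \<phi> k x) x \<bullet> b) * l.nrm \<theta>"
      unfolding E_eq[of k]
      using l.Cauchy_Schwarz[OF m(2) \<theta>2(2)] l.Cauchy_Schwarz[OF m(1) \<theta>2(1)] by linarith
    also have "\<dots> \<le> H1_norm S' (\<lambda>x. u x - \<phi> k x) * l.nrm ?d + H1_norm S' (\<lambda>x. u x - \<phi> k x) * l.nrm \<theta>"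
      by (intro add_mono mult_right_mono 1 2 l.nrm_nonneg \<theta>2)
    finally show ?thesis by (simp add: algebra_simps)
  qed
  have "(\<lambda>k. H1_norm S' (\<lambda>x. u x - \<phi> k x) * (l.nrm ?d + l.nrm \<theta>)) \<longlonglongrightarrow> 0 * (l.nrm ?d + l.nrm \<theta>)"
    by (intro tendsto_intros \<phi>)
  then have "\<bar>E\<bar> \<le> 0"
    by (intro LIMSEQ_le_const[of _ 0]) (use bound in auto)
  then have E0: "E = 0" by simp
  have u0: "u x = 0" if "x \<notin> S'" for x using u that by (simp add: sobolev_H10_def)
  have "(\<integral>x. u x * ?d x \<partial>lebesgue_on S) = l2_inner S' u ?d"
    unfolding l2_inner_def by (rule integral_subset[OF S(1) S']) (simp add: u0)
  moreover have "(\<integral>x. ((if x \<in> S' then wgrad S' u x else 0) \<bullet> b) * \<theta> x \<partial>lebesgue_on S) = l2_inner S' (\<lambda>x. wgrad S' u x \<bullet> b) \<theta>"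
    unfolding l2_inner_def
    by (subst integral_subset[OF S(1) S']) (auto intro!: Bochner_Integration.integral_cong)
  ultimately show "(\<integral>x. u x * ?d x \<partial>lebesgue_on S) = - (\<integral>x. ((if x \<in> S' then wgrad S' u x else 0) \<bullet> b) * \<theta> x \<partial>lebesgue_on S)"
    using E0 unfolding E_def by simp
qed

text \<open>Places the basis functions of the enlarged blocks in H^1_0 of the domain. The
  approximating test functions can be kept: functions and gradients vanish outside
  \<open>S'\<close>, so the distances in H^1 are the same on both sets.\<close>

lemma sobolev_H10_extend:
  assumes S: "open S" "bounded S" and S': "open S'" "S' \<subseteq> S" and u: "u \<in> sobolev_H10 S'"
  shows "u \<in> sobolev_H10 S"
proof -
  have bd: "bounded S'" using S S' bounded_subset by blast
  interpret h: semi_inner "sobolev_H1 S" "x_form S (\<lambda>x. 1)"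
    by (rule semi_inner_x_form[OF S coeff_on_1])
  interpret h': semi_inner "sobolev_H1 S'" "x_form S' (\<lambda>x. 1)"
    by (rule semi_inner_x_form[OF S'(1) bd coeff_on_1])
  have u0: "u x = 0" if "x \<notin> S'" for x using u that by (simp add: sobolev_H10_def)
  have "(\<lambda>x. if x \<in> S' then u x else 0) = u" using u0 by auto
  then have uL: "u \<in> L2 S"
    using L2_extend[OF S(1) S' sobolev_H1_wgrad(1)[OF sobolev_H10_H1[OF u]]] by simp
  let ?G = "\<lambda>x. if x \<in> S' then wgrad S' u x else 0"
  have GL: "?G \<in> L2 S" by (rule L2_extend[OF S(1) S' sobolev_H1_wgrad(2)[OF sobolev_H10_H1[OF u]]])
  note w = wgrad_eq[OF S uL GL weak_gradient_extend[OF S S' u]]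
  obtain \<phi> where \<phi>: "\<And>k::nat. test_function S' (\<phi> k)" "(\<lambda>k. H1_norm S' (\<lambda>x. u x - \<phi> k x)) \<longlonglongrightarrow> 0"
    using sobolev_H10_approx[OF u] by blast
  note \<phi>S = test_function_mono[OF \<phi>(1) S'(2)]
  have "H1_norm S (\<lambda>x. u x - \<phi> k x) = H1_norm S' (\<lambda>x. u x - \<phi> k x)" for k
  proof -
    note d = h.diff[OF w(1) test_function_H1(1)[OF S \<phi>S[of k]]]
    note d' = h'.diff[OF sobolev_H10_H1[OF u] test_function_H1(1)[OF S'(1) bd \<phi>(1)[of k]]]
    let ?D = "\<lambda>x. if x \<in> S' then wgrad S' u x - classical_grad (\<phi> k) x else 0"
    have cg: "classical_grad (\<phi> k) x = 0" if x: "x \<notin> S'" for x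
    proof -
      obtain K where K: "compact K" "K \<subseteq> S'" "\<And>x. \<phi> k x \<noteq> 0 \<Longrightarrow> x \<in> K"
        using test_function_support[OF \<phi>(1)] by blast
      have "frechet_derivative (\<phi> k) (at x) = (\<lambda>h. 0)"
        by (rule frechet_derivative_eq_0_outside[OF compact_imp_closed[OF K(1)] K(3)]) (use x K in auto)
      then show ?thesis by (simp add: classical_grad_def)
    qed
    \<comment> \<open>The gradients chosen on \<open>S\<close> and on \<open>S'\<close> are
      unrelated choices; both are compared with the explicit difference gradient, extended by 0 in
      the case of \<open>S\<close>.\<close>
    have 1: "AE x in lebesgue_on S. wgrad S (\<lambda>x. u x - \<phi> k x) x = ?D x"
      using wgrad_comb(2)[OF S w(1) test_function_H1(1)[OF S \<phi>S[of k]], of "-1"] w(2) test_function_H1(2)[OF S \<phi>S[of k]]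
      by eventually_elim (auto simp: cg)
    have 2: "AE x in lebesgue_on S'. wgrad S' (\<lambda>x. u x - \<phi> k x) x = wgrad S' u x - classical_grad (\<phi> k) x"
      using wgrad_comb(2)[OF S'(1) bd sobolev_H10_H1[OF u] test_function_H1(1)[OF S'(1) bd \<phi>(1)[of k]], of "-1"]
        test_function_H1(2)[OF S'(1) bd \<phi>(1)[of k]]
      by eventually_elim simp
    note m' = sobolev_H1_wgrad[OF d'] sobolev_H1_wgrad(2)[OF sobolev_H10_H1[OF u]] test_function_L2(3)[OF \<phi>(1)[of k] S'(1)]
    have D': "(\<lambda>x. wgrad S' u x - classical_grad (\<phi> k) x) \<in> L2 S'"
      using L2_comb[OF m'(4,5), of "-1"] by simp
    have D: "?D \<in> L2 S" by (rule L2_extend[OF S(1) S' D'])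
    note m = sobolev_H1_wgrad[OF d]
    have \<phi>0: "u x - \<phi> k x = 0" if "x \<notin> S'" for x
      using u0[OF that] test_function_support[OF \<phi>(1)[of k]] that by (metis diff_zero subsetD)
    have "(\<integral>x. (u x - \<phi> k x)\<^sup>2 + (norm (wgrad S (\<lambda>x. u x - \<phi> k x) x))\<^sup>2 \<partial>lebesgue_on S) =
        (\<integral>x. (u x - \<phi> k x)\<^sup>2 + (norm (?D x))\<^sup>2 \<partial>lebesgue_on S)"
    proof (rule integral_cong_AE)
      show "AE x in lebesgue_on S. (u x - \<phi> k x)\<^sup>2 + (norm (wgrad S (\<lambda>x. u x - \<phi> k x) x))\<^sup>2 = (u x - \<phi> k x)\<^sup>2 + (norm (?D x))\<^sup>2"
        using 1 by eventually_elim simp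
    qed (use m D in \<open>auto simp: L2_def\<close>)
    also have "\<dots> = (\<integral>x. (u x - \<phi> k x)\<^sup>2 + (norm (?D x))\<^sup>2 \<partial>lebesgue_on S')"
      by (rule integral_subset[OF S(1) S']) (simp add: \<phi>0)
    also have "\<dots> = (\<integral>x. (u x - \<phi> k x)\<^sup>2 + (norm (wgrad S' (\<lambda>x. u x - \<phi> k x) x))\<^sup>2 \<partial>lebesgue_on S')"
    proof (rule integral_cong_AE)
      have "AE x in lebesgue_on S'. x \<in> S'" by (rule AE_I2) simp
      then show "AE x in lebesgue_on S'. (u x - \<phi> k x)\<^sup>2 + (norm (?D x))\<^sup>2 = (u x - \<phi> k x)\<^sup>2 + (norm (wgrad S' (\<lambda>x. u x - \<phi> k x) x))\<^sup>2"
        using 2 by eventually_elim simp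
      have "?D \<in> L2 S'" by (rule L2_extend[OF S'(1) S'(1) order_refl D'])
      then show "(\<lambda>x. (u x - \<phi> k x)\<^sup>2 + (norm (?D x))\<^sup>2) \<in> borel_measurable (lebesgue_on S')"
        using m' by (auto simp: L2_def)
    qed (use m' in \<open>auto simp: L2_def\<close>)
    finally show ?thesis by (simp add: H1_norm_def)
  qed
  then have "(\<lambda>k. H1_norm S (\<lambda>x. u x - \<phi> k x)) \<longlonglongrightarrow> 0" using \<phi>(2) by simp
  then show ?thesis
    unfolding sobolev_H10_def using w(1) \<phi>S u0 S'(2) by blast
qed

subsection \<open>Poincare's inequality and the dual norm\<close>

lemma l2_norm_mono:
  assumes u: "u \<in> L2 S" and v: "v \<in> L2 S" and R: "0 \<le> R"
    and le: "AE x in lebesgue_on S. \<bar>v x\<bar> \<le> R * \<bar>u x\<bar>"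
  shows "l2_norm S v \<le> R * l2_norm S u"
proof -
  have "l2_inner S v v \<le> (\<integral>x. R\<^sup>2 * (u x * u x) \<partial>lebesgue_on S)"
    unfolding l2_inner_def
  proof (rule integral_mono_AE)
    show "AE x in lebesgue_on S. v x * v x \<le> R\<^sup>2 * (u x * u x)"
      using le
    proof eventually_elim
      case (elim x)
      then have "\<bar>v x\<bar>\<^sup>2 \<le> (R * \<bar>u x\<bar>)\<^sup>2" by (intro power_mono) auto
      then show ?case by (simp add: power2_eq_square mult_ac)
    qed
  qed (use L2_mult_integrable[OF u u] L2_mult_integrable[OF v v] in auto)
  also have "\<dots> = R\<^sup>2 * l2_inner S u u" by (simp add: l2_inner_def)
  finally have "sqrt (l2_inner S v v) \<le> sqrt (R\<^sup>2 * l2_inner S u u)" by (rule real_sqrt_le_mono)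
  then show ?thesis using R by (simp add: l2_norm_def real_sqrt_mult)
qed

lemma test_function_mult:
  assumes \<phi>: "test_function S \<phi>" and \<theta>: "\<And>k. C_class k \<theta>"
  shows "test_function S (\<lambda>x. \<phi> x * \<theta> x)"
proof -
  obtain K where K: "compact K" "K \<subseteq> S" "\<And>x. \<phi> x \<noteq> 0 \<Longrightarrow> x \<in> K"
    using test_function_support[OF \<phi>] by blast
  show ?thesis
    by (rule test_functionI[OF C_class_mult[OF test_function_C_class[OF \<phi>] \<theta>] K(1,2)]) (use K(3) in auto)
qed

lemma a_form_mono:
  assumes \<kappa>: "coeff_on S \<kappa>" "coeff_on S \<kappa>'" and u: "u \<in> sobolev_H1 S"
    and le: "\<And>x. x \<in> S \<Longrightarrow> \<kappa> x \<le> M * \<kappa>' x"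
  shows "a_form S \<kappa> u u \<le> M * a_form S \<kappa>' u u"
proof -
  note g = sobolev_H1_wgrad(2)[OF u]
  have "a_form S \<kappa> u u \<le> (\<integral>x. M * (\<kappa>' x * (wgrad S u x \<bullet> wgrad S u x)) \<partial>lebesgue_on S)"
    unfolding a_form_def
  proof (rule integral_mono)
    fix x assume "x \<in> space (lebesgue_on S)"
    then have "\<kappa> x * (wgrad S u x \<bullet> wgrad S u x) \<le> (M * \<kappa>' x) * (wgrad S u x \<bullet> wgrad S u x)"
      using le by (intro mult_right_mono) auto
    then show "\<kappa> x * (wgrad S u x \<bullet> wgrad S u x) \<le> M * (\<kappa>' x * (wgrad S u x \<bullet> wgrad S u x))" by (simp add: mult.assoc)
  qed (use coeff_integrable[OF \<kappa>(1) g g] coeff_integrable[OF \<kappa>(2) g g] in auto)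
  then show ?thesis by (simp add: a_form_def)
qed

text \<open>
  For a test function \<open>\<phi>\<close> and a unit vector \<open>b\<close> of the basis, integration by parts of
  \<open>\<phi>\<^sup>2\<close> against \<open>x \<bullet> b\<close>, whose derivative along \<open>b\<close> is 1, gives \<open>\<integral> \<phi>\<^sup>2 = - 2 \<integral> (x \<bullet> b) \<phi> \<partial>\<^sub>b \<phi>\<close>.
\<close>

lemma Poincare_test_function:
  assumes S: "open S" "bounded S" and R: "\<And>x. x \<in> S \<Longrightarrow> norm x \<le> R" "0 \<le> R" and \<phi>: "test_function S \<phi>"
  shows "l2_norm S \<phi> \<le> 2 * R * a_norm S (\<lambda>x. 1) \<phi>"
proof -
  interpret l: semi_inner "L2 S" "l2_inner S" by (rule semi_inner_l2)
  obtain b :: 'a where b: "b \<in> Basis" using nonempty_Basis by blast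
  let ?d = "\<lambda>x. frechet_derivative \<phi> (at x) b"
  note \<phi>2 = test_function_L2[OF \<phi> S(1)]
  note d2 = \<phi>2(2)[OF b] and \<phi>1 = test_function_C_class[OF \<phi>]
  have xb: "frechet_derivative (\<lambda>x. x \<bullet> b) (at x) = (\<lambda>h. h \<bullet> b)" for x
    using frechet_derivative_at[OF bounded_linear_imp_has_derivative[OF bounded_linear_inner_left[of b], of "at x"]] by metis
  have "test_function S (\<lambda>x. \<phi> x * (x \<bullet> b))"
    by (rule test_function_mult[OF \<phi> C_class_inner])
  then have y2: "(\<lambda>x. \<phi> x * (x \<bullet> b)) \<in> L2 S" by (rule test_function_L2(1)[OF _ S(1)])
  have "(\<integral>x. (\<phi> x * \<phi> x) * frechet_derivative (\<lambda>x. x \<bullet> b) (at x) b \<partial>lebesgue_on S)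
      = - (\<integral>x. frechet_derivative (\<lambda>x. \<phi> x * \<phi> x) (at x) b * (x \<bullet> b) \<partial>lebesgue_on S)"
    by (rule test_function_by_parts[OF S(1) test_function_mult[OF \<phi> \<phi>1] C_class_inner b])
  moreover have "frechet_derivative (\<lambda>x. \<phi> x * \<phi> x) (at x) b * (x \<bullet> b) = 2 * ((\<phi> x * (x \<bullet> b)) * ?d x)" for x
    by (simp add: frechet_derivative_mult[OF \<phi>1 \<phi>1] algebra_simps)
  ultimately have "l2_inner S \<phi> \<phi> = - (2 * l2_inner S (\<lambda>x. \<phi> x * (x \<bullet> b)) ?d)"
    using b by (simp add: xb l2_inner_def)
  then have "(l2_norm S \<phi>)\<^sup>2 \<le> 2 * \<bar>l2_inner S (\<lambda>x. \<phi> x * (x \<bullet> b)) ?d\<bar>"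
    using l2_inner_self[OF \<phi>2(1)] by linarith
  also have "\<dots> \<le> 2 * (l2_norm S (\<lambda>x. \<phi> x * (x \<bullet> b)) * l2_norm S ?d)"
    using l.Cauchy_Schwarz[OF y2 d2] by (simp add: l2_norm_nrm)
  \<comment> \<open>On \<open>S\<close> the weight x \<bullet> b is at most \<open>R\<close> in
    modulus, and one partial derivative is dominated by the whole gradient. A factor
    \<open>l2_norm S \<phi>\<close> then cancels.\<close>
  also have "\<dots> \<le> 2 * ((R * l2_norm S \<phi>) * a_norm S (\<lambda>x. 1) \<phi>)"
  proof (intro mult_left_mono mult_mono)
    show "l2_norm S (\<lambda>x. \<phi> x * (x \<bullet> b)) \<le> R * l2_norm S \<phi>"
    proof (rule l2_norm_mono[OF \<phi>2(1) y2 R(2)], rule AE_I2)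
      fix x assume "x \<in> space (lebesgue_on S)"
      then have "\<bar>x \<bullet> b\<bar> \<le> R" using R(1)[of x] Basis_le_norm[OF b, of x] by simp
      then show "\<bar>\<phi> x * (x \<bullet> b)\<bar> \<le> R * \<bar>\<phi> x\<bar>"
        by (simp add: abs_mult mult.commute[of R] mult_left_mono)
    qed
    have "l2_inner S ?d ?d \<le> a_form S (\<lambda>x. 1) \<phi> \<phi>"
      unfolding l2_inner_def a_form_def
    proof (rule integral_mono_AE)
      show "AE x in lebesgue_on S. ?d x * ?d x \<le> 1 * (wgrad S \<phi> x \<bullet> wgrad S \<phi> x)"
        using test_function_H1(2)[OF S \<phi>]
      proof eventually_elim
        case (elim x)
        have "(?d x)\<^sup>2 \<le> (norm (wgrad S \<phi> x))\<^sup>2"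
          using power_mono[OF Basis_le_norm[OF b, of "wgrad S \<phi> x"] abs_ge_zero, of 2]
          by (simp add: elim classical_grad_inner b)
        then show ?case by (simp only: power2_norm_eq_inner) (simp add: power2_eq_square)
      qed
    qed (use L2_mult_integrable[OF d2 d2] L2_inner_integrable sobolev_H1_wgrad(2)[OF test_function_H1(1)[OF S \<phi>]] in auto)
    then show "l2_norm S ?d \<le> a_norm S (\<lambda>x. 1) \<phi>"
      by (simp add: l2_norm_def a_norm_def)
  qed (use R l.nrm_nonneg \<phi>2 d2 in \<open>auto simp: l2_norm_nrm\<close>)
  finally have *: "l2_norm S \<phi> * l2_norm S \<phi> \<le> (2 * R * a_norm S (\<lambda>x. 1) \<phi>) * l2_norm S \<phi>"
    by (simp add: power2_eq_square mult_ac)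
  note x = x_norm_sq[OF S coeff_on_1 test_function_H1(1)[OF S \<phi>]]
  show ?thesis
  proof (cases "l2_norm S \<phi> = 0")
    case True
    then show ?thesis using R x(5) by simp
  next
    case False
    then show ?thesis using * x(4) by (simp add: mult_le_cancel_right)
  qed
qed

text \<open>The bound for test functions passes to H^1_0 by density. The lower bound
  \<open>k0\<close> of the coefficient compares the Dirichlet form with the energy, which is the
  origin of the factor sqrt (1 / k0).\<close>

lemma Poincare:
  assumes S: "open S" "bounded S" and \<kappa>: "coeff_on S \<kappa>"
  obtains C where "0 \<le> C" "\<And>u. u \<in> sobolev_H10 S \<Longrightarrow> l2_norm S u \<le> C * a_norm S \<kappa> u"
proof -
  interpret l: semi_inner "L2 S" "l2_inner S" by (rule semi_inner_l2)
  interpret a: semi_inner "sobolev_H1 S" "a_form S (\<lambda>x. 1)" by (rule semi_inner_a_form[OF S coeff_on_1])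
  interpret h: semi_inner "sobolev_H1 S" "x_form S (\<lambda>x. 1)" by (rule semi_inner_x_form[OF S coeff_on_1])
  obtain R where "R > 0" "\<forall>x\<in>S. norm x \<le> R" using S(2) bounded_pos by blast
  then have R: "\<And>x. x \<in> S \<Longrightarrow> norm x \<le> R" "0 \<le> R" by auto
  obtain k0 where k0: "k0 > 0" "\<And>x. x \<in> S \<Longrightarrow> k0 \<le> \<kappa> x" using \<kappa> unfolding coeff_on_def by blast
  show ?thesis
  proof (rule that[of "2 * R * sqrt (1 / k0)"])
    show "0 \<le> 2 * R * sqrt (1 / k0)" using R k0 by simp
    fix u assume u: "u \<in> sobolev_H10 S"
    note u1 = sobolev_H10_H1[OF u]
    obtain \<phi> where \<phi>: "\<And>k::nat. test_function S (\<phi> k)" "(\<lambda>k. H1_norm S (\<lambda>x. u x - \<phi> k x)) \<longlonglongrightarrow> 0"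
      using sobolev_H10_approx[OF u] by blast
    \<comment> \<open>In the error term, 1 comes from replacing \<open>u\<close> by
      \<open>\<phi> k\<close> in the L2 norm and 2 R from going back to \<open>u\<close> in the
      gradient norm.\<close>
    have "l2_norm S u \<le> 2 * R * a_norm S (\<lambda>x. 1) u + (1 + 2 * R) * H1_norm S (\<lambda>x. u x - \<phi> k x)" for k
    proof -
      note p1 = test_function_H1(1)[OF S \<phi>(1)[of k]]
      note d = h.diff[OF u1 p1]
      note x = x_norm_sq[OF S coeff_on_1 d, folded H1_norm_x_norm[OF d]]
      have "l2_norm S u \<le> l2_norm S (\<phi> k) + l2_norm S (\<lambda>x. u x - \<phi> k x)"
        using l.triangle_diff[OF sobolev_H1_wgrad(1)[OF u1] sobolev_H1_wgrad(1)[OF p1]] by (simp add: l2_norm_nrm)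
      moreover have "l2_norm S (\<phi> k) \<le> 2 * R * a_norm S (\<lambda>x. 1) (\<phi> k)"
        by (rule Poincare_test_function[OF S R \<phi>(1)])
      moreover have "a_norm S (\<lambda>x. 1) (\<phi> k) \<le> a_norm S (\<lambda>x. 1) u + a_norm S (\<lambda>x. 1) (\<lambda>x. u x - \<phi> k x)"
        using a.triangle_diff[OF p1 u1] a.nrm_minus[OF p1 u1] by (simp add: a_norm_nrm[OF S coeff_on_1])
      then have "2 * R * a_norm S (\<lambda>x. 1) (\<phi> k) \<le> 2 * R * (a_norm S (\<lambda>x. 1) u + H1_norm S (\<lambda>x. u x - \<phi> k x))"
        using x(3) R by (intro mult_left_mono) auto
      ultimately show ?thesis using x(2) by (simp add: algebra_simps)
    qed
    moreover have "(\<lambda>k. 2 * R * a_norm S (\<lambda>x. 1) u + (1 + 2 * R) * H1_norm S (\<lambda>x. u x - \<phi> k x))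
        \<longlonglongrightarrow> 2 * R * a_norm S (\<lambda>x. 1) u + (1 + 2 * R) * 0"
      by (intro tendsto_intros \<phi>)
    ultimately have 1: "l2_norm S u \<le> 2 * R * a_norm S (\<lambda>x. 1) u + (1 + 2 * R) * 0"
      by (intro LIMSEQ_le_const) auto
    have "a_form S (\<lambda>x. 1) u u \<le> (1 / k0) * a_form S \<kappa> u u"
      by (rule a_form_mono[OF coeff_on_1 \<kappa> u1]) (use k0 in \<open>simp add: field_simps\<close>)
    then have "a_norm S (\<lambda>x. 1) u \<le> sqrt (1 / k0) * a_norm S \<kappa> u"
      unfolding a_norm_def real_sqrt_mult[symmetric] by (rule real_sqrt_le_mono)
    then have "2 * R * a_norm S (\<lambda>x. 1) u \<le> 2 * R * (sqrt (1 / k0) * a_norm S \<kappa> u)"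
      using R by (intro mult_left_mono) auto
    with 1 show "l2_norm S u \<le> 2 * R * sqrt (1 / k0) * a_norm S \<kappa> u" by (simp add: mult.assoc)
  qed
qed

text \<open>Bochner measurability is expressed in the \<open>H1_norm\<close>; this makes quantities
  that are Lipschitz in the energy norm accessible to it.\<close>

lemma x_norm_le_H1_norm:
  assumes S: "open S" "bounded S" and \<kappa>: "coeff_on S \<kappa>"
  obtains C where "0 \<le> C" "\<And>u. u \<in> sobolev_H1 S \<Longrightarrow> x_norm S \<kappa> u \<le> C * H1_norm S u"
proof -
  obtain k1 where k1: "\<And>x. x \<in> S \<Longrightarrow> \<kappa> x \<le> k1" using \<kappa> unfolding coeff_on_def by blast
  define M where "M = max 1 k1"
  show ?thesis
  proof (rule that[of "sqrt M"])
    show "0 \<le> sqrt M" by (simp add: M_def)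
    fix u assume u: "u \<in> sobolev_H1 S"
    have "a_form S \<kappa> u u \<le> M * a_form S (\<lambda>x. 1) u u"
      by (rule a_form_mono[OF \<kappa> coeff_on_1 u]) (use k1 in \<open>fastforce simp: M_def le_max_iff_disj\<close>)
    moreover have "1 * l2_inner S u u \<le> M * l2_inner S u u"
      using semi_inner.pos[OF semi_inner_l2 sobolev_H1_wgrad(1)[OF u]] by (intro mult_right_mono) (auto simp: M_def)
    ultimately have "x_form S \<kappa> u u \<le> M * x_form S (\<lambda>x. 1) u u"
      by (simp add: x_form_def algebra_simps)
    then show "x_norm S \<kappa> u \<le> sqrt M * H1_norm S u"
      unfolding H1_norm_x_norm[OF u] x_norm_def real_sqrt_mult[symmetric] by (rule real_sqrt_le_mono)
  qed
qed

text \<open>Cauchy-Schwarz and Poincare bound the quotients, so that the supremum is a genuine least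
  upper bound. They also settle vectors of energy 0, where the quotient says nothing because of
  division by zero: the pairing itself is 0 there.\<close>

lemma a_dual_norm_bound:
  assumes S: "open S" "bounded S" and \<kappa>: "coeff_on S \<kappa>" and w: "w \<in> L2 S"
  shows "0 \<le> a_dual_norm S \<kappa> w"
    and "v \<in> sobolev_H10 S \<Longrightarrow> \<bar>l2_inner S w v\<bar> \<le> a_dual_norm S \<kappa> w * a_norm S \<kappa> v"
proof -
  interpret l: semi_inner "L2 S" "l2_inner S" by (rule semi_inner_l2)
  interpret a: semi_inner "sobolev_H1 S" "a_form S \<kappa>" by (rule semi_inner_a_form[OF S \<kappa>])
  obtain C where C: "0 \<le> C" "\<And>u. u \<in> sobolev_H10 S \<Longrightarrow> l2_norm S u \<le> C * a_norm S \<kappa> u"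
    using Poincare[OF S \<kappa>] by blast
  have le: "\<bar>l2_inner S w v\<bar> \<le> l2_norm S w * C * a_norm S \<kappa> v" if v: "v \<in> sobolev_H10 S" for v
  proof -
    have "\<bar>l2_inner S w v\<bar> \<le> l2_norm S w * l2_norm S v"
      using l.Cauchy_Schwarz[OF w sobolev_H1_wgrad(1)[OF sobolev_H10_H1[OF v]]] by (simp add: l2_norm_nrm)
    also have "\<dots> \<le> l2_norm S w * (C * a_norm S \<kappa> v)"
      using C(2)[OF v] l.nrm_nonneg[OF w] by (intro mult_left_mono) (auto simp: l2_norm_nrm)
    finally show ?thesis by (simp add: mult.assoc)
  qed
  have a0: "0 \<le> a_norm S \<kappa> v" if "v \<in> sobolev_H10 S" for v
    using a.nrm_nonneg[OF sobolev_H10_H1[OF that]] by (simp add: a_norm_nrm[OF S \<kappa>])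
  have bdd: "bdd_above ((\<lambda>v. l2_inner S w v / a_norm S \<kappa> v) ` sobolev_H10 S)"
  proof (rule bdd_aboveI2)
    fix v assume v: "v \<in> sobolev_H10 S"
    show "l2_inner S w v / a_norm S \<kappa> v \<le> l2_norm S w * C"
    proof (cases "a_norm S \<kappa> v = 0")
      case True
      then show ?thesis using C l.nrm_nonneg[OF w] by (simp add: l2_norm_nrm)
    next
      case False
      then show ?thesis using le[OF v] a0[OF v] by (simp add: divide_le_eq)
    qed
  qed
  have up: "l2_inner S w v / a_norm S \<kappa> v \<le> a_dual_norm S \<kappa> w" if "v \<in> sobolev_H10 S" for v
    unfolding a_dual_norm_def by (rule cSUP_upper[OF that bdd])
  have "a_norm S \<kappa> (\<lambda>x. 0) = 0"
    using a.zero(3)[OF sobolev_H10_H1[OF zero_H10[OF S]]] by (simp add: a_norm_nrm[OF S \<kappa>])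
  then show "0 \<le> a_dual_norm S \<kappa> w" using up[OF zero_H10[OF S]] by simp
  assume v: "v \<in> sobolev_H10 S"
  show "\<bar>l2_inner S w v\<bar> \<le> a_dual_norm S \<kappa> w * a_norm S \<kappa> v"
  proof (cases "a_norm S \<kappa> v = 0")
    case True
    then show ?thesis using le[OF v] by simp
  next
    case False
    then have pos: "a_norm S \<kappa> v > 0" using a0[OF v] by simp
    \<comment> \<open>The supremum bounds signed quotients; the absolute value is obtained from
      \<open>v\<close> and its negative.\<close>
    have "(\<lambda>x. 0 + (-1) * v x) \<in> sobolev_H10 S"
      by (rule sobolev_H10_comb[OF S zero_H10[OF S] v])
    then have mv: "(\<lambda>x. (-1) * v x) \<in> sobolev_H10 S" by simp
    have "l2_inner S w (\<lambda>x. (-1) * v x) = - l2_inner S w v" by (simp add: l2_inner_def)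
    moreover have "a_norm S \<kappa> (\<lambda>x. (-1) * v x) = a_norm S \<kappa> v"
      using a.nrm_scale[OF sobolev_H10_H1[OF v], of "-1"] by (simp add: a_norm_nrm[OF S \<kappa>])
    ultimately have "(- l2_inner S w v) / a_norm S \<kappa> v \<le> a_dual_norm S \<kappa> w" using up[OF mv] by simp
    then show ?thesis
      using up[OF v] unfolding pos_divide_le_eq[OF pos] by (rule abs_leI[rotated])
  qed
qed

subsection \<open>Bochner measurability\<close>

text \<open>No sigma-algebra on the function space is at hand, so preimages are written as finite
  unions of intersections of level sets. Two arguments serve pairings of simple functions; a
  function of one argument takes the same simple function twice.\<close>

lemma simple_pair_measurable:
  fixes p :: "'b \<Rightarrow> 'c \<Rightarrow> real" and I :: "real set"
  assumes s: "finite (s ` I)" "\<And>w. {t\<in>I. s t = w} \<in> sets lebesgue"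
    and r: "finite (r ` I)" "\<And>w. {t\<in>I. r t = w} \<in> sets lebesgue" and I: "I \<in> sets lebesgue"
  shows "(\<lambda>t. p (s t) (r t)) \<in> borel_measurable (lebesgue_on I)"
proof (rule measurableI)
  fix A :: "real set"
  have "(\<lambda>t. p (s t) (r t)) -` A \<inter> space (lebesgue_on I) =
      (\<Union>w\<in>s ` I. \<Union>w'\<in>r ` I. if p w w' \<in> A then {t\<in>I. s t = w} \<inter> {t\<in>I. r t = w'} else {})"
    by (auto split: if_splits)
  also have "\<dots> \<in> sets lebesgue"
    using s r by (intro sets.finite_UN) auto
  finally show "(\<lambda>t. p (s t) (r t)) -` A \<inter> space (lebesgue_on I) \<in> sets (lebesgue_on I)"
    using I by (auto simp: sets_restrict_space_iff)
qed simp

text \<open>Completeness of Lebesgue measure makes \<open>q\<close> measurable although the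
  convergence may fail on a null set. The indicator of \<open>I\<close> carries the argument over to
  the whole line.\<close>

lemma measurable_AE_limit:
  fixes q :: "real \<Rightarrow> real"
  assumes I: "I \<in> sets lebesgue" and p: "\<And>k::nat. p k \<in> borel_measurable (lebesgue_on I)"
    and l: "AE t in lebesgue_on I. (\<lambda>k. p k t) \<longlonglongrightarrow> q t"
  shows "q \<in> borel_measurable (lebesgue_on I)"
proof -
  have II: "I \<inter> space lebesgue \<in> sets lebesgue" using I by simp
  have "(\<lambda>t. lim (\<lambda>k. p k t)) \<in> borel_measurable (lebesgue_on I)"
    by (rule borel_measurable_lim_metric[OF p])
  then have "(\<lambda>t. indicator I t *\<^sub>R lim (\<lambda>k. p k t)) \<in> borel_measurable lebesgue"
    by (rule iffD1[OF borel_measurable_restrict_space_iff[OF II]])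
  moreover have "AE t in lebesgue. t \<in> I \<longrightarrow> (\<lambda>k. p k t) \<longlonglongrightarrow> q t"
    using l AE_restrict_space_iff[OF II] by simp
  then have "AE t in lebesgue. indicator I t *\<^sub>R lim (\<lambda>k. p k t) = indicator I t *\<^sub>R q t"
    by eventually_elim (auto simp: indicator_def limI)
  ultimately have "(\<lambda>t. indicator I t *\<^sub>R q t) \<in> borel_measurable lebesgue"
    by (rule borel_measurable_AE)
  then show ?thesis
    by (rule iffD2[OF borel_measurable_restrict_space_iff[OF II]])
qed

lemma bochner_L2_approx:
  assumes "v \<in> bochner_L2 I N W"
  obtains s where "\<And>k t. t \<in> I \<Longrightarrow> s (k::nat) t \<in> W" "\<And>k. finite (s k ` I)" "\<And>k w. {t\<in>I. s k t = w} \<in> sets lebesgue"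
    "AE t in lebesgue_on I. (\<lambda>k. N (\<lambda>x. v t x - s k t x)) \<longlonglongrightarrow> 0"
proof -
  have "\<exists>s. (\<forall>k::nat. finite (s k ` I) \<and> s k ` I \<subseteq> W \<and> (\<forall>w. {t\<in>I. s k t = w} \<in> sets lebesgue)) \<and>
    (AE t in lebesgue_on I. (\<lambda>k. N (\<lambda>x. v t x - s k t x)) \<longlonglongrightarrow> 0)"
    using assms unfolding bochner_L2_def by simp
  then obtain s where s: "\<And>k::nat. finite (s k ` I) \<and> s k ` I \<subseteq> W \<and> (\<forall>w. {t\<in>I. s k t = w} \<in> sets lebesgue)"
    "AE t in lebesgue_on I. (\<lambda>k. N (\<lambda>x. v t x - s k t x)) \<longlonglongrightarrow> 0"
    by (elim exE conjE) blast
  show ?thesis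
  proof (rule that[of s])
    show "s k t \<in> W" if "t \<in> I" for k t using s(1)[of k] that by blast
    show "finite (s k ` I)" for k using s(1)[of k] by blast
    show "{t\<in>I. s k t = w} \<in> sets lebesgue" for k w using s(1)[of k] by blast
  qed (rule s(2))
qed

lemma bochner_L2_mem: "v \<in> bochner_L2 I N W \<Longrightarrow> t \<in> I \<Longrightarrow> v t \<in> W"
  by (simp add: bochner_L2_def)

text \<open>A Lipschitz functional turns the convergence of the simple approximations in
  \<open>N\<close> into convergence of real functions of time. It serves for norms of
  \<open>v t\<close> and for pairings of \<open>v t\<close> with a fixed vector.\<close>

lemma bochner_L2_lipschitz_measurable:
  assumes I: "I \<in> sets lebesgue" and v: "v \<in> bochner_L2 I N W"
    and p: "\<And>x y. x \<in> W \<Longrightarrow> y \<in> W \<Longrightarrow> \<bar>p x - p y\<bar> \<le> C * N (\<lambda>z. x z - y z)"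
  shows "(\<lambda>t. p (v t) :: real) \<in> borel_measurable (lebesgue_on I)"
proof -
  obtain s where s: "\<And>k t. t \<in> I \<Longrightarrow> s (k::nat) t \<in> W" "\<And>k. finite (s k ` I)" "\<And>k w. {t\<in>I. s k t = w} \<in> sets lebesgue"
    "AE t in lebesgue_on I. (\<lambda>k. N (\<lambda>x. v t x - s k t x)) \<longlonglongrightarrow> 0"
    using bochner_L2_approx[OF v] by blast
  show ?thesis
  proof (rule measurable_AE_limit[OF I])
    show "(\<lambda>t. p (s k t)) \<in> borel_measurable (lebesgue_on I)" for k
      by (rule simple_pair_measurable[OF s(2,3) s(2,3) I, where p = "\<lambda>x y. p x"])
    have "AE t in lebesgue_on I. t \<in> I" by (rule AE_I2) simp
    with s(4) show "AE t in lebesgue_on I. (\<lambda>k. p (s k t)) \<longlonglongrightarrow> p (v t)"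
    proof eventually_elim
      case (elim t)
      have "(\<lambda>k. p (v t) - p (s k t)) \<longlonglongrightarrow> 0"
      proof (rule Lim_null_comparison)
        show "\<forall>\<^sub>F k in sequentially. norm (p (v t) - p (s k t)) \<le> C * N (\<lambda>x. v t x - s k t x)"
          using p[OF bochner_L2_mem[OF v elim(2)] s(1)[OF elim(2)]] by simp
        show "(\<lambda>k. C * N (\<lambda>x. v t x - s k t x)) \<longlonglongrightarrow> 0"
          using tendsto_mult[OF tendsto_const elim(1), of C] by simp
      qed
      from tendsto_diff[OF tendsto_const[of "p (v t)"] this] show ?case by simp
    qed
  qed
qed

text \<open>Both factors depend on time, so the pairing is not Lipschitz with a uniform constant;
  both are approximated by simple functions and bilinearity yields convergence at almost every
  time.\<close>

lemma bochner_L2_inner_measurable: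
  assumes I: "I \<in> sets lebesgue" and f: "f \<in> bochner_L2 I (l2_norm S) (L2 S)" and v: "v \<in> bochner_L2 I N W"
    and W: "W \<subseteq> L2 S" and N: "\<And>x y. x \<in> W \<Longrightarrow> y \<in> W \<Longrightarrow> l2_norm S (\<lambda>z. x z - y z) \<le> N (\<lambda>z. x z - y z)"
  shows "(\<lambda>t. l2_inner S (f t) (v t)) \<in> borel_measurable (lebesgue_on I)"
proof -
  interpret l: semi_inner "L2 S" "l2_inner S" by (rule semi_inner_l2)
  obtain s where s: "\<And>k t. t \<in> I \<Longrightarrow> s (k::nat) t \<in> W" "\<And>k. finite (s k ` I)" "\<And>k w. {t\<in>I. s k t = w} \<in> sets lebesgue"
    "AE t in lebesgue_on I. (\<lambda>k. N (\<lambda>x. v t x - s k t x)) \<longlonglongrightarrow> 0"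
    using bochner_L2_approx[OF v] by blast
  obtain r where r: "\<And>k t. t \<in> I \<Longrightarrow> r (k::nat) t \<in> L2 S" "\<And>k. finite (r k ` I)" "\<And>k w. {t\<in>I. r k t = w} \<in> sets lebesgue"
    "AE t in lebesgue_on I. (\<lambda>k. l2_norm S (\<lambda>x. f t x - r k t x)) \<longlonglongrightarrow> 0"
    using bochner_L2_approx[OF f] by blast
  show ?thesis
  proof (rule measurable_AE_limit[OF I])
    show "(\<lambda>t. l2_inner S (r k t) (s k t)) \<in> borel_measurable (lebesgue_on I)" for k
      by (rule simple_pair_measurable[OF r(2,3) s(2,3) I])
    have "AE t in lebesgue_on I. t \<in> I" by (rule AE_I2) simp
    with s(4) r(4) show "AE t in lebesgue_on I. (\<lambda>k. l2_inner S (r k t) (s k t)) \<longlonglongrightarrow> l2_inner S (f t) (v t)"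
    proof eventually_elim
      case (elim t)
      define A where "A k = l2_norm S (\<lambda>x. f t x - r k t x)" for k
      define B where "B k = N (\<lambda>x. v t x - s k t x)" for k
      have A: "A \<longlonglongrightarrow> 0" and B: "B \<longlonglongrightarrow> 0" 
        unfolding A_def[abs_def] B_def[abs_def] by (rule elim(2), rule elim(1))
      have ft: "f t \<in> L2 S" and vt: "v t \<in> W"
        by (rule bochner_L2_mem[OF f elim(3)], rule bochner_L2_mem[OF v elim(3)])
      then have vt2: "v t \<in> L2 S" using W by blast
      have "(\<lambda>k. l2_inner S (f t) (v t) - l2_inner S (r k t) (s k t)) \<longlonglongrightarrow> 0"
      proof (rule Lim_null_comparison)
        \<comment> \<open>From (f, v) - (r, s) = (f - r, s) + (f, v - s), where the norm of s is at
          most that of v plus the error \<open>B k\<close>.\<close>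
        have "norm (l2_inner S (f t) (v t) - l2_inner S (r k t) (s k t)) \<le> A k * (l2_norm S (v t) + B k) + l2_norm S (f t) * B k" for k
        proof -
          have rk: "r k t \<in> L2 S" and sk: "s k t \<in> W" "s k t \<in> L2 S"
            using r(1)[OF elim(3), of k] s(1)[OF elim(3), of k] W by auto
          have 1: "l2_inner S (f t) (v t) - l2_inner S (r k t) (s k t)
              = l2_inner S (\<lambda>x. f t x - r k t x) (s k t) + l2_inner S (\<lambda>x. v t x - s k t x) (f t)"
            using l.diff_left[OF ft rk sk(2)] l.diff_left[OF vt2 sk(2) ft] l.sym ft vt2 sk by simp
          have 2: "\<bar>l2_inner S (\<lambda>x. f t x - r k t x) (s k t)\<bar> \<le> A k * l2_norm S (s k t)"
            using l.Cauchy_Schwarz[OF l.diff[OF ft rk] sk(2)] by (simp add: A_def l2_norm_nrm)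
          have 3: "\<bar>l2_inner S (\<lambda>x. v t x - s k t x) (f t)\<bar> \<le> l2_norm S (\<lambda>x. v t x - s k t x) * l2_norm S (f t)"
            using l.Cauchy_Schwarz[OF l.diff[OF vt2 sk(2)] ft] by (simp add: l2_norm_nrm)
          have 4: "l2_norm S (\<lambda>x. v t x - s k t x) \<le> B k" using N[OF vt sk(1)] by (simp add: B_def)
          have 5: "l2_norm S (s k t) \<le> l2_norm S (v t) + B k"
            using l.triangle_diff[OF sk(2) vt2] l.nrm_minus[OF sk(2) vt2] 4 by (simp add: l2_norm_nrm)
          have "A k * l2_norm S (s k t) \<le> A k * (l2_norm S (v t) + B k)"
            using 5 l.nrm_nonneg[OF l.diff[OF ft rk]] by (intro mult_left_mono) (auto simp: A_def l2_norm_nrm)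
          moreover have "l2_norm S (\<lambda>x. v t x - s k t x) * l2_norm S (f t) \<le> B k * l2_norm S (f t)"
            using 4 l.nrm_nonneg[OF ft] by (intro mult_right_mono) (auto simp: l2_norm_nrm)
          ultimately show ?thesis using 1 2 3 by (simp add: mult.commute)
        qed
        then show "\<forall>\<^sub>F k in sequentially. norm (l2_inner S (f t) (v t) - l2_inner S (r k t) (s k t))
            \<le> A k * (l2_norm S (v t) + B k) + l2_norm S (f t) * B k" by simp
        have "(\<lambda>k. A k * (l2_norm S (v t) + B k) + l2_norm S (f t) * B k) \<longlonglongrightarrow> 0 * (l2_norm S (v t) + 0) + l2_norm S (f t) * 0"
          by (intro tendsto_intros A B)
        then show "(\<lambda>k. A k * (l2_norm S (v t) + B k) + l2_norm S (f t) * B k) \<longlonglongrightarrow> 0" by simp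
      qed
      from tendsto_diff[OF tendsto_const[of "l2_inner S (f t) (v t)"] this] show ?case by simp
    qed
  qed
qed

subsection \<open>Splitting of the space and the residual\<close>

text \<open>Isolates the functional analysis from the multiscale construction: two subspaces of
  H^1_0, a nonempty time interval with end points \<open>a\<close> and \<open>b\<close>, and the
  separation of the subspaces in the space-time product.\<close>

locale split_space =
  fixes S :: "'a::euclidean_space set" and \<kappa> :: "'a \<Rightarrow> real" and V1 V2 :: "('a \<Rightarrow> real) set" and a b :: real
  assumes S: "open S" "bounded S" and \<kappa>: "coeff_on S \<kappa>"
    and V1: "V1 \<subseteq> sobolev_H10 S" and V2: "V2 \<subseteq> sobolev_H10 S"
    and V1_zero: "(\<lambda>x. 0) \<in> V1" and V2_zero: "(\<lambda>x. 0) \<in> V2"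
    and V1_comb: "\<And>u v c. u \<in> V1 \<Longrightarrow> v \<in> V1 \<Longrightarrow> (\<lambda>x. u x + c * v x) \<in> V1"
    and V2_comb: "\<And>u v c. u \<in> V2 \<Longrightarrow> v \<in> V2 \<Longrightarrow> (\<lambda>x. u x + c * v x) \<in> V2"
    and ab: "a < b" and gamma_X_less: "gamma_X S \<kappa> {a<..b} V1 V2 < 1"
begin

abbreviation "I \<equiv> {a<..b}"
abbreviation "VH \<equiv> space_sum V1 V2"
abbreviation "gX \<equiv> gamma_X S \<kappa> I V1 V2"
abbreviation "xn \<equiv> x_norm S \<kappa>"

sublocale l: semi_inner "L2 S" "l2_inner S" by (rule semi_inner_l2)
sublocale af: semi_inner "sobolev_H1 S" "a_form S \<kappa>" by (rule semi_inner_a_form[OF S \<kappa>])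
sublocale x: semi_inner "sobolev_H1 S" "x_form S \<kappa>" by (rule semi_inner_x_form[OF S \<kappa>])
sublocale h: semi_inner "sobolev_H1 S" "x_form S (\<lambda>x. 1)" by (rule semi_inner_x_form[OF S coeff_on_1])
sublocale lt: semi_inner "L2 I" "l2_inner I" by (rule semi_inner_l2)

lemmas nrm_eqs = l2_norm_nrm a_norm_nrm[OF S \<kappa>] x_norm_nrm[OF S \<kappa>]
lemmas xn_props = x_norm_sq[OF S \<kappa>]

lemma V1_H1: "v \<in> V1 \<Longrightarrow> v \<in> sobolev_H1 S" and V2_H1: "v \<in> V2 \<Longrightarrow> v \<in> sobolev_H1 S"
  using V1 V2 sobolev_H10_H1 by blast+

lemma VH_E:
  assumes "v \<in> VH"
  obtains v1 v2 where "v1 \<in> V1" "v2 \<in> V2" "v = (\<lambda>x. v1 x + v2 x)"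
  using assms by (auto simp: space_sum_def)

lemma VH_H1: "v \<in> VH \<Longrightarrow> v \<in> sobolev_H1 S"
  by (elim VH_E) (simp add: x.add V1_H1 V2_H1)

lemma V1_VH: "v \<in> V1 \<Longrightarrow> v \<in> VH" and V2_VH: "v \<in> V2 \<Longrightarrow> v \<in> VH"
proof -
  show "v \<in> VH" if "v \<in> V1"
    unfolding space_sum_def by (rule CollectI, rule exI[of _ v], rule exI[of _ "\<lambda>x. 0"]) (use that V2_zero in simp)
  show "v \<in> VH" if "v \<in> V2"
    unfolding space_sum_def by (rule CollectI, rule exI[of _ "\<lambda>x. 0"], rule exI[of _ v]) (use that V1_zero in simp)
qed

lemma VH_comb:
  assumes "u \<in> VH" "v \<in> VH"
  shows "(\<lambda>x. u x + c * v x) \<in> VH"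
proof -
  obtain u1 u2 where u: "u1 \<in> V1" "u2 \<in> V2" "u = (\<lambda>x. u1 x + u2 x)" using VH_E[OF assms(1)] .
  obtain v1 v2 where v: "v1 \<in> V1" "v2 \<in> V2" "v = (\<lambda>x. v1 x + v2 x)" using VH_E[OF assms(2)] .
  have "(\<lambda>x. u x + c * v x) = (\<lambda>x. (u1 x + c * v1 x) + (u2 x + c * v2 x))"
    by (simp add: u v fun_eq_iff algebra_simps)
  then show ?thesis
    unfolding space_sum_def using V1_comb[OF u(1) v(1), of c] V2_comb[OF u(2) v(2), of c]
    by (intro CollectI exI[of _ "\<lambda>x. u1 x + c * v1 x"] exI[of _ "\<lambda>x. u2 x + c * v2 x"] conjI)
qed

lemma I_sets: "I \<in> sets lebesgue" by simp

lemma I_finite: "finite_measure (lebesgue_on I)"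
  by (intro finite_measure_lebesgue_on bounded_set_imp_lmeasurable) auto

lemma I_measure: "measure (lebesgue_on I) I = b - a"
  using ab by (simp add: measure_restrict_space)

lemma const_L2_I: "(\<lambda>t. c::real) \<in> L2 I"
  using finite_measure.integrable_const[OF I_finite] by (simp add: L2_def)

lemma l2_norm_I_const: "l2_norm I (\<lambda>t. 1) = sqrt (b - a)"
  using I_measure by (simp add: l2_norm_def l2_inner_def)

text \<open>Constant functions of time are used twice: as competitors in the supremum of
  \<open>gamma_X\<close>, which turns it into information about single time levels, and as a unit
  vector for the residual.\<close>

lemma bochner_const:
  assumes "v \<in> W" "W \<subseteq> sobolev_H1 S"
  shows "(\<lambda>t. v) \<in> bochner_L2 I (H1_norm S) W"
proof -
  have v: "v \<in> sobolev_H1 S" using assms by blast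
  have "H1_norm S (\<lambda>x. v x - v x) = 0"
    using h.zero[OF v] by (simp add: H1_norm_nrm[OF S])
  then have lim: "AE t in lebesgue_on I. (\<lambda>k. H1_norm S (\<lambda>x. v x - v x)) \<longlonglongrightarrow> 0" by simp
  have "{t\<in>I. v = w} \<in> sets lebesgue" for w by (cases "v = w") auto
  moreover have "integrable (lebesgue_on I) (\<lambda>t. (H1_norm S v)\<^sup>2)"
    using finite_measure.integrable_const[OF I_finite] .
  moreover have "finite ((\<lambda>t. v) ` I)" by (rule finite_subset[of _ "{v}"]) auto
  ultimately show ?thesis
    unfolding bochner_L2_def
    by (intro CollectI conjI exI[of _ "\<lambda>k t. v"] allI lim ballI) (use assms(1) in blast)+
qed

lemma l2_le_H1: "u \<in> sobolev_H1 S \<Longrightarrow> l2_norm S u \<le> H1_norm S u"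
  using x_norm_sq(2)[OF S coeff_on_1] by (simp add: H1_norm_x_norm)

text \<open>Reduces space-time integrals to the L2 space of scalar functions of time, where
  Cauchy-Schwarz is available.\<close>

lemma bochner_x_norm_L2:
  assumes v: "v \<in> bochner_L2 I (H1_norm S) W" and W: "W \<subseteq> sobolev_H1 S"
  shows "(\<lambda>t. xn (v t)) \<in> L2 I"
proof -
  obtain C where C: "0 \<le> C" "\<And>u. u \<in> sobolev_H1 S \<Longrightarrow> x_norm S \<kappa> u \<le> C * H1_norm S u"
    using x_norm_le_H1_norm[OF S \<kappa>] by blast
  have m: "(\<lambda>t. xn (v t)) \<in> borel_measurable (lebesgue_on I)"
  proof (rule bochner_L2_lipschitz_measurable[OF I_sets v, where C = C])
    fix u w assume "u \<in> W" "w \<in> W"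
    then have u: "u \<in> sobolev_H1 S" "w \<in> sobolev_H1 S" using W by auto
    show "\<bar>xn u - xn w\<bar> \<le> C * H1_norm S (\<lambda>z. u z - w z)"
      using x.triangle_abs[OF u] C(2)[OF x.diff[OF u]] by (simp add: nrm_eqs)
  qed
  have "integrable (lebesgue_on I) (\<lambda>t. (xn (v t))\<^sup>2)"
  proof (rule Bochner_Integration.integrable_bound)
    show "integrable (lebesgue_on I) (\<lambda>t. C\<^sup>2 * (H1_norm S (v t))\<^sup>2)"
      using v by (simp add: bochner_L2_def)
    show "AE t in lebesgue_on I. norm ((xn (v t))\<^sup>2) \<le> norm (C\<^sup>2 * (H1_norm S (v t))\<^sup>2)"
    proof (rule AE_I2)
      fix t assume "t \<in> space (lebesgue_on I)"
      then have "v t \<in> sobolev_H1 S" using bochner_L2_mem[OF v] W by auto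
      then have "(xn (v t))\<^sup>2 \<le> (C * H1_norm S (v t))\<^sup>2"
        using C(2) xn_props(6) by (intro power_mono) auto
      then show "norm ((xn (v t))\<^sup>2) \<le> norm (C\<^sup>2 * (H1_norm S (v t))\<^sup>2)" by (simp add: power_mult_distrib)
    qed
  qed (use m in auto)
  with m show ?thesis by (simp add: L2_def)
qed

lemma X_norm_eq:
  assumes v: "v \<in> bochner_L2 I (H1_norm S) W" and W: "W \<subseteq> sobolev_H1 S"
  shows "X_norm S \<kappa> I v = l2_norm I (\<lambda>t. xn (v t))"
proof -
  have "(\<integral>t. (l2_norm S (v t))\<^sup>2 + (a_norm S \<kappa> (v t))\<^sup>2 \<partial>lebesgue_on I) = l2_inner I (\<lambda>t. xn (v t)) (\<lambda>t. xn (v t))"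
    unfolding l2_inner_def
  proof (rule Bochner_Integration.integral_cong)
    fix t assume "t \<in> space (lebesgue_on I)"
    then have "v t \<in> sobolev_H1 S" using bochner_L2_mem[OF v] W by auto
    then show "(l2_norm S (v t))\<^sup>2 + (a_norm S \<kappa> (v t))\<^sup>2 = xn (v t) * xn (v t)"
      using xn_props(1) by (simp add: power2_eq_square)
  qed simp
  then show ?thesis by (simp add: X_norm_def l2_norm_def)
qed

text \<open>The integrand is compared with the product of the norms at each time, followed by
  Cauchy-Schwarz in time. Integrability of the inner products is decided by cases: a non-integrable
  function has integral 0 by convention, and 0 satisfies the bound.\<close>

lemma X_inner_le:
  assumes u: "u \<in> bochner_L2 I (H1_norm S) V1" and v: "v \<in> bochner_L2 I (H1_norm S) V2"
  shows "X_inner S \<kappa> I u v \<le> X_norm S \<kappa> I u * X_norm S \<kappa> I v"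
proof -
  have W: "V1 \<subseteq> sobolev_H1 S" "V2 \<subseteq> sobolev_H1 S" using V1_H1 V2_H1 by auto
  note p = bochner_x_norm_L2[OF u W(1)] and q = bochner_x_norm_L2[OF v W(2)]
  note n = X_norm_eq[OF u W(1)] X_norm_eq[OF v W(2)]
  have n0: "0 \<le> X_norm S \<kappa> I u" "0 \<le> X_norm S \<kappa> I v"
    unfolding n using lt.nrm_nonneg p q by (simp_all add: l2_norm_nrm)
  show ?thesis
  proof (cases "integrable (lebesgue_on I) (\<lambda>t. x_form S \<kappa> (u t) (v t))")
    case True
    have "X_inner S \<kappa> I u v \<le> l2_inner I (\<lambda>t. xn (u t)) (\<lambda>t. xn (v t))"
      unfolding X_inner_def x_form_def[symmetric] l2_inner_def[of I]
    proof (rule integral_mono[OF True L2_mult_integrable[OF p q]])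
      fix t assume "t \<in> space (lebesgue_on I)"
      then have "u t \<in> sobolev_H1 S" "v t \<in> sobolev_H1 S"
        using bochner_L2_mem[OF u] bochner_L2_mem[OF v] W by auto
      then show "x_form S \<kappa> (u t) (v t) \<le> xn (u t) * xn (v t)"
        using x.Cauchy_Schwarz by (fastforce simp: nrm_eqs abs_le_iff)
    qed
    also have "\<dots> \<le> l2_norm I (\<lambda>t. xn (u t)) * l2_norm I (\<lambda>t. xn (v t))"
      using lt.Cauchy_Schwarz[OF p q] by (simp add: l2_norm_nrm)
    finally show ?thesis by (simp add: n)
  next
    case False
    then have "X_inner S \<kappa> I u v = 0"
      unfolding X_inner_def x_form_def[symmetric] by (rule not_integrable_integral_eq)
    then show ?thesis using n0 by simp
  qed
qed

lemma gamma_X_upper: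
  assumes u: "u \<in> bochner_L2 I (H1_norm S) V1" and v: "v \<in> bochner_L2 I (H1_norm S) V2"
  shows "X_inner S \<kappa> I u v / (X_norm S \<kappa> I u * X_norm S \<kappa> I v) \<le> gX"
proof -
  have "bdd_above ((\<lambda>(v1, v2). X_inner S \<kappa> I v1 v2 / (X_norm S \<kappa> I v1 * X_norm S \<kappa> I v2)) `
      (bochner_L2 I (H1_norm S) V1 \<times> bochner_L2 I (H1_norm S) V2))"
  proof (rule bdd_aboveI2[where M = 1])
    fix z assume "z \<in> bochner_L2 I (H1_norm S) V1 \<times> bochner_L2 I (H1_norm S) V2"
    then obtain v1 v2 where z: "z = (v1, v2)" "v1 \<in> bochner_L2 I (H1_norm S) V1" "v2 \<in> bochner_L2 I (H1_norm S) V2"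
      by auto
    have W: "V1 \<subseteq> sobolev_H1 S" "V2 \<subseteq> sobolev_H1 S" using V1_H1 V2_H1 by auto
    have n0: "0 \<le> X_norm S \<kappa> I v1" "0 \<le> X_norm S \<kappa> I v2"
      unfolding X_norm_eq[OF z(2) W(1)] X_norm_eq[OF z(3) W(2)]
      using lt.nrm_nonneg bochner_x_norm_L2 z W by (simp_all add: l2_norm_nrm)
    show "(case z of (v1, v2) \<Rightarrow> X_inner S \<kappa> I v1 v2 / (X_norm S \<kappa> I v1 * X_norm S \<kappa> I v2)) \<le> 1"
      using X_inner_le[OF z(2,3)] n0 by (cases "X_norm S \<kappa> I v1 * X_norm S \<kappa> I v2 = 0")
        (auto simp: z(1) divide_le_eq mult_less_0_iff zero_less_mult_iff not_less)
  qed
  from cSUP_upper[OF _ this, of "(u, v)"] show ?thesis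
    unfolding gamma_X_def using u v by simp
qed

lemma X_norm_const: "v \<in> W \<Longrightarrow> W \<subseteq> sobolev_H1 S \<Longrightarrow> X_norm S \<kappa> I (\<lambda>t. v) = sqrt (b - a) * xn v"
  using X_norm_eq[OF bochner_const, of v W] lt.nrm_scale[OF const_L2_I[of 1], of "xn v"] l2_norm_I_const xn_props(6)
  by (auto simp: l2_norm_nrm mult.commute)

lemma X_inner_const: "X_inner S \<kappa> I (\<lambda>t. u) (\<lambda>t. v) = (b - a) * x_form S \<kappa> u v"
  using I_measure by (simp add: X_inner_def x_form_def)

text \<open>The pair of zero functions contributes the quotient 0 / 0 = 0 to the supremum.\<close>

lemma gamma_X_nonneg: "0 \<le> gX"
proof -
  have W: "V1 \<subseteq> sobolev_H1 S" "V2 \<subseteq> sobolev_H1 S" using V1_H1 V2_H1 by auto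
  have "xn (\<lambda>x. 0) = 0" using x.zero(3)[OF V1_H1[OF V1_zero]] by (simp add: nrm_eqs)
  then have "X_norm S \<kappa> I (\<lambda>t x. 0) = 0" using X_norm_const[OF V1_zero W(1)] by simp
  then show ?thesis
    using gamma_X_upper[OF bochner_const[OF V1_zero W(1)] bochner_const[OF V2_zero W(2)]] by simp
qed

text \<open>For functions constant in time, the length of the interval occurs in numerator and
  denominator and cancels. If a norm vanishes, the ordinary Cauchy-Schwarz inequality
  applies.\<close>

lemma strengthened_Cauchy_Schwarz:
  assumes v1: "v1 \<in> V1" and v2: "v2 \<in> V2"
  shows "x_form S \<kappa> v1 v2 \<le> gX * (xn v1 * xn v2)"
proof (cases "xn v1 * xn v2 = 0")
  case True
  have "\<bar>x_form S \<kappa> v1 v2\<bar> \<le> xn v1 * xn v2"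
    using x.Cauchy_Schwarz[OF V1_H1[OF v1] V2_H1[OF v2]] by (simp add: nrm_eqs)
  then show ?thesis unfolding True by simp
next
  case False
  have W: "V1 \<subseteq> sobolev_H1 S" "V2 \<subseteq> sobolev_H1 S" using V1_H1 V2_H1 by auto
  have pos: "xn v1 * xn v2 > 0"
    using False xn_props(6)[OF V1_H1[OF v1]] xn_props(6)[OF V2_H1[OF v2]] by (simp add: zero_less_mult_iff less_le)
  have "(sqrt (b - a) * xn v1) * (sqrt (b - a) * xn v2) = (sqrt (b - a) * sqrt (b - a)) * (xn v1 * xn v2)"
    by (simp only: mult_ac)
  also have "sqrt (b - a) * sqrt (b - a) = b - a" using ab by simp
  finally have sq: "(sqrt (b - a) * xn v1) * (sqrt (b - a) * xn v2) = (b - a) * (xn v1 * xn v2)" .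
  have "(b - a) * x_form S \<kappa> v1 v2 / ((b - a) * (xn v1 * xn v2)) \<le> gX"
    using gamma_X_upper[OF bochner_const[OF v1 W(1)] bochner_const[OF v2 W(2)]]
    unfolding X_inner_const X_norm_const[OF v1 W(1)] X_norm_const[OF v2 W(2)] sq .
  then show ?thesis using pos ab by (simp add: divide_le_eq)
qed

lemma split_norm_le:
  assumes v1: "v1 \<in> V1" and v2: "v2 \<in> V2"
  shows "(1 - gX) * ((xn v1)\<^sup>2 + (xn v2)\<^sup>2) \<le> (xn (\<lambda>x. v1 x + v2 x))\<^sup>2"
proof -
  note h1 = V1_H1[OF v1] and h2 = V2_H1[OF v2]
  \<comment> \<open>The strengthened inequality bounds the form from above only; a lower bound is
    needed, so it is applied to the negative of \<open>v1\<close>.\<close>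
  have m: "(\<lambda>x. 0 + (-1) * v1 x) \<in> V1" by (rule V1_comb[OF V1_zero v1])
  have m': "(\<lambda>x. (-1) * v1 x) \<in> V1" using m by simp
  have "x_form S \<kappa> (\<lambda>x. (-1) * v1 x) v2 \<le> gX * (xn (\<lambda>x. (-1) * v1 x) * xn v2)"
    by (rule strengthened_Cauchy_Schwarz[OF m' v2])
  then have "- x_form S \<kappa> v1 v2 \<le> gX * (xn v1 * xn v2)"
    using x.scale_left[OF h1 h2, of "-1"] x.nrm_scale[OF h1, of "-1"] by (simp add: nrm_eqs)
  moreover have "gX * (2 * (xn v1 * xn v2)) \<le> gX * ((xn v1)\<^sup>2 + (xn v2)\<^sup>2)"
    using sum_squares_bound[of "xn v1" "xn v2"] by (intro mult_left_mono gamma_X_nonneg) simp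
  moreover have "(xn (\<lambda>x. v1 x + v2 x))\<^sup>2 = (xn v1)\<^sup>2 + 2 * x_form S \<kappa> v1 v2 + (xn v2)\<^sup>2"
    using x.expand[OF h1 h2, of 1] x.nrm_sq[OF x.add[OF h1 h2]] x.nrm_sq[OF h1] x.nrm_sq[OF h2] by (simp add: nrm_eqs)
  ultimately show ?thesis by (simp add: algebra_simps)
qed

end

section \<open>The residual estimate on one time slab\<close>

context split_space
begin

text \<open>All that the scheme has to provide is collected in \<open>e1\<close> and
  \<open>e2\<close>: at each time, the residual with \<open>f\<close> replaced by the projected
  source \<open>g\<close> is small on either component. Here \<open>d\<close> stands for the time
  derivative of the interpolant, and \<open>p\<close>, \<open>q\<close> for its initial value and
  increment.\<close>

lemma residual_bound:
  assumes f: "f \<in> bochner_L2 I (l2_norm S) (L2 S)" and g: "g \<in> VH" and F: "\<And>t. t \<in> I \<Longrightarrow> F t = g"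
    and d: "d \<in> VH" and dU: "\<And>t x. deriv (\<lambda>\<tau>. U \<tau> x) t = d x"
    and p: "p \<in> VH" and q: "q \<in> VH" and U: "\<And>t. U t = (\<lambda>x. p x + (t - a) / (b - a) * q x)"
    and E: "0 \<le> E1" "0 \<le> E2"
    and e1: "\<And>t w. t \<in> I \<Longrightarrow> w \<in> V1 \<Longrightarrow> l2_inner S g w - l2_inner S d w - a_form S \<kappa> (U t) w \<le> E1 * xn w"
    and e2: "\<And>t w. t \<in> I \<Longrightarrow> w \<in> V2 \<Longrightarrow> l2_inner S g w - l2_inner S d w - a_form S \<kappa> (U t) w \<le> E2 * xn w"
    and v: "v \<in> bochner_L2 I (H1_norm S) VH" and v1: "X_norm S \<kappa> I v = 1"
  shows "residual S \<kappa> I f U v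
    \<le> sqrt (E1\<^sup>2 + E2\<^sup>2) / sqrt (1 - gX) * sqrt (b - a) + L2L2_norm S I (\<lambda>t x. f t x - F t x)"
proof -
  have W: "VH \<subseteq> sobolev_H1 S" using VH_H1 by auto
  have vt: "v t \<in> VH" "v t \<in> sobolev_H1 S" "v t \<in> L2 S" if "t \<in> I" for t
    using bochner_L2_mem[OF v that] W sobolev_H1_wgrad(1) by auto
  have ft: "f t \<in> L2 S" if "t \<in> I" for t by (rule bochner_L2_mem[OF f that])
  have gL: "g \<in> L2 S" and dL: "d \<in> L2 S" using g d W sobolev_H1_wgrad(1) by auto
  have pH: "p \<in> sobolev_H1 S" and qH: "q \<in> sobolev_H1 S" using p q W by auto
  have UH: "U t \<in> sobolev_H1 S" for t unfolding U by (rule x.comb[OF pH qH])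
  note xv = bochner_x_norm_L2[OF v W]
  have xv0: "0 \<le> xn (v t)" if "t \<in> I" for t using xn_props(6)[OF vt(2)[OF that]] .
  have lx: "l2_norm S (v t) \<le> xn (v t)" "a_norm S \<kappa> (v t) \<le> xn (v t)" if "t \<in> I" for t
    using xn_props(2,3)[OF vt(2)[OF that]] .
  \<comment> \<open>A common criterion for the three integrands of the residual: measurable, and
    dominated by a square integrable function of time times the norm of \<open>v t\<close>.\<close>
  have bounded_integrable: "integrable (lebesgue_on I) q'"
    if m: "q' \<in> borel_measurable (lebesgue_on I)" and h: "h \<in> L2 I" and le: "\<And>t. t \<in> I \<Longrightarrow> \<bar>q' t\<bar> \<le> h t * xn (v t)" for q' h
  proof (rule Bochner_Integration.integrable_bound[OF L2_mult_integrable[OF h xv] m], rule AE_I2)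
    fix t assume "t \<in> space (lebesgue_on I)"
    then have "t \<in> I" by simp
    from le[OF this] show "norm (q' t) \<le> norm (h t * xn (v t))" by simp
  qed
  \<comment> \<open>Used with w = 0 for the norm of \<open>f\<close> and with w = g for the data
    error.\<close>
  have fm: "(\<lambda>t. l2_norm S (\<lambda>x. f t x - w x)) \<in> borel_measurable (lebesgue_on I)" if w: "w \<in> L2 S" for w
  proof (rule bochner_L2_lipschitz_measurable[OF I_sets f, where C = 1])
    fix y z :: "'a \<Rightarrow> real" assume yz: "y \<in> L2 S" "z \<in> L2 S"
    have "(\<lambda>x. (y x - w x) - (z x - w x)) = (\<lambda>x. y x - z x)" by (simp add: fun_eq_iff)
    then show "\<bar>l2_norm S (\<lambda>x. y x - w x) - l2_norm S (\<lambda>x. z x - w x)\<bar> \<le> 1 * l2_norm S (\<lambda>x. y x - z x)"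
      using l.triangle_abs[OF l.diff[OF yz(1) w] l.diff[OF yz(2) w]] by (simp add: l2_norm_nrm)
  qed
  have fL: "(\<lambda>t. l2_norm S (f t)) \<in> L2 I"
    using fm[OF L2_zero] f by (simp add: L2_def bochner_L2_def)
  have fgL: "(\<lambda>t. l2_norm S (\<lambda>x. f t x - g x)) \<in> L2 I"
  proof (rule L2_bound[where R = 1])
    show "(\<lambda>t. l2_norm S (f t) + l2_norm S g * 1) \<in> L2 I"
      by (rule L2_comb_real[OF fL const_L2_I])
    fix t assume t: "t \<in> I"
    have "l2_norm S (\<lambda>x. f t x - g x) \<le> l2_norm S (f t) + l2_norm S g"
      using l.triangle[OF ft[OF t] gL, of "-1"] by (simp add: l2_norm_nrm)
    moreover have "0 \<le> l2_norm S (\<lambda>x. f t x - g x)"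
      using l.nrm_nonneg[OF l.diff[OF ft[OF t] gL]] by (simp add: l2_norm_nrm)
    ultimately show "norm (l2_norm S (\<lambda>x. f t x - g x)) \<le> 1 * norm (l2_norm S (f t) + l2_norm S g * 1)" by simp
  qed (rule fm[OF gL])
  have iA: "integrable (lebesgue_on I) (\<lambda>t. l2_inner S (f t) (v t))"
  proof (rule bounded_integrable[OF _ fL])
    show "(\<lambda>t. l2_inner S (f t) (v t)) \<in> borel_measurable (lebesgue_on I)"
    proof (rule bochner_L2_inner_measurable[OF I_sets f v])
      show "VH \<subseteq> L2 S" using W sobolev_H1_wgrad(1) by blast
      show "l2_norm S (\<lambda>z. y z - w z) \<le> H1_norm S (\<lambda>z. y z - w z)" if "y \<in> VH" "w \<in> VH" for y w
        by (rule l2_le_H1[OF x.diff]) (use that W in auto)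
    qed
    fix t assume t: "t \<in> I"
    have "\<bar>l2_inner S (f t) (v t)\<bar> \<le> l2_norm S (f t) * l2_norm S (v t)"
      using l.Cauchy_Schwarz[OF ft[OF t] vt(3)[OF t]] by (simp add: l2_norm_nrm)
    also have "\<dots> \<le> l2_norm S (f t) * xn (v t)"
      using lx(1)[OF t] l.nrm_nonneg[OF ft[OF t]] by (intro mult_left_mono) (auto simp: l2_norm_nrm)
    finally show "\<bar>l2_inner S (f t) (v t)\<bar> \<le> l2_norm S (f t) * xn (v t)" .
  qed
  have iB: "integrable (lebesgue_on I) (\<lambda>t. l2_inner S d (v t))"
  proof (rule bounded_integrable[OF _ const_L2_I[of "l2_norm S d"]])
    have d0: "0 \<le> l2_norm S d" using l.nrm_nonneg[OF dL] by (simp add: l2_norm_nrm)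
    show "(\<lambda>t. l2_inner S d (v t)) \<in> borel_measurable (lebesgue_on I)"
    proof (rule bochner_L2_lipschitz_measurable[OF I_sets v, where C = "l2_norm S d"])
      fix y z assume "y \<in> VH" "z \<in> VH"
      then have yz: "y \<in> sobolev_H1 S" "z \<in> sobolev_H1 S" using W by auto
      note yzL = sobolev_H1_wgrad(1)[OF yz(1)] sobolev_H1_wgrad(1)[OF yz(2)]
      have "\<bar>l2_inner S d y - l2_inner S d z\<bar> = \<bar>l2_inner S (\<lambda>x. y x - z x) d\<bar>"
        using l.diff_left[OF yzL dL] l.sym[OF yzL(1) dL] l.sym[OF yzL(2) dL] by simp
      also have "\<dots> \<le> l2_norm S (\<lambda>x. y x - z x) * l2_norm S d"
        using l.Cauchy_Schwarz[OF l.diff[OF yzL] dL] by (simp add: l2_norm_nrm)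
      also have "\<dots> \<le> H1_norm S (\<lambda>x. y x - z x) * l2_norm S d"
        by (rule mult_right_mono[OF l2_le_H1[OF x.diff[OF yz]] d0])
      finally show "\<bar>l2_inner S d y - l2_inner S d z\<bar> \<le> l2_norm S d * H1_norm S (\<lambda>x. y x - z x)"
        by (simp add: mult.commute)
    qed
    fix t assume t: "t \<in> I"
    have "\<bar>l2_inner S d (v t)\<bar> \<le> l2_norm S d * l2_norm S (v t)"
      using l.Cauchy_Schwarz[OF dL vt(3)[OF t]] by (simp add: l2_norm_nrm)
    also have "\<dots> \<le> l2_norm S d * xn (v t)" by (rule mult_left_mono[OF lx(1)[OF t] d0])
    finally show "\<bar>l2_inner S d (v t)\<bar> \<le> l2_norm S d * xn (v t)" .
  qed
  have a_int: "integrable (lebesgue_on I) (\<lambda>t. a_form S \<kappa> w (v t))" 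
    and a_meas: "(\<lambda>t. a_form S \<kappa> w (v t)) \<in> borel_measurable (lebesgue_on I)"
    and a_le: "\<And>t. t \<in> I \<Longrightarrow> \<bar>a_form S \<kappa> w (v t)\<bar> \<le> a_norm S \<kappa> w * xn (v t)"
    if w: "w \<in> sobolev_H1 S" for w
  proof -
    have w0: "0 \<le> a_norm S \<kappa> w" using xn_props(5)[OF w] .
    obtain C where C: "0 \<le> C" "\<And>u. u \<in> sobolev_H1 S \<Longrightarrow> x_norm S \<kappa> u \<le> C * H1_norm S u"
      using x_norm_le_H1_norm[OF S \<kappa>] by blast
    have CS: "\<bar>a_form S \<kappa> w y\<bar> \<le> a_norm S \<kappa> w * xn y" if y: "y \<in> sobolev_H1 S" for y
    proof -
      have "\<bar>a_form S \<kappa> w y\<bar> \<le> a_norm S \<kappa> w * a_norm S \<kappa> y"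
        using af.Cauchy_Schwarz[OF w y] by (simp add: nrm_eqs)
      also have "\<dots> \<le> a_norm S \<kappa> w * xn y" by (rule mult_left_mono[OF xn_props(3)[OF y] w0])
      finally show ?thesis .
    qed
    show m: "(\<lambda>t. a_form S \<kappa> w (v t)) \<in> borel_measurable (lebesgue_on I)"
    proof (rule bochner_L2_lipschitz_measurable[OF I_sets v, where C = "a_norm S \<kappa> w * C"])
      fix y z assume "y \<in> VH" "z \<in> VH"
      then have yz: "y \<in> sobolev_H1 S" "z \<in> sobolev_H1 S" using W by auto
      note dyz = x.diff[OF yz]
      have "\<bar>a_form S \<kappa> w y - a_form S \<kappa> w z\<bar> = \<bar>a_form S \<kappa> w (\<lambda>x. y x - z x)\<bar>"
        using af.diff_left[OF yz w] af.sym[OF yz(1) w] af.sym[OF yz(2) w] af.sym[OF dyz w] by simp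
      also have "\<dots> \<le> a_norm S \<kappa> w * xn (\<lambda>x. y x - z x)" by (rule CS[OF dyz])
      also have "\<dots> \<le> a_norm S \<kappa> w * (C * H1_norm S (\<lambda>x. y x - z x))"
        by (rule mult_left_mono[OF C(2)[OF dyz] w0])
      finally show "\<bar>a_form S \<kappa> w y - a_form S \<kappa> w z\<bar> \<le> a_norm S \<kappa> w * C * H1_norm S (\<lambda>x. y x - z x)"
        by (simp add: mult.assoc)
    qed
    show le: "\<bar>a_form S \<kappa> w (v t)\<bar> \<le> a_norm S \<kappa> w * xn (v t)" if "t \<in> I" for t
      by (rule CS[OF vt(2)[OF that]])
    show "integrable (lebesgue_on I) (\<lambda>t. a_form S \<kappa> w (v t))"
      by (rule bounded_integrable[OF m const_L2_I[of "a_norm S \<kappa> w"] le])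
  qed
  \<comment> \<open>\<open>U\<close> is affine in time, so this is a pairing with the fixed
    \<open>p\<close> plus a factor in [0, 1] times a pairing with the fixed
    \<open>q\<close>.\<close>
  have iC: "integrable (lebesgue_on I) (\<lambda>t. a_form S \<kappa> (U t) (v t))"
  proof -
    have "integrable (lebesgue_on I) (\<lambda>t. (t - a) / (b - a) * a_form S \<kappa> q (v t))"
    proof (rule bounded_integrable[OF _ const_L2_I[of "a_norm S \<kappa> q"]])
      have "(\<lambda>t. (t - a) / (b - a)) \<in> borel_measurable (lebesgue_on I)"
        by (intro measurable_restrict_space1 measurable_completion) simp
      then show "(\<lambda>t. (t - a) / (b - a) * a_form S \<kappa> q (v t)) \<in> borel_measurable (lebesgue_on I)"
        using a_meas[OF qH] by (rule borel_measurable_times)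
      fix t assume t: "t \<in> I"
      then have "\<bar>(t - a) / (b - a)\<bar> \<le> 1" by simp
      then have "\<bar>(t - a) / (b - a)\<bar> * \<bar>a_form S \<kappa> q (v t)\<bar> \<le> 1 * \<bar>a_form S \<kappa> q (v t)\<bar>"
        by (rule mult_right_mono) simp
      then show "\<bar>(t - a) / (b - a) * a_form S \<kappa> q (v t)\<bar> \<le> a_norm S \<kappa> q * xn (v t)"
        unfolding abs_mult using a_le[OF qH t] by simp
    qed
    then have "integrable (lebesgue_on I) (\<lambda>t. a_form S \<kappa> p (v t) + (t - a) / (b - a) * a_form S \<kappa> q (v t))"
      using a_int[OF pH] by simp
    then show ?thesis
    proof (rule Bochner_Integration.integrable_cong[THEN iffD1, rotated 2])
      fix t assume "t \<in> space (lebesgue_on I)"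
      then have t: "t \<in> I" by simp
      show "a_form S \<kappa> p (v t) + (t - a) / (b - a) * a_form S \<kappa> q (v t) = a_form S \<kappa> (U t) (v t)"
        unfolding U by (rule af.lin[OF pH qH vt(2)[OF t], symmetric])
    qed simp
  qed
  define k where "k = sqrt (E1\<^sup>2 + E2\<^sup>2) / sqrt (1 - gX)"
  have res: "residual S \<kappa> I f U v = (\<integral>t. l2_inner S (f t) (v t) - l2_inner S d (v t) - a_form S \<kappa> (U t) (v t) \<partial>lebesgue_on I)"
    unfolding residual_def dU using iA iB iC by simp
  also have "\<dots> \<le> (\<integral>t. l2_norm S (\<lambda>x. f t x - g x) * xn (v t) + k * (1 * xn (v t)) \<partial>lebesgue_on I)"
  proof (rule integral_mono)
    show "integrable (lebesgue_on I) (\<lambda>t. l2_inner S (f t) (v t) - l2_inner S d (v t) - a_form S \<kappa> (U t) (v t))"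
      using iA iB iC by simp
    show "integrable (lebesgue_on I) (\<lambda>t. l2_norm S (\<lambda>x. f t x - g x) * xn (v t) + k * (1 * xn (v t)))"
      using L2_mult_integrable[OF fgL xv] L2_mult_integrable[OF const_L2_I[of 1] xv] by simp
    fix t assume "t \<in> space (lebesgue_on I)"
    then have t: "t \<in> I" by simp
    obtain w1 w2 where w: "w1 \<in> V1" "w2 \<in> V2" "v t = (\<lambda>x. w1 x + w2 x)" using VH_E[OF vt(1)[OF t]] .
    note h1 = V1_H1[OF w(1)] and h2 = V2_H1[OF w(2)]
    note l1 = sobolev_H1_wgrad(1)[OF h1] and l2 = sobolev_H1_wgrad(1)[OF h2]
    let ?r = "\<lambda>w. l2_inner S g w - l2_inner S d w - a_form S \<kappa> (U t) w"
    have "l2_inner S (f t) (v t) - l2_inner S d (v t) - a_form S \<kappa> (U t) (v t) = l2_inner S (\<lambda>x. f t x - g x) (v t) + ?r (v t)"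
      using l.diff_left[OF ft[OF t] gL vt(3)[OF t]] by simp
    moreover have "?r (v t) = ?r w1 + ?r w2"
      unfolding w(3) using l.add_right[OF l1 l2] af.add_right[OF h1 h2] gL dL UH by simp
    moreover have "l2_inner S (\<lambda>x. f t x - g x) (v t) \<le> l2_norm S (\<lambda>x. f t x - g x) * xn (v t)"
    proof -
      have "l2_inner S (\<lambda>x. f t x - g x) (v t) \<le> l2_norm S (\<lambda>x. f t x - g x) * l2_norm S (v t)"
        using l.Cauchy_Schwarz[OF l.diff[OF ft[OF t] gL] vt(3)[OF t]] by (simp add: l2_norm_nrm)
      also have "\<dots> \<le> l2_norm S (\<lambda>x. f t x - g x) * xn (v t)"
        using lx(1)[OF t] l.nrm_nonneg[OF l.diff[OF ft[OF t] gL]] by (intro mult_left_mono) (auto simp: l2_norm_nrm)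
      finally show ?thesis .
    qed
    moreover have "E1 * xn w1 + E2 * xn w2 \<le> k * xn (v t)"
    proof -
      have g1: "0 < 1 - gX" using gamma_X_less by simp
      have "E1 * xn w1 + E2 * xn w2 \<le> sqrt ((E1 * xn w1 + E2 * xn w2)\<^sup>2)" by simp
      also have "\<dots> \<le> sqrt ((E1\<^sup>2 + E2\<^sup>2) * ((xn w1)\<^sup>2 + (xn w2)\<^sup>2))"
      proof (rule real_sqrt_le_mono)
        \<comment> \<open>Cauchy-Schwarz in the plane through Lagrange's identity: the difference of
          the two sides is (E1 |w2| - E2 |w1|)^2.\<close>
        show "(E1 * xn w1 + E2 * xn w2)\<^sup>2 \<le> (E1\<^sup>2 + E2\<^sup>2) * ((xn w1)\<^sup>2 + (xn w2)\<^sup>2)"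
          using zero_le_power2[of "E1 * xn w2 - E2 * xn w1"] by (simp add: power2_eq_square algebra_simps)
      qed
      also have "\<dots> \<le> sqrt ((E1\<^sup>2 + E2\<^sup>2) * ((xn (v t))\<^sup>2 / (1 - gX)))"
        using split_norm_le[OF w(1,2)] g1 unfolding w(3)
        by (intro real_sqrt_le_mono mult_left_mono) (simp_all add: pos_le_divide_eq mult.commute)
      also have "\<dots> = k * xn (v t)"
        using xv0[OF t] by (simp add: k_def real_sqrt_mult real_sqrt_divide)
      finally show ?thesis .
    qed
    ultimately show "l2_inner S (f t) (v t) - l2_inner S d (v t) - a_form S \<kappa> (U t) (v t)
      \<le> l2_norm S (\<lambda>x. f t x - g x) * xn (v t) + k * (1 * xn (v t))"
      using e1[OF t w(1)] e2[OF t w(2)] by simp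
  qed
  also have "\<dots> = l2_inner I (\<lambda>t. l2_norm S (\<lambda>x. f t x - g x)) (\<lambda>t. xn (v t)) + k * l2_inner I (\<lambda>t. 1) (\<lambda>t. xn (v t))"
    unfolding l2_inner_def[of I] using L2_mult_integrable[OF fgL xv] L2_mult_integrable[OF const_L2_I[of 1] xv] by simp
  also have "\<dots> \<le> L2L2_norm S I (\<lambda>t x. f t x - F t x) + k * sqrt (b - a)"
  proof (rule add_mono)
    \<comment> \<open>The normalization of \<open>v\<close>. With Cauchy-Schwarz in time it removes
      \<open>v\<close> from both terms; the constant function 1 contributes sqrt (b - a).\<close>
    have X1: "l2_norm I (\<lambda>t. xn (v t)) = 1" using X_norm_eq[OF v W] v1 by simp
    have "(\<integral>t. (l2_norm S (\<lambda>x. f t x - F t x))\<^sup>2 \<partial>lebesgue_on I) =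
        l2_inner I (\<lambda>t. l2_norm S (\<lambda>x. f t x - g x)) (\<lambda>t. l2_norm S (\<lambda>x. f t x - g x))"
      unfolding l2_inner_def[of I] by (rule Bochner_Integration.integral_cong) (auto simp: F power2_eq_square)
    then have L: "L2L2_norm S I (\<lambda>t x. f t x - F t x) = l2_norm I (\<lambda>t. l2_norm S (\<lambda>x. f t x - g x))"
      by (simp add: L2L2_norm_def l2_norm_def[of I])
    show "l2_inner I (\<lambda>t. l2_norm S (\<lambda>x. f t x - g x)) (\<lambda>t. xn (v t)) \<le> L2L2_norm S I (\<lambda>t x. f t x - F t x)"
      using lt.Cauchy_Schwarz[OF fgL xv] X1 unfolding L by (simp add: l2_norm_nrm[of I])
    have "l2_inner I (\<lambda>t. 1) (\<lambda>t. xn (v t)) \<le> sqrt (b - a)"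
      using lt.Cauchy_Schwarz[OF const_L2_I[of 1] xv] X1 l2_norm_I_const by (simp add: l2_norm_nrm[of I])
    moreover have "0 \<le> k" using gamma_X_less by (simp add: k_def)
    ultimately show "k * l2_inner I (\<lambda>t. 1) (\<lambda>t. xn (v t)) \<le> k * sqrt (b - a)" by (rule mult_left_mono)
  qed
  finally show ?thesis by (simp add: k_def add.commute)
qed

text \<open>Written once for both equations of the scheme. \<open>A\<close> and \<open>B\<close> are
  the two difference quotients of an equation, \<open>d\<close> is the derivative of the
  interpolant, \<open>P\<close> the argument of the energy form in the scheme and \<open>Q\<close>
  the interpolant; \<open>w\<close> is a second difference, \<open>y\<close> and \<open>z\<close>
  are the increments.\<close>

lemma consistency_bound:
  assumes H1: "A \<in> sobolev_H1 S" "B \<in> sobolev_H1 S" "d \<in> sobolev_H1 S" "P \<in> sobolev_H1 S" "Q \<in> sobolev_H1 S"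
      "y \<in> sobolev_H1 S" "z \<in> sobolev_H1 S" "w \<in> sobolev_H1 S" "v \<in> sobolev_H1 S"
    and eq1: "\<And>x. A x + B x - d x = - \<tau> * w x" and eq2: "\<And>x. P x - Q x = c1 * y x + c2 * z x"
    and c: "\<bar>c1\<bar> \<le> 1" "\<bar>c2\<bar> \<le> 1" and \<tau>: "0 \<le> \<tau>" and w: "\<bar>l2_inner S w v\<bar> \<le> N * xn v"
  shows "l2_inner S A v + l2_inner S B v + a_form S \<kappa> P v - l2_inner S d v - a_form S \<kappa> Q v
    \<le> (a_norm S \<kappa> y + a_norm S \<kappa> z + \<tau> * N) * xn v"
proof -
  note L = H1[THEN sobolev_H1_wgrad(1)]
  have "l2_inner S A v + l2_inner S B v - l2_inner S d v = l2_inner S (\<lambda>x. A x + B x - d x) v"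
    using l.diff_left[OF l.add[OF L(1,2)] L(3,9)] l.add_left[OF L(1,2,9)] by simp
  also have "\<dots> = - \<tau> * l2_inner S w v"
    unfolding eq1 by (rule l.scale_left[OF L(8,9)])
  also have "\<dots> \<le> \<tau> * (N * xn v)"
    using mult_left_mono[OF w \<tau>] mult_left_mono[OF abs_ge_minus_self[of "l2_inner S w v"] \<tau>] by linarith
  finally have 1: "l2_inner S A v + l2_inner S B v - l2_inner S d v \<le> \<tau> * (N * xn v)" .
  have bnd: "c * a_form S \<kappa> u v \<le> a_norm S \<kappa> u * xn v" if u: "u \<in> sobolev_H1 S" and c: "\<bar>c\<bar> \<le> 1" for u c
  proof -
    have "c * a_form S \<kappa> u v \<le> \<bar>c\<bar> * \<bar>a_form S \<kappa> u v\<bar>" by (metis abs_ge_self abs_mult)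
    also have "\<dots> \<le> 1 * \<bar>a_form S \<kappa> u v\<bar>" using c by (intro mult_right_mono) auto
    also have "\<dots> \<le> a_norm S \<kappa> u * a_norm S \<kappa> v"
      using af.Cauchy_Schwarz[OF u H1(9)] by (simp add: nrm_eqs)
    also have "\<dots> \<le> a_norm S \<kappa> u * xn v"
      by (rule mult_left_mono[OF xn_props(3)[OF H1(9)] xn_props(5)[OF u]])
    finally show ?thesis .
  qed
  have "a_form S \<kappa> P v - a_form S \<kappa> Q v = a_form S \<kappa> (\<lambda>x. P x - Q x) v"
    using af.diff_left[OF H1(4,5,9)] by simp
  also have "\<dots> = c1 * a_form S \<kappa> y v + c2 * a_form S \<kappa> z v"
    unfolding eq2 using af.lin[OF af.scale(1)[OF H1(6), of c1] H1(7,9), of c2] af.scale_left[OF H1(6,9), of c1] by simp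
  also have "\<dots> \<le> a_norm S \<kappa> y * xn v + a_norm S \<kappa> z * xn v"
    by (intro add_mono bnd H1 c)
  finally show ?thesis using 1 by (simp add: algebra_simps)
qed

text \<open>A least upper bound is below \<open>M\<close> only if the set is nonempty. The vector
  \<open>w\<close>, scaled and taken constant in time, is an element of X-norm 1; the factor sqrt (b
  - a) in the scaling is the effect of the time integration.\<close>

lemma residual_dual_norm_le:
  assumes ne: "w \<in> VH" "xn w > 0"
    and le: "\<And>v. v \<in> bochner_L2 I (H1_norm S) VH \<Longrightarrow> X_norm S \<kappa> I v = 1 \<Longrightarrow> residual S \<kappa> I f U v \<le> M"
  shows "residual_dual_norm S \<kappa> I VH f U \<le> M"
  unfolding residual_dual_norm_def
proof (rule cSUP_least)
  have W: "VH \<subseteq> sobolev_H1 S" using VH_H1 by auto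
  let ?c = "1 / (sqrt (b - a) * xn w)"
  have s: "0 < sqrt (b - a)" using ab by simp
  have "(\<lambda>x. w x + (?c - 1) * w x) \<in> VH" by (rule VH_comb[OF ne(1) ne(1)])
  then have cw: "(\<lambda>x. ?c * w x) \<in> VH" by (simp add: algebra_simps)
  have "xn (\<lambda>x. ?c * w x) = ?c * xn w"
    using x.nrm_scale[OF VH_H1[OF ne(1)], of ?c] s ne(2) by (simp add: nrm_eqs)
  then have "X_norm S \<kappa> I (\<lambda>t x. ?c * w x) = 1"
    using X_norm_const[OF cw W] s ne(2) by simp
  then show "{v \<in> bochner_L2 I (H1_norm S) VH. X_norm S \<kappa> I v = 1} \<noteq> {}"
    using bochner_const[OF cw W] by blast
qed (use le in auto)

text \<open>The quotients are at most 1 by Cauchy-Schwarz, and the pair of zero functions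
  contributes the value 0.\<close>

lemma gamma_const_nonneg: "0 \<le> gamma_const S V1 V2"
proof -
  have "bdd_above ((\<lambda>(v1, v2). l2_inner S v1 v2 / (l2_norm S v1 * l2_norm S v2)) ` (V1 \<times> V2))"
  proof (rule bdd_aboveI2[where M = 1])
    fix z assume "z \<in> V1 \<times> V2"
    then obtain v1 v2 where z: "z = (v1, v2)" "v1 \<in> V1" "v2 \<in> V2" by auto
    note L = sobolev_H1_wgrad(1)[OF V1_H1[OF z(2)]] sobolev_H1_wgrad(1)[OF V2_H1[OF z(3)]]
    have "l2_inner S v1 v2 \<le> l2_norm S v1 * l2_norm S v2" "0 \<le> l2_norm S v1 * l2_norm S v2"
      using l.Cauchy_Schwarz[OF L] l.nrm_nonneg L by (auto simp: l2_norm_nrm)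
    then show "(case z of (v1, v2) \<Rightarrow> l2_inner S v1 v2 / (l2_norm S v1 * l2_norm S v2)) \<le> 1"
      by (simp add: z(1) divide_le_eq)
  qed
  from cSUP_upper[OF _ this, of "(\<lambda>x. 0, \<lambda>x. 0)"] show ?thesis
    unfolding gamma_const_def using V1_zero V2_zero by (simp add: l2_inner_def)
qed

end

subsection \<open>The multiscale spaces\<close>

text \<open>On the domain the permeability takes finitely many positive values, one on the matrix
  and one on each network. Their minimum and maximum are the bounds, and preimages are unions of
  measurable pieces.\<close>

lemma fractured_medium_coeff:
  assumes "fractured_medium \<Omega> \<kappa> Nf G"
  shows "open \<Omega>" "bounded \<Omega>" "coeff_on \<Omega> \<kappa>"
proof -
  show O: "open \<Omega>" "bounded \<Omega>" using assms by (auto simp: fractured_medium_def)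
  let ?F = "\<Union>s\<in>{1..Nf}. G s"
  have G: "\<And>s. s \<in> {1..Nf} \<Longrightarrow> compact (G s)" using assms by (auto simp: fractured_medium_def)
  obtain km where km: "km > 0" "\<And>x. x \<in> \<Omega> - ?F \<Longrightarrow> \<kappa> x = km"
    using assms unfolding fractured_medium_def by blast
  have "\<forall>s\<in>{1..Nf}. \<exists>kf>0. \<forall>x \<in> \<Omega> \<inter> G s. \<kappa> x = kf"
    using assms unfolding fractured_medium_def by blast
  then obtain kf where kf: "\<And>s. s \<in> {1..Nf} \<Longrightarrow> kf s > 0" "\<And>s x. s \<in> {1..Nf} \<Longrightarrow> x \<in> \<Omega> \<inter> G s \<Longrightarrow> \<kappa> x = kf s"
    by metis
  have val: "\<kappa> x \<in> insert km (kf ` {1..Nf})" if x: "x \<in> \<Omega>" for x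
  proof (cases "x \<in> ?F")
    case True
    then obtain s where "s \<in> {1..Nf}" "x \<in> G s" by blast
    then show ?thesis using kf(2)[of s x] x by blast
  next
    case False
    then show ?thesis using km(2)[of x] x by blast
  qed
  have fin: "finite (insert km (kf ` {1..Nf}))" by simp
  have "\<kappa> \<in> borel_measurable (lebesgue_on \<Omega>)"
  proof (rule measurableI)
    fix A :: "real set"
    have Gs: "G s \<in> sets lebesgue" if "s \<in> {1..Nf}" for s
      using compact_imp_closed[OF G[OF that]] by auto
    have Os: "\<Omega> \<in> sets lebesgue" using O by auto
    have "\<kappa> -` A \<inter> space (lebesgue_on \<Omega>) =
        (if km \<in> A then \<Omega> - ?F else {}) \<union> (\<Union>s\<in>{1..Nf}. if kf s \<in> A then \<Omega> \<inter> G s else {})"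
    proof (intro set_eqI iffI)
      fix x assume x: "x \<in> \<kappa> -` A \<inter> space (lebesgue_on \<Omega>)"
      then have xO: "x \<in> \<Omega>" "\<kappa> x \<in> A" by auto
      show "x \<in> (if km \<in> A then \<Omega> - ?F else {}) \<union> (\<Union>s\<in>{1..Nf}. if kf s \<in> A then \<Omega> \<inter> G s else {})"
      proof (cases "x \<in> ?F")
        case True
        then obtain s where s: "s \<in> {1..Nf}" "x \<in> G s" by blast
        then have "kf s \<in> A" using kf(2)[of s x] xO by simp
        then have "x \<in> (if kf s \<in> A then \<Omega> \<inter> G s else {})" using s xO by simp
        then show ?thesis using s by blast
      next
        case False
        then have "km \<in> A" using km(2)[of x] xO by simp
        then show ?thesis using False xO by simp
      qed
    next
      fix x assume "x \<in> (if km \<in> A then \<Omega> - ?F else {}) \<union> (\<Union>s\<in>{1..Nf}. if kf s \<in> A then \<Omega> \<inter> G s else {})"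
      then consider "km \<in> A" "x \<in> \<Omega> - ?F" | s where "s \<in> {1..Nf}" "kf s \<in> A" "x \<in> \<Omega> \<inter> G s"
        by (auto split: if_splits)
      then show "x \<in> \<kappa> -` A \<inter> space (lebesgue_on \<Omega>)"
      proof cases
        case 1
        then show ?thesis using km(2)[of x] by simp
      next
        case 2
        then show ?thesis using kf(2)[of s x] by simp
      qed
    qed
    also have "\<dots> \<in> sets lebesgue"
    proof -
      have "?F \<in> sets lebesgue" using Gs by (intro sets.finite_UN) auto
      then show ?thesis using Gs Os by (intro sets.Un sets.finite_UN) (auto intro: sets.Diff sets.Int)
    qed
    finally show "\<kappa> -` A \<inter> space (lebesgue_on \<Omega>) \<in> sets (lebesgue_on \<Omega>)"
      using Os by (simp add: sets_restrict_space_iff)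
  qed simp
  moreover have "Min (insert km (kf ` {1..Nf})) > 0"
    using km(1) kf(1) by (subst Min_gr_iff[OF fin]) auto
  ultimately show "coeff_on \<Omega> \<kappa>"
    unfolding coeff_on_def using Min_le[OF fin val] Max_ge[OF fin val] by blast
qed

lemma H10_lin_span:
  assumes S: "open S" "bounded S" and J: "finite J" and \<phi>: "\<And>k. k \<in> J \<Longrightarrow> \<phi> k \<in> sobolev_H10 S"
  shows "lin_span J \<phi> \<subseteq> sobolev_H10 S"
proof
  fix u assume "u \<in> lin_span J \<phi>"
  then obtain c where u: "u = (\<lambda>x. \<Sum>k\<in>J. c k * \<phi> k x)" by (auto simp: lin_span_def)
  show "u \<in> sobolev_H10 S"
    unfolding u using J \<phi>
  proof (induction J rule: finite_induct)
    case empty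
    then show ?case using zero_H10[OF S] by simp
  next
    case (insert k J)
    have "(\<lambda>x. (\<Sum>k\<in>J. c k * \<phi> k x) + c k * \<phi> k x) \<in> sobolev_H10 S"
      by (rule sobolev_H10_comb[OF S]) (use insert in auto)
    then show ?case using insert by (simp add: add.commute)
  qed
qed

lemma lin_span_comb:
  assumes "u \<in> lin_span J \<phi>" "v \<in> lin_span J \<phi>"
  shows "(\<lambda>x. u x + r * v x) \<in> lin_span J \<phi>"
proof -
  obtain c d where "u = (\<lambda>x. \<Sum>k\<in>J. c k * \<phi> k x)" "v = (\<lambda>x. \<Sum>k\<in>J. d k * \<phi> k x)"
    using assms by (auto simp: lin_span_def)
  then have "(\<lambda>x. u x + r * v x) = (\<lambda>x. \<Sum>k\<in>J. (c k + r * d k) * \<phi> k x)"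
    by (simp add: sum_distrib_left sum.distrib[symmetric] algebra_simps)
  then show ?thesis unfolding lin_span_def by (auto intro!: exI[of _ "\<lambda>k. c k + r * d k"])
qed

lemma lin_span_zero: "(\<lambda>x. 0) \<in> lin_span J \<phi>"
  unfolding lin_span_def by (rule CollectI, rule exI[of _ "\<lambda>k. 0"]) simp

lemma lin_span_member:
  assumes "finite J" "k \<in> J"
  shows "\<phi> k \<in> lin_span J \<phi>"
proof -
  have "(\<Sum>j\<in>J. (if j = k then 1 else 0) * \<phi> j x) = \<phi> k x" for x
    using assms by (simp add: if_distrib[where f = "\<lambda>c. c * _"] cong: if_cong)
  then have "\<phi> k = (\<lambda>x. \<Sum>j\<in>J. (if j = k then 1 else 0) * \<phi> j x)" by auto
  then show ?thesis unfolding lin_span_def by (intro CollectI exI[of _ "\<lambda>j. if j = k then 1 else 0"]) simp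
qed

lemma nlmc_basis_H10:
  assumes O: "open \<Omega>" "bounded \<Omega>" and \<psi>: "nlmc_basis \<Omega> \<kappa> Nc K lay m fr \<psi>"
    and i: "i \<in> {1..Nc}" "l \<in> {0..m i}"
  shows "\<psi> i l \<in> sobolev_H10 \<Omega>"
proof -
  have "\<psi> i l \<in> sobolev_H10 (\<Omega> \<inter> interior (oversampled Nc K lay i))"
    using \<psi> i unfolding nlmc_basis_def Let_def V0_def by blast
  then show ?thesis
    by (rule sobolev_H10_extend[OF O, rotated 2]) (use O in auto)
qed

lemma psi_bar_H10:
  assumes O: "open \<Omega>" "bounded \<Omega>" and \<psi>: "nlmc_basis \<Omega> \<kappa> Nc K lay m fr \<psi>"
  shows "psi_bar Nc m \<psi> \<in> sobolev_H10 \<Omega>"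
proof -
  let ?J = "SIGMA i:{1..Nc}. {0..m i}"
  \<comment> \<open>The nested sum becomes a sum over one finite index set, so that a single
    induction over its subsets suffices.\<close>
  have eq: "psi_bar Nc m \<psi> = (\<lambda>x. \<Sum>(i, l)\<in>?J. 1 / real (num_fractures Nc m) * \<psi> i l x)"
    by (auto simp: psi_bar_def fun_eq_iff sum.Sigma sum_distrib_left case_prod_unfold)
  have *: "(\<lambda>x. \<Sum>z\<in>J. c * \<psi> (fst z) (snd z) x) \<in> sobolev_H10 \<Omega>" if "finite J" "J \<subseteq> ?J" for J c
    using that
  proof (induction J rule: finite_induct)
    case empty
    then show ?case using zero_H10[OF O] by simp
  next
    case (insert z J)
    have "(\<lambda>x. (\<Sum>z\<in>J. c * \<psi> (fst z) (snd z) x) + c * \<psi> (fst z) (snd z) x) \<in> sobolev_H10 \<Omega>"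
      by (rule sobolev_H10_comb[OF O]) (use insert in \<open>auto intro!: nlmc_basis_H10[OF O \<psi>]\<close>)
    then show ?case using insert by (simp add: add.commute)
  qed
  show ?thesis unfolding eq case_prod_unfold by (rule *) auto
qed

lemma psi_tilde_H10:
  assumes O: "open \<Omega>" "bounded \<Omega>" and \<psi>: "nlmc_basis \<Omega> \<kappa> Nc K lay m fr \<psi>"
    and i: "i \<in> {1..Nc}" "l \<in> {0..m i}"
  shows "psi_tilde \<Omega> kt Nc m \<psi> i l \<in> sobolev_H10 \<Omega>"
proof -
  let ?c = "s_form \<Omega> kt (\<psi> i l) (psi_bar Nc m \<psi>) / s_form \<Omega> kt (psi_bar Nc m \<psi>) (psi_bar Nc m \<psi>)"
  have "psi_tilde \<Omega> kt Nc m \<psi> i l = (\<lambda>x. \<psi> i l x + - ?c * psi_bar Nc m \<psi> x)"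
    by (simp add: psi_tilde_def fun_eq_iff)
  then show ?thesis
    using sobolev_H10_comb[OF O nlmc_basis_H10[OF O \<psi> i] psi_bar_H10[OF O \<psi>], of "- ?c"] by simp
qed

lemma V_H1_H10:
  assumes O: "open \<Omega>" "bounded \<Omega>" and \<psi>: "nlmc_basis \<Omega> \<kappa> Nc K lay m fr \<psi>"
    and e: "fracture_enumeration Nc m e"
  shows "V_H1 \<Omega> kt Nc m \<psi> e \<subseteq> sobolev_H10 \<Omega>"
  unfolding V_H1_def
proof (rule H10_lin_span[OF O])
  fix k assume "k \<in> {1..num_fractures Nc m - 1}"
  then have "k \<in> {1..num_fractures Nc m}" by auto
  then have "e k \<in> (SIGMA i:{1..Nc}. {1..m i})"
    using e unfolding fracture_enumeration_def by (rule bij_betwE[rule_format, rotated])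
  then show "psi_tilde \<Omega> kt Nc m \<psi> (fst (e k)) (snd (e k)) \<in> sobolev_H10 \<Omega>"
    by (intro psi_tilde_H10[OF O \<psi>]) auto
qed simp

lemma V_H2_H10:
  assumes O: "open \<Omega>" "bounded \<Omega>" and \<psi>: "nlmc_basis \<Omega> \<kappa> Nc K lay m fr \<psi>"
  shows "V_H2 Nc m \<psi> \<subseteq> sobolev_H10 \<Omega>"
  unfolding V_H2_def
  by (rule H10_lin_span[OF O]) (auto intro!: psi_bar_H10[OF O \<psi>] nlmc_basis_H10[OF O \<psi>])

lemma self_in_block_layers:
  assumes "i \<in> {1..Nc}" "K i \<noteq> {}"
  shows "i \<in> block_layers Nc K i lay"
  using assms by (induction lay) auto

text \<open>The defining constraint gives this basis function integral 1 over the matrix part of its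
  own block, so it cannot vanish almost everywhere. That block belongs to its oversampled region,
  hence the constraint is in force.\<close>

lemma l2_norm_psi_pos:
  assumes O: "open \<Omega>" "bounded \<Omega>" and \<psi>: "nlmc_basis \<Omega> \<kappa> Nc K lay m fr \<psi>"
    and K: "coarse_partition \<Omega> Nc K h" and i: "i \<in> {1..Nc}"
  shows "0 < l2_norm \<Omega> (\<psi> i 0)"
proof -
  have "K i \<noteq> {}" using K i interior_subset[of "K i"] unfolding coarse_partition_def by blast
  then have "i \<in> block_layers Nc K i lay" by (rule self_in_block_layers[OF i])
  then have "K i \<subseteq> oversampled Nc K lay i" unfolding oversampled_def by (rule UN_upper)
  with i have J: "i \<in> {j \<in> {1..Nc}. K j \<subseteq> oversampled Nc K lay i}" by simp
  have "0 \<in> {0..m i}" by simp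
  note b = bspec[OF bspec[OF \<psi>[unfolded nlmc_basis_def Let_def] i] this]
  have int1: "(LINT x:block_matrix K m fr i|lebesgue. \<psi> i 0 x) = 1"
    using conjunct1[OF bspec[OF conjunct2[OF conjunct2[OF b]] J]] by simp
  have H: "\<psi> i 0 \<in> sobolev_H10 \<Omega>" by (rule nlmc_basis_H10[OF O \<psi> i]) simp
  note L = sobolev_H1_wgrad(1)[OF sobolev_H10_H1[OF H]]
  have "l2_inner \<Omega> (\<psi> i 0) (\<psi> i 0) \<noteq> 0"
  proof
    assume "l2_inner \<Omega> (\<psi> i 0) (\<psi> i 0) = 0"
    then have "AE x in lebesgue_on \<Omega>. \<psi> i 0 x * \<psi> i 0 x = 0"
      unfolding l2_inner_def
      by (subst (asm) integral_nonneg_eq_0_iff_AE[OF L2_mult_integrable[OF L L]]) auto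
    then have "AE x in lebesgue. x \<in> \<Omega> \<longrightarrow> \<psi> i 0 x = 0"
      using AE_restrict_space_iff[OF lebesgue_on_open[OF O(1)]] by simp
    \<comment> \<open>The block may reach the boundary of the domain; points outside the domain are
      covered because members of H^1_0 vanish there by definition.\<close>
    then have "AE x in lebesgue. indicator (block_matrix K m fr i) x *\<^sub>R \<psi> i 0 x = 0"
      by eventually_elim (use H in \<open>auto simp: sobolev_H10_def\<close>)
    then have "(LINT x:block_matrix K m fr i|lebesgue. \<psi> i 0 x) = 0"
      unfolding set_lebesgue_integral_def by (rule integral_eq_zero_AE)
    with int1 show False by simp
  qed
  moreover have "0 \<le> l2_inner \<Omega> (\<psi> i 0) (\<psi> i 0)"
    by (rule semi_inner.pos[OF semi_inner_l2 L])
  ultimately show ?thesis by (simp add: l2_norm_def)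
qed

subsection \<open>The error indicators\<close>

text \<open>The left side is the size of the consistency errors, in which both increments occur with
  factor 1; the indicators provide x with weight sqrt (1 / 3) in \<open>h1\<close> and y with weight
  1 / 3 in \<open>h2\<close>. The remaining cross terms are nonnegative and are dropped.\<close>

lemma indicator_bound:
  fixes \<tau> :: real
  assumes \<tau>: "0 < \<tau>" and \<gamma>: "0 \<le> \<gamma>" and C: "0 \<le> C" and nn: "0 \<le> x" "0 \<le> y" "0 \<le> n1" "0 \<le> n2"
  defines "h1 \<equiv> sqrt (\<tau> / 3) * (x + \<gamma> * y) + \<tau> powr (3 / 2) * n2"
    and "h2 \<equiv> \<gamma> * sqrt (C * \<tau>) * x + sqrt \<tau> / 3 * y + \<tau> powr (3 / 2) * n1"
  shows "sqrt ((x + y + \<tau> * n2)\<^sup>2 + (x + y + \<tau> * n1)\<^sup>2) * sqrt \<tau> \<le> 8 * sqrt (h1\<^sup>2 + h2\<^sup>2)"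
proof -
  define A where "A = sqrt \<tau> * x"
  define B where "B = sqrt \<tau> * y"
  define P where "P = sqrt \<tau> * (\<tau> * n2)"
  define Q where "Q = sqrt \<tau> * (\<tau> * n1)"
  have p: "\<tau> powr (3 / 2) = sqrt \<tau> * \<tau>"
    using powr_add[of \<tau> "1 / 2" 1] \<tau> by (simp add: powr_half_sqrt)
  have ABPQ: "0 \<le> A" "0 \<le> B" "0 \<le> P" "0 \<le> Q" using \<tau> nn by (auto simp: A_def B_def P_def Q_def)
  have "1 / 2 \<le> sqrt (1 / 3::real)" by (rule real_le_rsqrt) (simp add: power2_eq_square)
  then have "A / 2 \<le> sqrt (1 / 3) * A" using ABPQ(1) mult_right_mono by fastforce
  also have "\<dots> = sqrt (\<tau> / 3) * x" by (simp add: A_def real_sqrt_divide)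
  finally have A: "A / 2 \<le> sqrt (\<tau> / 3) * x" .
  have "h1 = sqrt (\<tau> / 3) * x + sqrt (\<tau> / 3) * (\<gamma> * y) + P"
    by (simp add: h1_def p P_def algebra_simps)
  moreover have "0 \<le> sqrt (\<tau> / 3) * (\<gamma> * y)" using \<tau> \<gamma> nn by simp
  ultimately have h1: "A / 2 + P \<le> h1" using A by linarith
  have "h2 = \<gamma> * sqrt (C * \<tau>) * x + B / 3 + Q"
    by (simp add: h2_def p Q_def B_def algebra_simps)
  moreover have "0 \<le> \<gamma> * sqrt (C * \<tau>) * x" using \<tau> \<gamma> C nn by simp
  ultimately have h2: "B / 3 + Q \<le> h2" by linarith
  \<comment> \<open>Twice \<open>h1\<close> pays for \<open>A\<close>, as sqrt (1 / 3) is at least 1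
    / 2, and three times \<open>h2\<close> pays for \<open>B\<close>; \<open>P\<close> and
    \<open>Q\<close> are covered as well.\<close>
  have le1: "A + B + P \<le> 2 * h1 + 3 * h2" and le2: "A + B + Q \<le> 2 * h1 + 3 * h2"
    using h1 h2 ABPQ by linarith+
  have "(A + B + P)\<^sup>2 + (A + B + Q)\<^sup>2 \<le> (2 * h1 + 3 * h2)\<^sup>2 + (2 * h1 + 3 * h2)\<^sup>2"
    using ABPQ by (intro add_mono power_mono le1 le2) auto
  also have "\<dots> = 8 * h1\<^sup>2 + 12 * (2 * h1 * h2) + 18 * h2\<^sup>2"
    by (simp add: power2_eq_square algebra_simps)
  also have "\<dots> \<le> 64 * (h1\<^sup>2 + h2\<^sup>2)"
  proof -
    \<comment> \<open>With \<open>Z\<close> standing for 2 h1 h2, the left side is at most 20 X + 30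
      Y; the bound 64 is rounded up to a square with root 8.\<close>
    have "8 * X + 12 * Z + 18 * Y \<le> 64 * (X + Y)" if "Z \<le> X + Y" "0 \<le> X" "0 \<le> Y" for X Y Z :: real
      using that by simp
    from this[OF sum_squares_bound zero_le_power2 zero_le_power2] show ?thesis .
  qed
  finally have fin: "(A + B + P)\<^sup>2 + (A + B + Q)\<^sup>2 \<le> 64 * (h1\<^sup>2 + h2\<^sup>2)" .
  have "sqrt ((x + y + \<tau> * n2)\<^sup>2 + (x + y + \<tau> * n1)\<^sup>2) * sqrt \<tau> = sqrt ((A + B + P)\<^sup>2 + (A + B + Q)\<^sup>2)"
  proof -
    have "(A + B + P)\<^sup>2 + (A + B + Q)\<^sup>2 = (sqrt \<tau>)\<^sup>2 * ((x + y + \<tau> * n2)\<^sup>2 + (x + y + \<tau> * n1)\<^sup>2)"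
      unfolding A_def B_def P_def Q_def power2_eq_square by (simp only: algebra_simps)
    then show ?thesis using \<tau> by (simp add: real_sqrt_mult mult.commute)
  qed
  also have "\<dots> \<le> sqrt (64 * (h1\<^sup>2 + h2\<^sup>2))" using fin by (rule real_sqrt_le_mono)
  also have "\<dots> = sqrt 64 * sqrt (h1\<^sup>2 + h2\<^sup>2)" by (rule real_sqrt_mult)
  also have "sqrt 64 = (8::real)" using real_sqrt_abs[of 8] by simp
  finally show ?thesis .
qed

section \<open>The estimate for the splitting scheme\<close>

theorem theorem4p2:
  "\<exists>D1 D2 :: real.
     \<forall>(\<Omega> :: 'a::euclidean_space set) (\<kappa> :: 'a \<Rightarrow> real) (Nf :: nat) (G :: nat \<Rightarrow> 'a set)
      (Nc :: nat) (K :: nat \<Rightarrow> 'a set) (h :: real) (lay :: nat)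
      (m :: nat \<Rightarrow> nat) (fr :: nat \<Rightarrow> nat \<Rightarrow> 'a set) (\<psi> :: nat \<Rightarrow> nat \<Rightarrow> 'a \<Rightarrow> real)
      (Nv :: nat) (z :: nat \<Rightarrow> 'a) (\<theta> :: nat \<Rightarrow> 'a \<Rightarrow> real) (e :: nat \<Rightarrow> nat \<times> nat)
      (V1 :: ('a \<Rightarrow> real) set) (V2 :: ('a \<Rightarrow> real) set) (VH :: ('a \<Rightarrow> real) set)
      (\<Delta>T :: real) (\<omega> :: real) (N :: nat) (T :: nat \<Rightarrow> real)
      (f :: real \<Rightarrow> 'a \<Rightarrow> real) (F :: real \<Rightarrow> 'a \<Rightarrow> real)
      (u1 :: nat \<Rightarrow> 'a \<Rightarrow> real) (u2 :: nat \<Rightarrow> 'a \<Rightarrow> real) (n :: nat).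
       fractured_medium \<Omega> \<kappa> Nf G \<and>
       coarse_partition \<Omega> Nc K h \<and>
       block_fractures Nf G Nc K m fr \<and>
       num_fractures Nc m > 0 \<and>
       lay \<ge> 1 \<and>
       nlmc_basis \<Omega> \<kappa> Nc K lay m fr \<psi> \<and>
       multiscale_pou \<Omega> \<kappa> Nc K Nv z \<theta> \<and>
       fracture_enumeration Nc m e \<and>
       V1 = V_H1 \<Omega> (kappa_tilde \<Omega> \<kappa> Nv \<theta>) Nc m \<psi> e \<and>
       V2 = V_H2 Nc m \<psi> \<and>
       VH = space_sum V1 V2 \<and>
       gamma_const \<Omega> V1 V2 < 1 \<and>
       0 < \<Delta>T \<and> 0 \<le> \<omega> \<and> \<omega> \<le> 1 \<and>
       (\<forall>k<N. T (k + 1) = T k + \<Delta>T) \<and>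
       (\<forall>k<N. f \<in> bochner_L2 (time_slab T k) (l2_norm \<Omega>) (L2 \<Omega>)) \<and>
       splitting_scheme \<Omega> \<kappa> V1 V2 \<Delta>T \<omega> N T f u1 u2 \<and>
       projected_source \<Omega> VH N T f F \<and>
       1 \<le> n \<and> n < N \<and>
       gamma_X \<Omega> \<kappa> (time_slab T n) V1 V2 < 1
       \<longrightarrow>
       (\<forall>nrm \<in> {l2_norm \<Omega>, a_dual_norm \<Omega> \<kappa>}.
          residual_dual_norm \<Omega> \<kappa> (time_slab T n) VH f (interpolant \<Delta>T T u1 u2 n)
          \<le> D1 * (1 - gamma_X \<Omega> \<kappa> (time_slab T n) V1 V2) powr (- 1 / 2)
               * sqrt ((eta1 nrm \<Omega> \<kappa> (gamma_const \<Omega> V1 V2) \<Delta>T u1 u2 n)\<^sup>2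
                       + (eta2 nrm \<Omega> \<kappa> (gamma_const \<Omega> V1 V2) \<omega> \<Delta>T u1 u2 n)\<^sup>2)
            + D2 * L2L2_norm \<Omega> (time_slab T n) (\<lambda>t x. f t x - F t x))"

proof (rule exI[of _ 8], rule exI[of _ 1], intro allI impI ballI)
  fix \<Omega> :: "'a set" and \<kappa> :: "'a \<Rightarrow> real" and Nf :: nat and G :: "nat \<Rightarrow> 'a set"
    and Nc :: nat and K :: "nat \<Rightarrow> 'a set" and h :: real and lay :: nat
    and m :: "nat \<Rightarrow> nat" and fr :: "nat \<Rightarrow> nat \<Rightarrow> 'a set" and \<psi> :: "nat \<Rightarrow> nat \<Rightarrow> 'a \<Rightarrow> real"
    and Nv :: nat and z :: "nat \<Rightarrow> 'a" and \<theta> :: "nat \<Rightarrow> 'a \<Rightarrow> real" and e :: "nat \<Rightarrow> nat \<times> nat"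
    and V1 V2 VH :: "('a \<Rightarrow> real) set"
    and \<Delta>T \<omega> :: real and N :: nat and T :: "nat \<Rightarrow> real"
    and f F :: "real \<Rightarrow> 'a \<Rightarrow> real" and u1 u2 :: "nat \<Rightarrow> 'a \<Rightarrow> real" and n :: nat
    and nrm :: "('a \<Rightarrow> real) \<Rightarrow> real"
  let ?g = "gamma_const \<Omega> V1 V2"
  let ?I = "time_slab T n"
  assume A: "fractured_medium \<Omega> \<kappa> Nf G \<and>
       coarse_partition \<Omega> Nc K h \<and>
       block_fractures Nf G Nc K m fr \<and>
       num_fractures Nc m > 0 \<and>
       lay \<ge> 1 \<and>
       nlmc_basis \<Omega> \<kappa> Nc K lay m fr \<psi> \<and>
       multiscale_pou \<Omega> \<kappa> Nc K Nv z \<theta> \<and>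
       fracture_enumeration Nc m e \<and>
       V1 = V_H1 \<Omega> (kappa_tilde \<Omega> \<kappa> Nv \<theta>) Nc m \<psi> e \<and>
       V2 = V_H2 Nc m \<psi> \<and>
       VH = space_sum V1 V2 \<and>
       gamma_const \<Omega> V1 V2 < 1 \<and>
       0 < \<Delta>T \<and> 0 \<le> \<omega> \<and> \<omega> \<le> 1 \<and>
       (\<forall>k<N. T (k + 1) = T k + \<Delta>T) \<and>
       (\<forall>k<N. f \<in> bochner_L2 (time_slab T k) (l2_norm \<Omega>) (L2 \<Omega>)) \<and>
       splitting_scheme \<Omega> \<kappa> V1 V2 \<Delta>T \<omega> N T f u1 u2 \<and>
       projected_source \<Omega> VH N T f F \<and>
       1 \<le> n \<and> n < N \<and>
       gamma_X \<Omega> \<kappa> (time_slab T n) V1 V2 < 1"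
    and nrm: "nrm \<in> {l2_norm \<Omega>, a_dual_norm \<Omega> \<kappa>}"
  from A have med: "fractured_medium \<Omega> \<kappa> Nf G" and part: "coarse_partition \<Omega> Nc K h"
    and nf: "num_fractures Nc m > 0" and \<psi>: "nlmc_basis \<Omega> \<kappa> Nc K lay m fr \<psi>"
    and enum: "fracture_enumeration Nc m e" and V1_eq: "V1 = V_H1 \<Omega> (kappa_tilde \<Omega> \<kappa> Nv \<theta>) Nc m \<psi> e"
    and V2_eq: "V2 = V_H2 Nc m \<psi>" and VH_eq: "VH = space_sum V1 V2"
    and \<tau>: "0 < \<Delta>T" and \<omega>: "0 \<le> \<omega>" "\<omega> \<le> 1" and T: "\<forall>k<N. T (k + 1) = T k + \<Delta>T"
    and f: "\<forall>k<N. f \<in> bochner_L2 (time_slab T k) (l2_norm \<Omega>) (L2 \<Omega>)"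
    and sch: "splitting_scheme \<Omega> \<kappa> V1 V2 \<Delta>T \<omega> N T f u1 u2"
    and src: "projected_source \<Omega> VH N T f F" and n: "1 \<le> n" "n < N"
    and gX: "gamma_X \<Omega> \<kappa> (time_slab T n) V1 V2 < 1"
    by blast+
  note O = fractured_medium_coeff[OF med]
  have Tn: "T (Suc n) = T n + \<Delta>T" using T n by simp
  interpret split_space \<Omega> \<kappa> V1 V2 "T n" "T (Suc n)"
  proof
    show "open \<Omega>" "bounded \<Omega>" "coeff_on \<Omega> \<kappa>" by (rule O)+
    show "V1 \<subseteq> sobolev_H10 \<Omega>" unfolding V1_eq by (rule V_H1_H10[OF O(1,2) \<psi> enum])
    show "V2 \<subseteq> sobolev_H10 \<Omega>" unfolding V2_eq by (rule V_H2_H10[OF O(1,2) \<psi>])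
    show "(\<lambda>x. 0) \<in> V1" unfolding V1_eq V_H1_def by (rule lin_span_zero)
    show "(\<lambda>x. 0) \<in> V2" unfolding V2_eq V_H2_def by (rule lin_span_zero)
    show "(\<lambda>x. u x + c * v x) \<in> V1" if "u \<in> V1" "v \<in> V1" for u v c
      using that unfolding V1_eq V_H1_def by (rule lin_span_comb)
    show "(\<lambda>x. u x + c * v x) \<in> V2" if "u \<in> V2" "v \<in> V2" for u v c
      using that unfolding V2_eq V_H2_def by (rule lin_span_comb)
    show "T n < T (Suc n)" using Tn \<tau> by simp
    show "gamma_X \<Omega> \<kappa> {T n<..T (Suc n)} V1 V2 < 1" using gX by (simp add: time_slab_def)
  qed
  have slab: "time_slab T n = I" by (simp add: time_slab_def)
  have len: "T (Suc n) - T n = \<Delta>T" using Tn by simp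
  \<comment> \<open>The properties of \<open>nrm\<close> that the estimate relies on, valid for the
    L2 norm and for the dual norm alike; from here on the two types of indicators are treated
    together.\<close>
  have nrm_bound: "0 \<le> nrm w" "\<And>v. v \<in> sobolev_H10 \<Omega> \<Longrightarrow> \<bar>l2_inner \<Omega> w v\<bar> \<le> nrm w * xn v" if w: "w \<in> L2 \<Omega>" for w
  proof -
    consider "nrm = l2_norm \<Omega>" | "nrm = a_dual_norm \<Omega> \<kappa>" using nrm by blast
    then have "0 \<le> nrm w \<and> (\<forall>v\<in>sobolev_H10 \<Omega>. \<bar>l2_inner \<Omega> w v\<bar> \<le> nrm w * xn v)"
    proof cases
      case 1
      have w0: "0 \<le> l2_norm \<Omega> w" using l.nrm_nonneg[OF w] by (simp add: l2_norm_nrm)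
      have "\<bar>l2_inner \<Omega> w v\<bar> \<le> l2_norm \<Omega> w * xn v" if "v \<in> sobolev_H10 \<Omega>" for v
      proof -
        note v = sobolev_H10_H1[OF that]
        have "\<bar>l2_inner \<Omega> w v\<bar> \<le> l2_norm \<Omega> w * l2_norm \<Omega> v"
          using l.Cauchy_Schwarz[OF w sobolev_H1_wgrad(1)[OF v]] by (simp add: l2_norm_nrm)
        also have "\<dots> \<le> l2_norm \<Omega> w * xn v" by (rule mult_left_mono[OF xn_props(2)[OF v] w0])
        finally show ?thesis .
      qed
      then show ?thesis using 1 w0 by simp
    next
      case 2
      note b = a_dual_norm_bound[OF O w]
      have "\<bar>l2_inner \<Omega> w v\<bar> \<le> a_dual_norm \<Omega> \<kappa> w * xn v" if "v \<in> sobolev_H10 \<Omega>" for v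
        using b(2)[OF that] mult_left_mono[OF xn_props(3)[OF sobolev_H10_H1[OF that]] b(1)] by linarith
      then show ?thesis using 2 b(1) by simp
    qed
    then show "0 \<le> nrm w" "\<And>v. v \<in> sobolev_H10 \<Omega> \<Longrightarrow> \<bar>l2_inner \<Omega> w v\<bar> \<le> nrm w * xn v" by blast+
  qed
  have mem: "u1 k \<in> V1" "u2 k \<in> V2" if "k \<le> N" for k
    using sch that unfolding splitting_scheme_def by blast+
  have le: "n - 1 \<le> N" "n \<le> N" "n + 1 \<le> N" using n by auto
  note m1 = mem(1)[OF le(1)] mem(1)[OF le(2)] mem(1)[OF le(3)]
    and m2 = mem(2)[OF le(1)] mem(2)[OF le(2)] mem(2)[OF le(3)]
  note h1 = m1[THEN V1_H1] and h2 = m2[THEN V2_H1]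
  define y1 where "y1 x = u1 (n + 1) x - u1 n x" for x
  define y2 where "y2 x = u2 (n + 1) x - u2 n x" for x
  define p where "p x = u1 n x + u2 n x" for x
  define q where "q x = y1 x + y2 x" for x
  define d where "d x = 1 / \<Delta>T * q x" for x
  have y: "y1 \<in> sobolev_H1 \<Omega>" "y2 \<in> sobolev_H1 \<Omega>"
    unfolding y1_def[abs_def] y2_def[abs_def] by (intro x.diff h1 h2)+
  have pV: "p \<in> VH" unfolding p_def[abs_def] VH_eq space_sum_def using m1(2) m2(2) by blast
  have qV: "q \<in> VH"
  proof -
    have "(\<lambda>x. u1 (n + 1) x + - 1 * u1 n x) \<in> V1" "(\<lambda>x. u2 (n + 1) x + - 1 * u2 n x) \<in> V2"
      by (rule V1_comb[OF m1(3,2)], rule V2_comb[OF m2(3,2)])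
    then have "y1 \<in> V1" "y2 \<in> V2" by (simp_all add: y1_def[abs_def] y2_def[abs_def])
    then show ?thesis unfolding q_def[abs_def] VH_eq space_sum_def by blast
  qed
  have dV: "d \<in> VH"
  proof -
    have "(\<lambda>x. q x + (1 / \<Delta>T - 1) * q x) \<in> VH" using VH_comb qV unfolding VH_eq by blast
    then show ?thesis by (simp add: d_def[abs_def] algebra_simps)
  qed
  note pH = VH_H1[OF pV[unfolded VH_eq]] and qH = VH_H1[OF qV[unfolded VH_eq]] and dH = VH_H1[OF dV[unfolded VH_eq]]
  let ?U = "interpolant \<Delta>T T u1 u2 n"
  have U: "?U t = (\<lambda>x. p x + (t - T n) / (T (Suc n) - T n) * q x)" for t
    unfolding len by (simp add: interpolant_def p_def q_def y1_def y2_def fun_eq_iff algebra_simps)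
  have UH: "?U t \<in> sobolev_H1 \<Omega>" for t unfolding U by (rule x.comb[OF pH qH])
  \<comment> \<open>The interpolant is affine for all real times, so the two-sided derivative exists
    also at the right end of the slab.\<close>
  have dU: "deriv (\<lambda>\<sigma>. ?U \<sigma> x) t = d x" for t x
  proof (rule DERIV_imp_deriv)
    show "((\<lambda>\<sigma>. ?U \<sigma> x) has_real_derivative d x) (at t)"
      unfolding U len d_def using \<tau> by (auto intro!: derivative_eq_intros)
  qed
  obtain g where g: "g \<in> VH" "\<And>v. v \<in> VH \<Longrightarrow> l2_inner \<Omega> g v = l2_inner \<Omega> (f (T (n + 1))) v"
    "\<And>t. t \<in> time_slab T n \<Longrightarrow> F t = g"
    using src n(2) unfolding projected_source_def by blast
  let ?w1 = "second_diff \<Delta>T u1 n" and ?w2 = "second_diff \<Delta>T u2 n"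
  have sdH: "second_diff \<Delta>T u n \<in> sobolev_H1 \<Omega>"
    if "u (n - 1) \<in> sobolev_H1 \<Omega>" "u n \<in> sobolev_H1 \<Omega>" "u (n + 1) \<in> sobolev_H1 \<Omega>" for u
  proof -
    have "(\<lambda>x. 1 / \<Delta>T\<^sup>2 * ((u (n + 1) x + - 2 * u n x) + u (n - 1) x)) \<in> sobolev_H1 \<Omega>"
      by (intro x.scale(1) x.add x.comb that)
    moreover have "second_diff \<Delta>T u n = (\<lambda>x. 1 / \<Delta>T\<^sup>2 * ((u (n + 1) x + - 2 * u n x) + u (n - 1) x))"
      by (simp add: second_diff_def fun_eq_iff)
    ultimately show ?thesis by simp
  qed
  have w: "?w1 \<in> sobolev_H1 \<Omega>" "?w2 \<in> sobolev_H1 \<Omega>" by (rule sdH; rule h1 h2)+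
  note nw = nrm_bound[OF sobolev_H1_wgrad(1)[OF w(1)]] nrm_bound[OF sobolev_H1_wgrad(1)[OF w(2)]]
  define E1 where "E1 = a_norm \<Omega> \<kappa> y1 + a_norm \<Omega> \<kappa> y2 + \<Delta>T * nrm ?w2"
  define E2 where "E2 = a_norm \<Omega> \<kappa> y1 + a_norm \<Omega> \<kappa> y2 + \<Delta>T * nrm ?w1"
  have a0: "0 \<le> a_norm \<Omega> \<kappa> y1" "0 \<le> a_norm \<Omega> \<kappa> y2" using xn_props(5) y by auto
  have E: "0 \<le> E1" "0 \<le> E2" unfolding E1_def E2_def using a0 nw(1,3) \<tau> by auto
  have dq: "(\<lambda>x. (u k x - u j x) / \<Delta>T) \<in> sobolev_H1 \<Omega>" if "u k \<in> sobolev_H1 \<Omega>" "u j \<in> sobolev_H1 \<Omega>"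
    for u :: "nat \<Rightarrow> 'a \<Rightarrow> real" and k j
    using x.scale(1)[OF x.diff[OF that], of "1 / \<Delta>T"] by simp
  have steps: "1 \<le> n \<and> n < N" using n by simp
  have e1: "l2_inner \<Omega> g v - l2_inner \<Omega> d v - a_form \<Omega> \<kappa> (?U t) v \<le> E1 * xn v"
    if t: "t \<in> I" and v: "v \<in> V1" for t v
  proof -
    \<comment> \<open>The relative position of \<open>t\<close> in the slab.\<close>
    define \<sigma> where "\<sigma> = (t - T n) / \<Delta>T"
    have \<sigma>: "0 \<le> \<sigma>" "\<sigma> \<le> 1" using t Tn \<tau> by (auto simp: \<sigma>_def divide_le_eq)
    have v10: "v \<in> sobolev_H10 \<Omega>" using v V1 by blast
    have "l2_inner \<Omega> g v = l2_inner \<Omega> (f (T (n + 1))) v"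
      by (rule g(2)) (use v V1_VH VH_eq in blast)
    also have "\<dots> = l2_inner \<Omega> (\<lambda>x. (u1 (n + 1) x - u1 n x) / \<Delta>T) v + l2_inner \<Omega> (\<lambda>x. (u2 n x - u2 (n - 1) x) / \<Delta>T) v
        + a_form \<Omega> \<kappa> (\<lambda>x. u1 (n + 1) x + u2 n x) v"
      using sch v steps unfolding splitting_scheme_def by simp
    finally have gv: "l2_inner \<Omega> g v = l2_inner \<Omega> (\<lambda>x. (u1 (n + 1) x - u1 n x) / \<Delta>T) v
        + l2_inner \<Omega> (\<lambda>x. (u2 n x - u2 (n - 1) x) / \<Delta>T) v + a_form \<Omega> \<kappa> (\<lambda>x. u1 (n + 1) x + u2 n x) v" .
    have "l2_inner \<Omega> (\<lambda>x. (u1 (n + 1) x - u1 n x) / \<Delta>T) v + l2_inner \<Omega> (\<lambda>x. (u2 n x - u2 (n - 1) x) / \<Delta>T) v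
        + a_form \<Omega> \<kappa> (\<lambda>x. u1 (n + 1) x + u2 n x) v - l2_inner \<Omega> d v - a_form \<Omega> \<kappa> (?U t) v
      \<le> (a_norm \<Omega> \<kappa> y1 + a_norm \<Omega> \<kappa> y2 + \<Delta>T * nrm ?w2) * xn v"
    proof (rule consistency_bound[OF dq[of u1, OF h1(3,2)] dq[of u2, OF h2(2,1)] dH x.add[OF h1(3) h2(2)] UH y w(2) V1_H1[OF v]])
      fix x
      \<comment> \<open>The quotient of the first component cancels against its part of
        \<open>d\<close>. For the second component the scheme uses the quotient of the preceding
        step, and the lag is a second difference times the step.\<close>
      show "(u1 (n + 1) x - u1 n x) / \<Delta>T + (u2 n x - u2 (n - 1) x) / \<Delta>T - d x = - \<Delta>T * ?w2 x"
        using \<tau> by (simp add: d_def q_def y1_def y2_def second_diff_def field_simps power2_eq_square)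
      show "u1 (n + 1) x + u2 n x - ?U t x = (1 - \<sigma>) * y1 x + - \<sigma> * y2 x"
        unfolding U len \<sigma>_def[symmetric] by (simp add: p_def q_def y1_def y2_def algebra_simps)
    qed (use \<sigma> \<tau> nw(4)[OF v10] in auto)
    then show ?thesis unfolding gv E1_def by simp
  qed
  have e2: "l2_inner \<Omega> g v - l2_inner \<Omega> d v - a_form \<Omega> \<kappa> (?U t) v \<le> E2 * xn v"
    if t: "t \<in> I" and v: "v \<in> V2" for t v
  proof -
    define \<sigma> where "\<sigma> = (t - T n) / \<Delta>T"
    have \<sigma>: "0 \<le> \<sigma>" "\<sigma> \<le> 1" using t Tn \<tau> by (auto simp: \<sigma>_def divide_le_eq)
    have v10: "v \<in> sobolev_H10 \<Omega>" using v V2 by blast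
    let ?P = "\<lambda>x. (1 - \<omega>) * u1 n x + \<omega> * u1 (n + 1) x + u2 n x"
    have PH: "?P \<in> sobolev_H1 \<Omega>" by (intro x.add x.comb x.scale(1) h1 h2)
    have "l2_inner \<Omega> g v = l2_inner \<Omega> (f (T (n + 1))) v"
      by (rule g(2)) (use v V2_VH VH_eq in blast)
    also have "\<dots> = l2_inner \<Omega> (\<lambda>x. (u2 (n + 1) x - u2 n x) / \<Delta>T) v + l2_inner \<Omega> (\<lambda>x. (u1 n x - u1 (n - 1) x) / \<Delta>T) v
        + a_form \<Omega> \<kappa> ?P v"
      using sch v steps unfolding splitting_scheme_def by simp
    finally have gv: "l2_inner \<Omega> g v = l2_inner \<Omega> (\<lambda>x. (u2 (n + 1) x - u2 n x) / \<Delta>T) v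
        + l2_inner \<Omega> (\<lambda>x. (u1 n x - u1 (n - 1) x) / \<Delta>T) v + a_form \<Omega> \<kappa> ?P v" .
    have "l2_inner \<Omega> (\<lambda>x. (u2 (n + 1) x - u2 n x) / \<Delta>T) v + l2_inner \<Omega> (\<lambda>x. (u1 n x - u1 (n - 1) x) / \<Delta>T) v
        + a_form \<Omega> \<kappa> ?P v - l2_inner \<Omega> d v - a_form \<Omega> \<kappa> (?U t) v
      \<le> (a_norm \<Omega> \<kappa> y1 + a_norm \<Omega> \<kappa> y2 + \<Delta>T * nrm ?w1) * xn v"
    proof (rule consistency_bound[OF dq[of u2, OF h2(3,2)] dq[of u1, OF h1(2,1)] dH PH UH y w(1) V2_H1[OF v]])
      fix x
      show "(u2 (n + 1) x - u2 n x) / \<Delta>T + (u1 n x - u1 (n - 1) x) / \<Delta>T - d x = - \<Delta>T * ?w1 x"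
        using \<tau> by (simp add: d_def q_def y1_def y2_def second_diff_def field_simps power2_eq_square)
      \<comment> \<open>Both \<omega> and \<sigma> lie in [0, 1], so the two coefficients have
        modulus at most 1.\<close>
      show "?P x - ?U t x = (\<omega> - \<sigma>) * y1 x + - \<sigma> * y2 x"
        unfolding U len \<sigma>_def[symmetric] by (simp add: p_def q_def y1_def y2_def algebra_simps)
    qed (use \<sigma> \<omega> \<tau> nw(2)[OF v10] in auto)
    then show ?thesis unfolding gv E2_def by simp
  qed
  let ?h1 = "eta1 nrm \<Omega> \<kappa> ?g \<Delta>T u1 u2 n" and ?h2 = "eta2 nrm \<Omega> \<kappa> ?g \<omega> \<Delta>T u1 u2 n"
  let ?M = "8 * (1 - gamma_X \<Omega> \<kappa> ?I V1 V2) powr (- 1 / 2) * sqrt (?h1\<^sup>2 + ?h2\<^sup>2)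
            + 1 * L2L2_norm \<Omega> ?I (\<lambda>t x. f t x - F t x)"
  \<comment> \<open>There is at least one fracture, hence at least one block.\<close>
  have i: "1 \<in> {1..Nc}"
    using nf by (cases "Nc = 0") (auto simp: num_fractures_def)
  \<comment> \<open>C_omega is (\<omega> - 1/2)^2 + 1/12. The sign matters because the square root
    of a negative number is negative here, not undefined.\<close>
  have C0: "0 \<le> C_omega \<omega>"
    using zero_le_power2[of "\<omega> - 1 / 2"] by (simp add: C_omega_def power2_eq_square algebra_simps)
  show "residual_dual_norm \<Omega> \<kappa> ?I VH f ?U \<le> ?M"
    unfolding VH_eq slab
  proof (rule residual_dual_norm_le)
    \<comment> \<open>In the spanning family of \<open>V2\<close> the index 0 is reserved for
      \<open>psi_bar\<close>, so index 1 is the matrix basis function of the first block, the vector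
      of positive norm.\<close>
    have "(\<lambda>i. if i = 0 then psi_bar Nc m \<psi> else \<psi> i 0) 1 \<in> V2"
      unfolding V2_eq V_H2_def by (rule lin_span_member) (use i in auto)
    then have \<psi>1: "\<psi> 1 0 \<in> V2" by simp
    then show "\<psi> 1 0 \<in> space_sum V1 V2" by (rule V2_VH)
    show "0 < xn (\<psi> 1 0)"
      using l2_norm_psi_pos[OF O(1,2) \<psi> part i] xn_props(2)[OF V2_H1[OF \<psi>1]] by linarith
    fix v assume v: "v \<in> bochner_L2 I (H1_norm \<Omega>) (space_sum V1 V2)" "X_norm \<Omega> \<kappa> I v = 1"
    have g1: "0 < 1 - gX" using gamma_X_less by simp
    have pw: "(1 - gX) powr (- 1 / 2) = 1 / sqrt (1 - gX)"
      using powr_minus_divide[of "1 - gX" "1 / 2"] g1 by (simp add: powr_half_sqrt)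
    have fn: "f \<in> bochner_L2 I (l2_norm \<Omega>) (L2 \<Omega>)" using f n(2) slab by metis
    have "residual \<Omega> \<kappa> I f ?U v
        \<le> sqrt (E1\<^sup>2 + E2\<^sup>2) / sqrt (1 - gX) * sqrt (T (Suc n) - T n) + L2L2_norm \<Omega> I (\<lambda>t x. f t x - F t x)"
      by (rule residual_bound[OF fn g(1)[unfolded VH_eq] g(3)[unfolded slab] dV[unfolded VH_eq] dU pV[unfolded VH_eq] qV[unfolded VH_eq]
            U E e1 e2 v])
    also have "sqrt (E1\<^sup>2 + E2\<^sup>2) / sqrt (1 - gX) * sqrt (T (Suc n) - T n) = (sqrt (E1\<^sup>2 + E2\<^sup>2) * sqrt \<Delta>T) / sqrt (1 - gX)"
      by (simp add: len)
    also have "\<dots> \<le> (8 * sqrt (?h1\<^sup>2 + ?h2\<^sup>2)) / sqrt (1 - gX)"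
    proof (rule divide_right_mono)
      show "sqrt (E1\<^sup>2 + E2\<^sup>2) * sqrt \<Delta>T \<le> 8 * sqrt (?h1\<^sup>2 + ?h2\<^sup>2)"
        unfolding E1_def E2_def eta1_def eta2_def y1_def[abs_def, symmetric] y2_def[abs_def, symmetric]
        by (rule indicator_bound[OF \<tau> gamma_const_nonneg C0 a0 nw(1,3)])
    qed (use g1 in simp)
    finally show "residual \<Omega> \<kappa> I f ?U v \<le> 8 * (1 - gX) powr (- 1 / 2) * sqrt (?h1\<^sup>2 + ?h2\<^sup>2)
            + 1 * L2L2_norm \<Omega> I (\<lambda>t x. f t x - F t x)"
      unfolding pw by simp
  qed
qed

end
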